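(* Let $a\in(0,1)$. For any arclength-parameterized geodesic $R_t$ with $R_0=\mathrm{Id}$ and initial covector $p_0$ of the left-invariant sub-Riemannian problem on $\mathrm{SO}(3)$ with orthonormal frame $X_1=A_2$, $X_2=\sqrt{1-a^2}A_1$, the cut time $t_{cut}$ satisfies the following bounds: 1. if $p_0\in C_1$: $t_{cut}\le 2K(k^2)/a+\pi$; 2. if $p_0\in C_2$: $t_{cut}\le 2kK(k^2)/a+\pi$; 3. if $p_0\in C_3$: $t_{cut}\le \pi/\sqrt{1-a^2}+\pi$; 4. if $p_0\in C_4$: $t_{cut}\le 2\pi$; 5. if $p_0\in C_5$: $t_{cut}\le \pi/\sqrt{1-a^2}+\pi$.
   Context: $A_1,A_2,A_3$ is the standard basis of $\mathfrak{so}(3)$: $A_1=\begin{pmatrix}0&0&0\\0&0&-1\\0&1&0\end{pmatrix}$, $A_2=\begin{pmatrix}0&0&1\\0&0&0\\-1&0&0\end{pmatrix}$, $A_3=\begin{pmatrix}0&-1&0\\1&0&0\\0&0&0\end{pmatrix}$. Fix $a\in(0,1)$, $X_1=A_2$, $X_2=\sqrt{1-a^2}A_1$. A Lipschitz curve in $\mathrm{SO}(3)$ is horizontal if $\dot R=R(u_1X_1+u_2X_2)$ a.e.; its length is $\int\sqrt{u_1^2+u_2^2}\,dt$. Arclength-parameterized geodesics from $\mathrm{Id}$ are the curves $R_t$ for which there is $p_t=(p_1,p_2,p_3)\in\mathbb{R}^3$ with $$\dot R=R(p_1X_1+p_2X_2),\quad R_0=\mathrm{Id},\qquad \dot p_1=p_3p_2,\quad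 \dot p_2=-p_3p_1,\quad \dot p_3=a^2p_1p_2,\qquad p_1^2+p_2^2=1.$$ The initial covector is $p_0=(p_1(0),p_2(0),p_3(0))$. The cut time is the supremum of $t>0$ such that $R_s$, $s\in[0,t]$, has minimal length among horizontal curves from $\mathrm{Id}$ to $R_t$. Regions: on $\{p_1^2+p_2^2=1\}$ write $p_1=\cos\psi$, $p_2=-\sin\psi$, $E=2p_3^2-a^2\cos2\psi$ (conserved). $C_1=\{E\in(-a^2,a^2)\}$, $C_2=\{E>a^2\}$, $C_3=\{E=a^2,\ p_3\ne0\}$, $C_4=\{E=-a^2\}$, $C_5=\{E=a^2,\ p_3=0\}$. The modulus $k\in(0,1)$ is given by $k^2=\frac{E+a^2}{2a^2}$ in $C_1$ and $k^2=\frac{2a^2}{E+a^2}$ in $C_2$. $K(k^2)=\int_0^{\pi/2}\frac{d\theta}{\sqrt{1-k^2\sin^2\theta}}$. *)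

theory Defs
  imports "HOL-Analysis.Analysis"
begin

definition SO3 :: "(real^3^3) set" where
  "SO3 = {R. orthogonal_matrix R \<and> det R = 1}"

definition A1 :: "real^3^3" where
  "A1 = vector [vector [0, 0, 0], vector [0, 0, -1], vector [0, 1, 0]]"

definition A2 :: "real^3^3" where
  "A2 = vector [vector [0, 0, 1], vector [0, 0, 0], vector [-1, 0, 0]]"

definition A3 :: "real^3^3" where
  "A3 = vector [vector [0, -1, 0], vector [1, 0, 0], vector [0, 0, 0]]"

definition X1 :: "real^3^3" where
  "X1 = A2"

definition X2 :: "real \<Rightarrow> real^3^3" where
  "X2 a = sqrt (1 - a\<^sup>2) *\<^sub>R A1"

definition horizontal ::
  "real \<Rightarrow> real \<Rightarrow> (real \<Rightarrow> real^3^3) \<Rightarrow> (real \<Rightarrow> real) \<Rightarrow> (real \<Rightarrow> real) \<Rightarrow> bool" where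
  "horizontal a T R u1 u2 \<longleftrightarrow>
     0 \<le> T \<and>
     (\<forall>t\<in>{0..T}. R t \<in> SO3) \<and>
     (\<exists>L. L-lipschitz_on {0..T} R) \<and>
     (AE t in lebesgue. t \<in> {0..T} \<longrightarrow>
        (R has_vector_derivative R t ** (u1 t *\<^sub>R X1 + u2 t *\<^sub>R X2 a)) (at t within {0..T}))"

(* For 0 < a < 1 the controls of a horizontal curve are determined up to a null set, and they are
   Lebesgue measurable and essentially bounded because the curve is Lipschitz.  Hence this integral
   exists and depends only on the curve. *)
definition control_length :: "real \<Rightarrow> (real \<Rightarrow> real) \<Rightarrow> (real \<Rightarrow> real) \<Rightarrow> real" where
  "control_length T u1 u2 = (LINT t:{0..T}|lebesgue. sqrt ((u1 t)\<^sup>2 + (u2 t)\<^sup>2))"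

(* Competitors may be defined on an interval of any length, since length does not depend on the
   parametrization. *)
definition length_minimizing :: "real \<Rightarrow> real \<Rightarrow> (real \<Rightarrow> real^3^3) \<Rightarrow> bool" where
  "length_minimizing a T R \<longleftrightarrow>
     (\<exists>u1 u2. horizontal a T R u1 u2 \<and>
        (\<forall>S Q v1 v2. horizontal a S Q v1 v2 \<and> Q 0 = R 0 \<and> Q S = R T \<longrightarrow>
           control_length T u1 u2 \<le> control_length S v1 v2))"

(* Extended-real valued, so that a curve minimizing for all times has cut time infinity. *)
definition cut_time :: "real \<Rightarrow> (real \<Rightarrow> real^3^3) \<Rightarrow> ereal" where
  "cut_time a R = Sup {ereal t | t. t > 0 \<and> length_minimizing a t R}"

definition arclength_geodesic ::
  "real \<Rightarrow> (real \<Rightarrow> real^3^3) \<Rightarrow> (real \<Rightarrow> real^3) \<Rightarrow> bool" where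
  "arclength_geodesic a R p \<longleftrightarrow>
     R 0 = mat 1 \<and>
     (\<forall>t\<ge>0.
        R t \<in> SO3 \<and>
        (R has_vector_derivative R t ** (p t $ 1 *\<^sub>R X1 + p t $ 2 *\<^sub>R X2 a)) (at t within {0..}) \<and>
        ((\<lambda>s. p s $ 1) has_real_derivative p t $ 3 * p t $ 2) (at t within {0..}) \<and>
        ((\<lambda>s. p s $ 2) has_real_derivative - (p t $ 3 * p t $ 1)) (at t within {0..}) \<and>
        ((\<lambda>s. p s $ 3) has_real_derivative a\<^sup>2 * p t $ 1 * p t $ 2) (at t within {0..}) \<and>
        (p t $ 1)\<^sup>2 + (p t $ 2)\<^sup>2 = 1)"

definition cylinder :: "(real^3) set" where
  "cylinder = {p. (p $ 1)\<^sup>2 + (p $ 2)\<^sup>2 = 1}"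

(* On the cylinder the angle exists and is unique modulo 2 pi; see energy_eq for independence
   of the choice. *)
definition psi :: "real^3 \<Rightarrow> real" where
  "psi p = (SOME \<psi>. p $ 1 = cos \<psi> \<and> p $ 2 = - sin \<psi>)"

definition energy :: "real \<Rightarrow> real^3 \<Rightarrow> real" where
  "energy a p = 2 * (p $ 3)\<^sup>2 - a\<^sup>2 * cos (2 * psi p)"

definition C1 :: "real \<Rightarrow> (real^3) set" where
  "C1 a = {p \<in> cylinder. energy a p \<in> {-a\<^sup>2<..<a\<^sup>2}}"

definition C2 :: "real \<Rightarrow> (real^3) set" where
  "C2 a = {p \<in> cylinder. energy a p > a\<^sup>2}"

definition C3 :: "real \<Rightarrow> (real^3) set" where
  "C3 a = {p \<in> cylinder. energy a p = a\<^sup>2 \<and> p $ 3 \<noteq> 0}"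

definition C4 :: "real \<Rightarrow> (real^3) set" where
  "C4 a = {p \<in> cylinder. energy a p = -a\<^sup>2}"

definition C5 :: "real \<Rightarrow> (real^3) set" where
  "C5 a = {p \<in> cylinder. energy a p = a\<^sup>2 \<and> p $ 3 = 0}"

(* Meaningful only on C1 and C2. *)
definition modulus :: "real \<Rightarrow> real^3 \<Rightarrow> real" where
  "modulus a p =
     (if p \<in> C1 a then sqrt ((energy a p + a\<^sup>2) / (2 * a\<^sup>2))
      else if p \<in> C2 a then sqrt (2 * a\<^sup>2 / (energy a p + a\<^sup>2))
      else undefined)"

(* The argument is the parameter m = k^2, not the modulus k. *)
definition elliptic_K :: "real \<Rightarrow> real" where
  "elliptic_K m = integral {0..pi/2} (\<lambda>\<theta>. 1 / sqrt (1 - m * (sin \<theta>)\<^sup>2))"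

lemma psi_cylinder:
  assumes "p \<in> cylinder"
  shows "p $ 1 = cos (psi p)" "p $ 2 = - sin (psi p)"
proof -
  have "(p $ 1)\<^sup>2 + (- (p $ 2))\<^sup>2 = 1"
    using assms by (simp add: cylinder_def)
  then obtain t where "p $ 1 = cos t" "- (p $ 2) = sin t"
    using sincos_total_2pi by metis
  then have "\<exists>\<psi>. p $ 1 = cos \<psi> \<and> p $ 2 = - sin \<psi>"
    by (intro exI[of _ t]) simp
  then have "p $ 1 = cos (psi p) \<and> p $ 2 = - sin (psi p)"
    unfolding psi_def by (rule someI_ex)
  then show "p $ 1 = cos (psi p)" "p $ 2 = - sin (psi p)" by auto
qed

lemma energy_eq:
  assumes "p $ 1 = cos \<psi>" "p $ 2 = - sin \<psi>"
  shows "energy a p = 2 * (p $ 3)\<^sup>2 - a\<^sup>2 * cos (2 * \<psi>)"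
proof -
  have "p \<in> cylinder" using assms by (simp add: cylinder_def)
  from psi_cylinder[OF this] assms
  have "cos (psi p) = cos \<psi>" "sin (psi p) = sin \<psi>" by auto
  then show ?thesis by (simp add: energy_def cos_double)
qed

lemma modulus_C1:
  assumes "0 < a" "p \<in> C1 a"
  shows "modulus a p \<in> {0<..<1}" "(modulus a p)\<^sup>2 = (energy a p + a\<^sup>2) / (2 * a\<^sup>2)"
  using assms by (auto simp: modulus_def C1_def field_simps)

lemma modulus_C2:
  assumes "0 < a" "p \<in> C2 a"
  shows "modulus a p \<in> {0<..<1}" "(modulus a p)\<^sup>2 = 2 * a\<^sup>2 / (energy a p + a\<^sup>2)"
proof -
  have E: "energy a p > a\<^sup>2" "0 < a\<^sup>2" using assms by (auto simp: C2_def)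
  then have P: "0 < energy a p + a\<^sup>2" by linarith
  have m: "modulus a p = sqrt (2 * a\<^sup>2 / (energy a p + a\<^sup>2))"
    using E assms by (auto simp: modulus_def C1_def)
  show "(modulus a p)\<^sup>2 = 2 * a\<^sup>2 / (energy a p + a\<^sup>2)"
    unfolding m using E by (intro real_sqrt_pow2 divide_nonneg_nonneg) linarith+
  have "0 < 2 * a\<^sup>2 / (energy a p + a\<^sup>2)" "2 * a\<^sup>2 / (energy a p + a\<^sup>2) < 1"
    using E P by (simp_all add: divide_simps)
  then show "modulus a p \<in> {0<..<1}"
    unfolding m by simp
qed

end

theory Submission imports Defs begin

text \<open>Two devices bound the cut time from above.

The first is the diameter. Every rotation factors as a turn about the second axis, a turn about the
first and again a turn about the second, where the two outer angles add up to at most \<open>pi\<close> in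
absolute value (\<open>SO3_euler_angles\<close>). Turning about the second axis costs \<open>1\<close> per radian and about
the first axis \<open>1 / sqrt (1 - a\<^sup>2)\<close>, so nothing is farther from the identity than
\<open>pi + pi / sqrt (1 - a\<^sup>2)\<close>. This settles \<open>C3\<close> and \<open>C5\<close>. A geodesic in \<open>C4\<close> only turns about
the second axis, so that the middle factor is trivial and the distance is at most \<open>pi\<close>.

The second is a mirror argument. For a chord \<open>Q = transpose (R s) ** R (s + L)\<close> and a diagonal
sign matrix \<open>D\<close>, reversing the arc and conjugating it by \<open>D\<close> gives another arc of length \<open>L\<close>, whose
chord is \<open>D ** transpose Q ** D\<close>. If that equals \<open>Q\<close>, both arcs join the same points, and following
the mirrored one and then the rest of the geodesic gives a curve of the same total length. Unless the
two arcs arrive at \<open>R (s + L)\<close> with the same velocity, this curve has a corner there. A corner can be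
cut (\<open>corner_shortcut\<close>), so the geodesic is not minimizing beyond \<open>s + L\<close>
(\<open>not_minimizing_past_mirrored_chord\<close>). The symmetry of \<open>Q\<close> says that
\<open>D ** Q\<close> equals its transpose, which happens when \<open>D ** Q\<close> is a half turn, that is, when
\<open>1 + trace (D ** Q) = 0\<close>.

To find such chords, note that the momentum \<open>(p\<^sub>2, sqrt (1 - a\<^sup>2) p\<^sub>1, p\<^sub>3)\<close> of the body is constant
in space. The motion is therefore explicit up to one precession angle about it. Take an arc whose
midpoint has \<open>p\<^sub>3 = 0\<close> in \<open>C1\<close>, or \<open>p\<^sub>1 = 0\<close> in \<open>C2\<close>. The values of \<open>p\<close> at its two ends are then mirror
images of each other, and the chord is a half turn for \<open>D = 1\<close> in \<open>C1\<close> once the precession over the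
arc is \<open>pi\<close>, and for \<open>D = diag (1, -1, -1)\<close> in \<open>C2\<close> once it is \<open>2 pi\<close>. For a fixed length \<open>L\<close> the number
\<open>1 + trace (D ** Q)\<close> satisfies a homogeneous linear differential equation in the starting time \<open>s\<close>.
So it vanishes for other starting times too, whether or not the arc is placed symmetrically
(\<open>half_turn_chord_propagates\<close>).

It remains to see that the precession is fast enough. In \<open>C1\<close> half a period \<open>2 K / a\<close> of the covector
suffices (\<open>oscillating_precession_bound\<close>). In \<open>C2\<close> half a period \<open>2 k K / a\<close> followed by at most
another time \<open>pi\<close> suffices (\<open>rotating_precession_bound\<close>).\<close>

section \<open>Rotation matrices\<close>

lemmas mat3_simps = vec_eq_iff forall_3 matrix_matrix_mult_def matrix_vector_mult_def sum_3
  transpose_def mat_def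

lemma bounded_bilinear_matrix_mult:
  "bounded_bilinear ((**) :: real^3^3 \<Rightarrow> real^3^3 \<Rightarrow> real^3^3)"
proof -
  have "bilinear ((**) :: real^3^3 \<Rightarrow> real^3^3 \<Rightarrow> real^3^3)"
    unfolding bilinear_def
    by (auto intro!: linearI simp: vec_eq_iff matrix_matrix_mult_def sum_3 algebra_simps)
  then show ?thesis using bilinear_conv_bounded_bilinear by blast
qed

lemmas matrix_mult_derivative =
  bounded_bilinear.has_vector_derivative[OF bounded_bilinear_matrix_mult]

lemma transpose_derivative:
  fixes A :: "real \<Rightarrow> real^3^3"
  assumes "(A has_vector_derivative A') F"
  shows "((\<lambda>t. transpose (A t)) has_vector_derivative transpose A') F"
proof -
  have "linear (transpose :: real^3^3 \<Rightarrow> real^3^3)"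
    by (rule linearI) (simp_all add: vec_eq_iff transpose_def)
  then have "bounded_linear (transpose :: real^3^3 \<Rightarrow> real^3^3)"
    using linear_conv_bounded_linear by blast
  then show ?thesis using assms by (rule bounded_linear.has_vector_derivative)
qed

lemma entry_derivative:
  fixes A :: "real \<Rightarrow> real^3^3"
  assumes "(A has_vector_derivative A') F"
  shows "((\<lambda>t. A t $ i $ j) has_real_derivative A' $ i $ j) F"
proof -
  have "bounded_linear (\<lambda>X::real^3^3. X $ i $ j)"
    using bounded_linear_compose[OF bounded_linear_vec_nth bounded_linear_vec_nth] by blast
  from bounded_linear.has_vector_derivative[OF this assms] show ?thesis
    by (simp add: has_real_derivative_iff_has_vector_derivative)
qed

lemma derivative_from_entries:
  fixes A :: "real \<Rightarrow> real^3^3"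
  assumes "\<And>i j. ((\<lambda>t. A t $ i $ j) has_real_derivative A' $ i $ j) (at x within X)"
  shows "(A has_vector_derivative A') (at x within X)"
  unfolding has_vector_derivative_def
proof (subst has_derivative_componentwise_within, intro ballI)
  fix e :: "real^3^3" assume "e \<in> Basis"
  then obtain i j where e: "e = axis i (axis j 1)"
    by (auto simp: Basis_vec_def)
  have "((\<lambda>t. A t $ i $ j) has_derivative (\<lambda>h. h *\<^sub>R A' $ i $ j)) (at x within X)"
    using assms[of i j] by (simp add: has_field_derivative_def mult_commute_abs)
  then show "((\<lambda>t. A t \<bullet> e) has_derivative (\<lambda>t. t *\<^sub>R A' \<bullet> e)) (at x within X)"
    by (simp add: e inner_axis)
qed

definition Rx :: "real \<Rightarrow> real^3^3" where
  "Rx t = vector [vector [1, 0, 0], vector [0, cos t, - sin t], vector [0, sin t, cos t]]"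
definition Ry :: "real \<Rightarrow> real^3^3" where
  "Ry t = vector [vector [cos t, 0, sin t], vector [0, 1, 0], vector [- sin t, 0, cos t]]"
definition Rz :: "real \<Rightarrow> real^3^3" where
  "Rz t = vector [vector [cos t, - sin t, 0], vector [sin t, cos t, 0], vector [0, 0, 1]]"

definition ctrl :: "real \<Rightarrow> real \<Rightarrow> real \<Rightarrow> real^3^3" where
  "ctrl a u v = u *\<^sub>R X1 + v *\<^sub>R X2 a"

lemma ctrl_entries:
  "ctrl a u v = vector [vector [0, 0, u], vector [0, 0, - (sqrt (1 - a\<^sup>2) * v)],
     vector [- u, sqrt (1 - a\<^sup>2) * v, 0]]"
  by (simp add: ctrl_def X1_def X2_def A1_def A2_def mat3_simps algebra_simps)

lemma transpose_ctrl: "transpose (ctrl a u v) = - ctrl a u v"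
  by (simp add: ctrl_entries mat3_simps)

lemma SO3_one: "mat 1 \<in> SO3"
  by (simp add: SO3_def orthogonal_matrix_id)

lemma SO3_mult: "A \<in> SO3 \<Longrightarrow> B \<in> SO3 \<Longrightarrow> A ** B \<in> SO3"
  by (simp add: SO3_def orthogonal_matrix_mul det_mul)

lemma SO3_transpose: "A \<in> SO3 \<Longrightarrow> transpose A \<in> SO3"
  by (simp add: SO3_def orthogonal_matrix_transpose det_transpose)

lemma SO3_cancel:
  assumes "A \<in> SO3"
  shows "transpose A ** A = mat 1" "A ** transpose A = mat 1"
    "transpose A ** (A ** B) = B" "A ** (transpose A ** B) = B"
  using assms by (auto simp: SO3_def orthogonal_matrix_def matrix_mul_assoc)

lemma SO3_rotations: "Rx t \<in> SO3" "Ry t \<in> SO3" "Rz t \<in> SO3"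
  by (simp_all add: SO3_def orthogonal_matrix_def det_3 Rx_def Ry_def Rz_def mat3_simps
      flip: power2_eq_square)

lemma SO3_orthonormal:
  assumes "A \<in> SO3"
  shows "A$1$1 * A$1$1 + A$1$2 * A$1$2 + A$1$3 * A$1$3 = 1"
    "A$2$1 * A$2$1 + A$2$2 * A$2$2 + A$2$3 * A$2$3 = 1"
    "A$3$1 * A$3$1 + A$3$2 * A$3$2 + A$3$3 * A$3$3 = 1"
    "A$1$1 * A$2$1 + A$1$2 * A$2$2 + A$1$3 * A$2$3 = 0"
    "A$1$1 * A$3$1 + A$1$2 * A$3$2 + A$1$3 * A$3$3 = 0"
    "A$2$1 * A$3$1 + A$2$2 * A$3$2 + A$2$3 * A$3$3 = 0"
    "A$1$1 * A$1$1 + A$2$1 * A$2$1 + A$3$1 * A$3$1 = 1"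
    "A$1$2 * A$1$2 + A$2$2 * A$2$2 + A$3$2 * A$3$2 = 1"
    "A$1$3 * A$1$3 + A$2$3 * A$2$3 + A$3$3 * A$3$3 = 1"
    "A$1$1 * A$1$2 + A$2$1 * A$2$2 + A$3$1 * A$3$2 = 0"
    "A$1$1 * A$1$3 + A$2$1 * A$2$3 + A$3$1 * A$3$3 = 0"
    "A$1$2 * A$1$3 + A$2$2 * A$2$3 + A$3$2 * A$3$3 = 0"
  using SO3_cancel(1,2)[OF assms] by (simp_all add: mat3_simps algebra_simps)

lemma SO3_cross3:
  assumes "A \<in> SO3"
  shows "cross3 (A *v x) (A *v y) = A *v cross3 x y"
  using assms by (intro cross_rotation_matrix) (simp add: SO3_def rotation_matrix_def)

text \<open>A rotation preserves the cross product, hence it equals its own cofactor matrix.\<close>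

lemma SO3_cofactor:
  assumes "A \<in> SO3"
  shows "A$1$1 = A$2$2 * A$3$3 - A$2$3 * A$3$2"
    "A$1$2 = A$2$3 * A$3$1 - A$2$1 * A$3$3"
    "A$1$3 = A$2$1 * A$3$2 - A$2$2 * A$3$1"
    "A$2$1 = A$1$3 * A$3$2 - A$1$2 * A$3$3"
    "A$2$2 = A$1$1 * A$3$3 - A$1$3 * A$3$1"
    "A$2$3 = A$1$2 * A$3$1 - A$1$1 * A$3$2"
    "A$3$1 = A$1$2 * A$2$3 - A$1$3 * A$2$2"
    "A$3$2 = A$1$3 * A$2$1 - A$1$1 * A$2$3"
    "A$3$3 = A$1$1 * A$2$2 - A$1$2 * A$2$1"
  using SO3_cross3[OF assms, of "axis 1 1" "axis 2 1"] SO3_cross3[OF assms, of "axis 2 1" "axis 3 1"]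
    SO3_cross3[OF assms, of "axis 3 1" "axis 1 1"]
  by (simp_all add: cross3_def axis_def mat3_simps algebra_simps)

lemma SO3_entry_le:
  assumes "A \<in> SO3" shows "\<bar>A $ i $ j\<bar> \<le> 1"
proof -
  have "(A $ i $ j)\<^sup>2 \<le> 1"
    using SO3_orthonormal(1-3)[OF assms] exhaust_3[of i] exhaust_3[of j]
    by (auto simp: power2_eq_square)
      (smt (verit) zero_le_square)+
  then show ?thesis by (simp add: abs_square_le_1)
qed

section \<open>Horizontal curves of unit speed\<close>

definition unit_speed_arc ::
  "real \<Rightarrow> real \<Rightarrow> (real \<Rightarrow> real^3^3) \<Rightarrow> (real \<Rightarrow> real) \<Rightarrow> (real \<Rightarrow> real) \<Rightarrow> bool" where
  "unit_speed_arc a l Q u v \<longleftrightarrow> 0 \<le> l \<and> (\<forall>t\<in>{0..l}. Q t \<in> SO3 \<and> (u t)\<^sup>2 + (v t)\<^sup>2 = 1 \<and>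
     (Q has_vector_derivative Q t ** ctrl a (u t) (v t)) (at t within {0..l}))"

text \<open>Every competitor below is a finite concatenation of smooth arcs of unit speed, so its length is the
total time. Lengths then add up without any integration, and the symmetries of the problem need to
be checked on smooth arcs only.\<close>

inductive joined :: "real \<Rightarrow> real^3^3 \<Rightarrow> real^3^3 \<Rightarrow> real \<Rightarrow> bool" for a where
  arc: "unit_speed_arc a l Q u v \<Longrightarrow> joined a (Q 0) (Q l) l"
| trans: "joined a g h l \<Longrightarrow> joined a h k m \<Longrightarrow> joined a g k (l + m)"

lemma joined_nonneg: "joined a g h l \<Longrightarrow> 0 \<le> l"
  by (induction rule: joined.induct) (auto simp: unit_speed_arc_def)

lemma joined_refl:
  assumes "g \<in> SO3" shows "joined a g g 0"
proof -
  have "unit_speed_arc a 0 (\<lambda>_. g) (\<lambda>_. 1) (\<lambda>_. 0)"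
    using assms by (simp add: unit_speed_arc_def has_vector_derivative_def
        has_derivative_within_singleton_iff bounded_linear_scaleR_left)
  from arc[OF this] show ?thesis .
qed

lemma joined_left_mult:
  assumes "joined a g h l" "k \<in> SO3"
  shows "joined a (k ** g) (k ** h) l"
  using assms
proof (induction rule: joined.induct)
  case (arc l Q u v)
  have "unit_speed_arc a l (\<lambda>t. k ** Q t) u v"
    unfolding unit_speed_arc_def
  proof (intro conjI ballI)
    fix t assume t: "t \<in> {0..l}"
    have "((\<lambda>t. k ** Q t) has_vector_derivative k ** (Q t ** ctrl a (u t) (v t))) (at t within {0..l})"
      by (rule bounded_linear.has_vector_derivative[OF
        bounded_bilinear.bounded_linear_right[OF bounded_bilinear_matrix_mult]])
        (use arc t in \<open>simp add: unit_speed_arc_def\<close>)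
    then show "((\<lambda>t. k ** Q t) has_vector_derivative k ** Q t ** ctrl a (u t) (v t)) (at t within {0..l})"
      by (simp add: matrix_mul_assoc)
  qed (use arc in \<open>auto simp: unit_speed_arc_def SO3_mult\<close>)
  from joined.arc[OF this] show ?case .
next
  case (trans g h l k' m)
  then show ?case using joined.trans by blast
qed

lemma joined_sym:
  assumes "joined a g h l"
  shows "joined a h g l"
  using assms
proof (induction rule: joined.induct)
  case (arc l Q u v)
  have "((\<lambda>t. Q (l - t)) has_vector_derivative Q (l - t) ** ctrl a (- u (l - t)) (- v (l - t)))
      (at t within {0..l})" if t: "t \<in> {0..l}" for t
  proof -
    have lt: "l - t \<in> {0..l}" using t by auto
    have im: "(\<lambda>t. l - t) ` {0..l} = {0..l}"
      using arc by (auto simp: unit_speed_arc_def image_iff intro!: bexI[of _ "l - _"])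
    have "((\<lambda>t. l - t) has_vector_derivative - 1) (at t within {0..l})"
      by (auto intro!: derivative_eq_intros)
    moreover have "(Q has_vector_derivative Q (l - t) ** ctrl a (u (l - t)) (v (l - t)))
        (at (l - t) within (\<lambda>t. l - t) ` {0..l})"
      using arc lt by (simp add: im unit_speed_arc_def)
    ultimately have "(Q \<circ> (\<lambda>t. l - t) has_vector_derivative
        (- 1) *\<^sub>R (Q (l - t) ** ctrl a (u (l - t)) (v (l - t)))) (at t within {0..l})"
      by (rule vector_diff_chain_within)
    moreover have "(- 1) *\<^sub>R (Q (l - t) ** ctrl a (u (l - t)) (v (l - t)))
        = Q (l - t) ** ctrl a (- u (l - t)) (- v (l - t))"
      by (simp add: ctrl_entries mat3_simps algebra_simps)
    ultimately show ?thesis by (simp add: o_def)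
  qed
  then have "unit_speed_arc a l (\<lambda>t. Q (l - t)) (\<lambda>t. - u (l - t)) (\<lambda>t. - v (l - t))"
    using arc by (simp add: unit_speed_arc_def)
  from joined.arc[OF this] show ?case by simp
next
  case (trans g h l k' m)
  then show ?case using joined.trans by (metis add.commute)
qed

definition diag3 :: "real \<Rightarrow> real \<Rightarrow> real \<Rightarrow> real^3^3" where
  "diag3 x y z = vector [vector [x, 0, 0], vector [0, y, 0], vector [0, 0, z]]"

definition sign_matrix :: "real^3^3 \<Rightarrow> bool" where
  "sign_matrix D \<longleftrightarrow> D \<in> {diag3 1 1 1, diag3 1 (-1) (-1), diag3 (-1) 1 (-1), diag3 (-1) (-1) 1}"

lemma sign_matrix_SO3: "sign_matrix D \<Longrightarrow> D \<in> SO3"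
  by (auto simp: sign_matrix_def SO3_def orthogonal_matrix_def det_3 diag3_def mat3_simps)

lemma sign_matrix_transpose: "sign_matrix D \<Longrightarrow> transpose D = D"
  by (auto simp: sign_matrix_def diag3_def mat3_simps)

lemma sign_matrix_square: "sign_matrix D \<Longrightarrow> D ** D = mat 1" "sign_matrix D \<Longrightarrow> D ** (D ** A) = A"
  using SO3_cancel[of D] sign_matrix_SO3[of D] sign_matrix_transpose[of D] by metis+

lemma sign_matrix_ctrl:
  assumes "sign_matrix D"
  shows "D ** ctrl a u v ** D = ctrl a (D$2$2 * u) (D$1$1 * v)"
  using assms by (auto simp: sign_matrix_def ctrl_entries diag3_def mat3_simps)

lemma sign_matrix_entry_square:
  assumes "sign_matrix D" shows "(D$i$i)\<^sup>2 = 1"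
  using assms exhaust_3[of i] by (auto simp: sign_matrix_def diag3_def)

lemma conjugate_derivative:
  fixes Q :: "real \<Rightarrow> real^3^3"
  assumes D: "sign_matrix D" and "(Q has_vector_derivative Q t ** ctrl a u v) F"
  shows "((\<lambda>t. D ** Q t ** D) has_vector_derivative
    (D ** Q t ** D) ** ctrl a (D$2$2 * u) (D$1$1 * v)) F"
proof -
  have bl: "bounded_linear (\<lambda>X::real^3^3. D ** X ** D)"
    using bounded_linear_compose[OF bounded_bilinear.bounded_linear_left[OF bounded_bilinear_matrix_mult]
        bounded_bilinear.bounded_linear_right[OF bounded_bilinear_matrix_mult]] by blast
  have "D ** (Q t ** ctrl a u v) ** D = (D ** Q t ** D) ** (D ** ctrl a u v ** D)"
    by (simp add: sign_matrix_square(2)[OF D] flip: matrix_mul_assoc)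
  then show ?thesis
    using bounded_linear.has_vector_derivative[OF bl assms(2)] by (simp add: sign_matrix_ctrl[OF D])
qed

text \<open>Conjugation by a diagonal sign matrix only changes signs of the controls, so it preserves lengths.\<close>

lemma joined_conjugate:
  assumes "joined a g h l" "sign_matrix D"
  shows "joined a (D ** g ** D) (D ** h ** D) l"
  using assms
proof (induction rule: joined.induct)
  case (arc l Q u v)
  have "unit_speed_arc a l (\<lambda>t. D ** Q t ** D) (\<lambda>t. D$2$2 * u t) (\<lambda>t. D$1$1 * v t)"
    using arc sign_matrix_entry_square[of D]
    by (simp add: unit_speed_arc_def SO3_mult sign_matrix_SO3 power_mult_distrib conjugate_derivative)
  from joined.arc[OF this] show ?case .
next
  case (trans g h l k' m)
  then show ?case using joined.trans by blast
qed

lemma unit_speed_arc_lipschitz: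
  assumes "unit_speed_arc a l Q u v"
  shows "\<exists>L. L-lipschitz_on {0..l} Q"
proof -
  from bounded_bilinear.pos_bounded[OF bounded_bilinear_matrix_mult]
  obtain B where B: "0 < B" "\<forall>(x::real^3^3) (y::real^3^3). norm (x ** y) \<le> norm x * norm y * B"
    by auto
  have bQ: "norm (A :: real^3^3) \<le> 9" if "A \<in> SO3" for A
  proof -
    have "norm A \<le> (\<Sum>i\<in>UNIV. norm (A $ i))" unfolding norm_vec_def by (intro L2_set_le_sum) simp
    also have "\<dots> \<le> (\<Sum>i\<in>(UNIV::3 set). \<Sum>j\<in>(UNIV::3 set). \<bar>A $ i $ j\<bar>)"
      by (intro sum_mono norm_le_l1_cart)
    also have "\<dots> \<le> (\<Sum>i\<in>(UNIV::3 set). \<Sum>j\<in>(UNIV::3 set). 1)"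
      by (intro sum_mono SO3_entry_le[OF that])
    also have "\<dots> = 9" by simp
    finally show ?thesis .
  qed
  have bc: "norm (ctrl a x y) \<le> norm X1 + norm (X2 a)" if "x\<^sup>2 + y\<^sup>2 = 1" for x y
  proof -
    have "x\<^sup>2 \<le> 1" "y\<^sup>2 \<le> 1" using that zero_le_power2[of x] zero_le_power2[of y] by linarith+
    then have "\<bar>x\<bar> \<le> 1" "\<bar>y\<bar> \<le> 1" by (simp_all add: abs_square_le_1)
    have "norm (ctrl a x y) \<le> \<bar>x\<bar> * norm X1 + \<bar>y\<bar> * norm (X2 a)"
      unfolding ctrl_def using norm_triangle_ineq[of "x *\<^sub>R X1" "y *\<^sub>R X2 a"] by simp
    also have "\<dots> \<le> 1 * norm X1 + 1 * norm (X2 a)"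
      using \<open>\<bar>x\<bar> \<le> 1\<close> \<open>\<bar>y\<bar> \<le> 1\<close> by (intro add_mono mult_right_mono) auto
    finally show ?thesis by simp
  qed
  define L where "L = 9 * (norm X1 + norm (X2 a)) * B"
  have "L-lipschitz_on {0..l} Q"
  proof (rule bounded_derivative_imp_lipschitz)
    fix t assume t: "t \<in> {0..l}"
    show "(Q has_derivative (\<lambda>h. h *\<^sub>R (Q t ** ctrl a (u t) (v t)))) (at t within {0..l})"
      using assms t by (simp add: unit_speed_arc_def has_vector_derivative_def)
    have q: "norm (Q t) \<le> 9" "norm (ctrl a (u t) (v t)) \<le> norm X1 + norm (X2 a)"
      using assms t unfolding unit_speed_arc_def by (blast intro: bQ bc)+
    have "norm (Q t ** ctrl a (u t) (v t)) \<le> norm (Q t) * norm (ctrl a (u t) (v t)) * B"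
      by (rule B(2)[rule_format])
    also have "\<dots> \<le> L"
      unfolding L_def using B(1) q(2) by (intro mult_right_mono mult_mono[OF q]) simp_all
    finally have "norm (Q t ** ctrl a (u t) (v t)) \<le> L" .
    then show "onorm (\<lambda>h. h *\<^sub>R (Q t ** ctrl a (u t) (v t))) \<le> L"
      by (intro onorm_le) (simp add: mult.commute[of L] mult_left_mono)
  qed (use B(1) in \<open>simp_all add: L_def\<close>)
  then show ?thesis ..
qed

text \<open>The gluing keeps the controls of unit norm at every time. The length of the glued curve is then read
off directly, although horizontality itself holds only up to a null set.\<close>

lemma joined_horizontal:
  assumes "joined a g h l"
  shows "\<exists>Q u v. horizontal a l Q u v \<and> Q 0 = g \<and> Q l = h \<and> control_length l u v = l"
proof -
  have "\<exists>Q u v. horizontal a l Q u v \<and> Q 0 = g \<and> Q l = h \<and> (\<forall>t. (u t)\<^sup>2 + (v t)\<^sup>2 = 1)"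
    using assms
  proof (induction rule: joined.induct)
    case (arc l Q u v)
    \<comment> \<open>Outside the interval any unit vector serves as control.\<close>
    define u' v' where "u' = (\<lambda>t. if t \<in> {0..l} then u t else 1)"
      and "v' = (\<lambda>t. if t \<in> {0..l} then v t else 0)"
    have "horizontal a l Q u' v'"
      unfolding horizontal_def
    proof (intro conjI unit_speed_arc_lipschitz[OF arc] AE_I2)
      show "0 \<le> l" "\<forall>t\<in>{0..l}. Q t \<in> SO3" using arc by (auto simp: unit_speed_arc_def)
      show "t \<in> {0..l} \<longrightarrow>
          (Q has_vector_derivative Q t ** (u' t *\<^sub>R X1 + v' t *\<^sub>R X2 a)) (at t within {0..l})" for t
        using arc unfolding unit_speed_arc_def ctrl_def u'_def v'_def by simp
    qed
    moreover have "(u' t)\<^sup>2 + (v' t)\<^sup>2 = 1" for t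
      using arc by (auto simp: u'_def v'_def unit_speed_arc_def)
    ultimately show ?case by blast
  next
      let ?c = "\<lambda>u v t. u t *\<^sub>R X1 + v t *\<^sub>R X2 a"
  case (trans g h l k m)
    from trans.IH(1) obtain Q u v where
      Q: "horizontal a l Q u v" "Q 0 = g" "Q l = h" "\<And>t. (u t)\<^sup>2 + (v t)\<^sup>2 = 1" by auto
    from trans.IH(2) obtain P x y where
      P: "horizontal a m P x y" "P 0 = h" "P m = k" "\<And>t. (x t)\<^sup>2 + (y t)\<^sup>2 = 1" by auto
    define N where "N = (\<lambda>t. if t \<le> l then Q t else P (t - l))"
    define u' v' where "u' = (\<lambda>t. if t \<le> l then u t else x (t - l))"
      and "v' = (\<lambda>t. if t \<le> l then v t else y (t - l))"
    have lm: "0 \<le> l" "0 \<le> m" using Q(1) P(1) by (auto simp: horizontal_def)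
    obtain L1 L2 where L: "L1-lipschitz_on {0..l} Q" "L2-lipschitz_on {0..m} P"
      using Q(1) P(1) by (auto simp: horizontal_def)
    have tr: "((\<lambda>t. t - l) has_vector_derivative 1) F" "((\<lambda>t. t - l) has_real_derivative 1) F" for F
      by (auto intro!: derivative_eq_intros)
    have "L2-lipschitz_on {l..l+m} (\<lambda>t. P (t - l))"
      unfolding lipschitz_on_def
    proof (intro conjI ballI)
      fix r s assume "r \<in> {l..l+m}" "s \<in> {l..l+m}"
      then have "r - l \<in> {0..m}" "s - l \<in> {0..m}" by auto
      from lipschitz_onD[OF L(2) this]
      show "dist (P (r - l)) (P (s - l)) \<le> L2 * dist r s" by (simp add: dist_real_def)
    qed (use lipschitz_on_nonneg[OF L(2)] in simp)
    then have "(max L1 L2)-lipschitz_on {0..l+m} N"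
      unfolding N_def by (intro lipschitz_on_concat_max L) (simp_all add: Q(3) P(2))
    moreover have "N t \<in> SO3" if "t \<in> {0..l+m}" for t
      using that Q(1) P(1) by (auto simp: N_def horizontal_def)
    moreover have "AE t in lebesgue. t \<in> {0..l+m} \<longrightarrow>
        (N has_vector_derivative N t ** ?c u' v' t) (at t within {0..l+m})"
    proof -
      have 1: "AE t in lebesgue. t \<in> {0..l} \<longrightarrow>
        (Q has_vector_derivative Q t ** ?c u v t) (at t within {0..l})"
        using Q(1) by (simp add: horizontal_def)
      have "AE t in lebesgue. t \<in> {0..m} \<longrightarrow>
        (P has_vector_derivative P t ** ?c x y t) (at t within {0..m})"
        using P(1) by (simp add: horizontal_def)
      then obtain Z where Z: "Z \<in> null_sets lebesgue" "{t \<in> space lebesgue. \<not> (t \<in> {0..m} \<longrightarrow>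
        (P has_vector_derivative P t ** ?c x y t) (at t within {0..m}))} \<subseteq> Z"
        unfolding eventually_ae_filter by (elim bexE)
      have "(+) l ` Z \<in> null_sets lebesgue"
        using Z(1) negligible_translation by (simp add: negligible_iff_null_sets)
      then have 2: "AE t in lebesgue. t - l \<notin> Z"
      proof (rule AE_I')
        show "{t \<in> space lebesgue. \<not> t - l \<notin> Z} \<subseteq> (+) l ` Z"
        proof
          fix t assume "t \<in> {t \<in> space lebesgue. \<not> t - l \<notin> Z}"
          then show "t \<in> (+) l ` Z" by (intro image_eqI[of _ _ "t - l"]) auto
        qed
      qed
      have 3: "AE t in lebesgue. t \<notin> {l}"
        by (intro AE_not_in) (simp add: negligible_iff_null_sets[symmetric])
      show ?thesis using 1 2 3
      proof eventually_elim
        case (elim t)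
        show ?case
        proof (intro impI)
          assume t: "t \<in> {0..l+m}"
          show "(N has_vector_derivative N t ** ?c u' v' t) (at t within {0..l+m})"
          proof (cases "t < l")
            case True
            have w: "at t within {0..l+m} = at t within {0..l}"
              by (rule at_within_nhd[of _ "{..<l}"]) (use True lm t in auto)
            have "(Q has_vector_derivative Q t ** ?c u v t) (at t within {0..l})"
              using elim True t by auto
            then have "(N has_vector_derivative Q t ** ?c u v t) (at t within {0..l})"
              by (rule has_vector_derivative_transform[rotated 2]) (use True t in \<open>auto simp: N_def\<close>)
            then show ?thesis unfolding w using True by (simp add: N_def u'_def v'_def)
          next
            case False
            then have tl: "t > l" using elim by auto
            have w: "at t within {0..l+m} = at t within {l..l+m}"
              by (rule at_within_nhd[of _ "{l<..}"]) (use tl lm t in auto)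
            have "(P has_vector_derivative P (t-l) ** ?c x y (t - l))
                (at (t - l) within (\<lambda>t. t - l) ` {l..l+m})"
              using subsetD[OF Z(2), of "t - l"] elim tl t by auto
            from vector_diff_chain_within[OF tr(1) this]
            have "((\<lambda>t. P (t - l)) has_vector_derivative
                P (t-l) ** ?c x y (t - l)) (at t within {l..l+m})"
              by (simp add: o_def)
            then have "(N has_vector_derivative
                P (t-l) ** ?c x y (t - l)) (at t within {l..l+m})"
              by (rule has_vector_derivative_transform[rotated 2]) (use tl t Q(3) P(2) in \<open>auto simp: N_def\<close>)
            then show ?thesis unfolding w using tl by (simp add: N_def u'_def v'_def)
          qed
        qed
      qed
    qed
    ultimately have "horizontal a (l + m) N u' v'"
      unfolding horizontal_def using add_nonneg_nonneg[OF lm] by blast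
    moreover have "N 0 = g" "N (l + m) = k" using Q(2,3) P(2,3) lm by (auto simp: N_def)
    moreover have "(u' t)\<^sup>2 + (v' t)\<^sup>2 = 1" for t by (simp add: u'_def v'_def Q(4) P(4))
    ultimately show ?case by (intro exI[of _ N] exI[of _ u'] exI[of _ v']) simp
  qed
  then obtain Q u v where Q: "horizontal a l Q u v" "Q 0 = g" "Q l = h" "\<And>t. (u t)\<^sup>2 + (v t)\<^sup>2 = 1"
    by auto
  then have "control_length l u v = l"
    using joined_nonneg[OF assms] by (simp add: control_length_def set_lebesgue_integral_def)
  with Q show ?thesis by auto
qed

text \<open>The witness of minimality may use any controls, but two admissible pairs of controls of the same
curve agree almost everywhere, so its length is the elapsed time.\<close>

lemma length_minimizing_le_joined:
  assumes a: "0 < a" "a < 1" and geo: "arclength_geodesic a R p"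
    and min: "length_minimizing a t R" and j: "joined a (mat 1) (R t) l"
  shows "t \<le> l"
proof -
  obtain u1 u2 where h: "horizontal a t R u1 u2" and
    m: "\<And>S Q v1 v2. horizontal a S Q v1 v2 \<Longrightarrow> Q 0 = R 0 \<Longrightarrow> Q S = R t \<Longrightarrow>
      control_length t u1 u2 \<le> control_length S v1 v2"
    using min unfolding length_minimizing_def by blast
  have t0: "0 \<le> t" using h by (simp add: horizontal_def)
  have b: "sqrt (1 - a\<^sup>2) \<noteq> 0" using a power_strict_mono[of a 1 2] by simp
  have "AE s in lebesgue. s \<in> {0..t} \<longrightarrow> sqrt ((u1 s)\<^sup>2 + (u2 s)\<^sup>2) = 1"
  proof -
    have 1: "AE s in lebesgue. s \<in> {0..t} \<longrightarrow>
        (R has_vector_derivative R s ** ctrl a (u1 s) (u2 s)) (at s within {0..t})"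
      using h by (simp add: horizontal_def ctrl_def)
    have 2: "AE s in lebesgue. s \<notin> {t}"
      by (intro AE_not_in) (simp add: negligible_iff_null_sets[symmetric])
    show ?thesis using 1 2
    proof eventually_elim
      case (elim s)
      show ?case
      proof
        assume s: "s \<in> {0..t}"
        have d1: "(R has_vector_derivative R s ** ctrl a (u1 s) (u2 s)) (at s within {0..t})"
          using elim s by auto
        have "(R has_vector_derivative R s ** ctrl a (p s $ 1) (p s $ 2)) (at s within {0..})"
          and S: "R s \<in> SO3" and n: "(p s $ 1)\<^sup>2 + (p s $ 2)\<^sup>2 = 1"
          using geo s by (auto simp: arclength_geodesic_def ctrl_def)
        then have d2: "(R has_vector_derivative R s ** ctrl a (p s $ 1) (p s $ 2)) (at s within {0..t})"
          by (auto intro: has_vector_derivative_within_subset)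
        have nt: "at s within {0..t} \<noteq> bot"
          using elim s by (simp add: trivial_limit_within islimpt_Icc)
        have "R s ** ctrl a (u1 s) (u2 s) = R s ** ctrl a (p s $ 1) (p s $ 2)"
          by (rule vector_derivative_unique_within[OF nt d1 d2])
        then have "ctrl a (u1 s) (u2 s) = ctrl a (p s $ 1) (p s $ 2)"
          using SO3_cancel(3)[OF S] by metis
        then have "u1 s = p s $ 1" "u2 s = p s $ 2"
          using b by (auto simp: ctrl_entries mat3_simps)
        then show "sqrt ((u1 s)\<^sup>2 + (u2 s)\<^sup>2) = 1" using n by simp
      qed
    qed
  qed
  then have "control_length t u1 u2 = (LINT s:{0..t}|lebesgue. 1)"
    unfolding control_length_def set_lebesgue_integral_def
  proof (intro integral_cong_AE)
    assume ae: "AE s in lebesgue. s \<in> {0..t} \<longrightarrow> sqrt ((u1 s)\<^sup>2 + (u2 s)\<^sup>2) = 1"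
    show "(\<lambda>s. indicat_real {0..t} s *\<^sub>R (1::real)) \<in> borel_measurable lebesgue" by (intro borel_measurable_scaleR borel_measurable_indicator) simp_all
    then show "(\<lambda>s. indicat_real {0..t} s *\<^sub>R sqrt ((u1 s)\<^sup>2 + (u2 s)\<^sup>2)) \<in> borel_measurable lebesgue"
      by (rule borel_measurable_AE) (use ae in \<open>auto simp: indicator_def elim: eventually_mono\<close>)
    show "AE s in lebesgue. indicat_real {0..t} s *\<^sub>R sqrt ((u1 s)\<^sup>2 + (u2 s)\<^sup>2)
      = indicat_real {0..t} s *\<^sub>R 1"
      using ae by (auto simp: indicator_def elim: eventually_mono)
  qed
  then have "control_length t u1 u2 = t" using t0 by (simp add: set_lebesgue_integral_def)
  moreover obtain Q v1 v2 where "horizontal a l Q v1 v2" "Q 0 = mat 1" "Q l = R t"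
    "control_length l v1 v2 = l" using joined_horizontal[OF j] by blast
  moreover have "R 0 = mat 1" using geo by (simp add: arclength_geodesic_def)
  ultimately show ?thesis using m by metis
qed

section \<open>Cutting a corner\<close>

lemma bounded_linear_sandwich:
  fixes K L :: "real^3^3"
  shows "bounded_linear (\<lambda>X. K ** X ** L)"
  using bounded_linear_compose[OF bounded_bilinear.bounded_linear_left[OF bounded_bilinear_matrix_mult]
    bounded_bilinear.bounded_linear_right[OF bounded_bilinear_matrix_mult]] by blast

lemma Rx_derivative:
  "((\<lambda>t. Rx (c * t)) has_vector_derivative Rx (c * t) ** (c *\<^sub>R A1)) (at t within F)"
proof (rule derivative_from_entries)
  fix i j :: 3
  show "((\<lambda>t. Rx (c * t) $ i $ j) has_real_derivative (Rx (c * t) ** (c *\<^sub>R A1)) $ i $ j) (at t within F)"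
    using exhaust_3[of i] exhaust_3[of j]
    by (auto simp: Rx_def A1_def mat3_simps intro!: derivative_eq_intros)
qed

lemma Ry_derivative:
  "((\<lambda>t. Ry (c * t)) has_vector_derivative Ry (c * t) ** (c *\<^sub>R A2)) (at t within F)"
proof (rule derivative_from_entries)
  fix i j :: 3
  show "((\<lambda>t. Ry (c * t) $ i $ j) has_real_derivative (Ry (c * t) ** (c *\<^sub>R A2)) $ i $ j) (at t within F)"
    using exhaust_3[of i] exhaust_3[of j]
    by (auto simp: Ry_def A2_def mat3_simps intro!: derivative_eq_intros)
qed

lemma rotations_zero: "Rx 0 = mat 1" "Ry 0 = mat 1" "Rz 0 = mat 1"
  by (simp_all add: Rx_def Ry_def Rz_def mat3_simps)

lemma joined_Ry: "joined a (mat 1) (Ry t) \<bar>t\<bar>"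
proof -
  define s :: real where "s = (if t \<ge> 0 then 1 else - 1)"
  have "ctrl a s 0 = s *\<^sub>R A2" by (simp add: ctrl_def X1_def)
  then have "unit_speed_arc a \<bar>t\<bar> (\<lambda>r. Ry (s * r)) (\<lambda>_. s) (\<lambda>_. 0)"
    by (simp add: unit_speed_arc_def SO3_rotations Ry_derivative) (simp add: s_def)
  from joined.arc[OF this] show ?thesis by (simp add: rotations_zero s_def split: if_splits)
qed

lemma joined_Rx:
  assumes "0 < a" "a < 1"
  shows "joined a (mat 1) (Rx t) (\<bar>t\<bar> / sqrt (1 - a\<^sup>2))"
proof -
  define s :: real where "s = (if t \<ge> 0 then 1 else - 1)"
  define b where "b = sqrt (1 - a\<^sup>2)"
  have b: "b > 0" using assms power_strict_mono[of a 1 2] by (simp add: b_def)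
  have "ctrl a 0 s = (s * b) *\<^sub>R A1" by (simp add: ctrl_def X2_def b_def)
  then have "unit_speed_arc a (\<bar>t\<bar> / b) (\<lambda>r. Rx (s * b * r)) (\<lambda>_. 0) (\<lambda>_. s)"
    using b by (simp add: unit_speed_arc_def SO3_rotations Rx_derivative) (simp add: s_def)
  from joined.arc[OF this] show ?thesis using b
    by (simp add: rotations_zero s_def b_def[symmetric] split: if_splits)
qed

text \<open>A constant control turns the body about a fixed axis in the plane of the first two axes; that axis
is moved to the first one by a turn about the third.\<close>

lemma constant_control_curve:
  obtains E where "E 0 = mat 1" "\<And>t. E t \<in> SO3"
    "\<And>t F. (E has_vector_derivative E t ** ctrl a u v) (at t within F)"
    "\<And>t. 0 \<le> t \<Longrightarrow> joined a (mat 1) (E t) (sqrt (u\<^sup>2 + v\<^sup>2) * t)"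
proof -
  define b where "b = sqrt (1 - a\<^sup>2)"
  obtain r z where rz: "b * v = r * cos z" "u = r * sin z"
    using polar_Ex by metis
  define E where "E = (\<lambda>t. Rz z ** Rx (r * t) ** Rz (- z))"
  have E0: "E 0 = mat 1"
    by (simp add: E_def rotations_zero) (simp add: Rz_def mat3_simps flip: power2_eq_square)
  have ES: "E t \<in> SO3" for t by (simp add: E_def SO3_mult SO3_rotations)
  have Ed: "(E has_vector_derivative E t ** ctrl a u v) (at t within F)" for t F
  proof -
    have inv: "Rz (- z) ** Rz z = mat 1"
      by (simp add: Rz_def mat3_simps flip: power2_eq_square)
    have inv2: "Rz z ** Rz (- z) = mat 1"
      by (simp add: Rz_def mat3_simps flip: power2_eq_square)
    then have inv': "Rz z ** (Rz (- z) ** X) = X" for X :: "real^3^3"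
      by (simp add: matrix_mul_assoc)
    have "r *\<^sub>R A1 = Rz (- z) ** ctrl a u v ** Rz z"
      unfolding ctrl_entries b_def[symmetric] rz
      by (simp add: Rz_def A1_def mat3_simps algebra_simps)
       (simp add: power2_eq_square[symmetric] sin_squared_eq algebra_simps)?
    then have "Rz z ** (Rx (r * t) ** (r *\<^sub>R A1)) ** Rz (- z) = E t ** ctrl a u v"
      using inv' inv2 by (simp add: E_def flip: matrix_mul_assoc)
    moreover have bl: "bounded_linear (\<lambda>X::real^3^3. Rz z ** X ** Rz (- z))"
      by (rule bounded_linear_sandwich)
    ultimately show ?thesis
      using bounded_linear.has_vector_derivative[OF bl Rx_derivative, of r t F] by (simp add: E_def)
  qed
  have "joined a (mat 1) (E t) (sqrt (u\<^sup>2 + v\<^sup>2) * t)" if t: "0 \<le> t" for t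
  proof (cases "u\<^sup>2 + v\<^sup>2 = 0")
    case True
    then have "u = 0" "v = 0" by (auto simp: sum_power2_eq_zero_iff)
    then have "r = 0" using rz by (metis mult_eq_0_iff sin_zero_abs_cos_one abs_zero zero_neq_one mult_zero_right)
    then have "E t = mat 1" using E0 by (simp add: E_def)
    then show ?thesis using True joined_refl[OF SO3_one] by simp
  next
    case False
    define n where "n = sqrt (u\<^sup>2 + v\<^sup>2)"
    have n: "n > 0" "n\<^sup>2 = u\<^sup>2 + v\<^sup>2" using False by (auto simp: n_def add_nonneg_eq_0_iff less_le)
    have "unit_speed_arc a (n * t) (\<lambda>s. E (s / n)) (\<lambda>_. u / n) (\<lambda>_. v / n)"
      unfolding unit_speed_arc_def
    proof (intro conjI ballI ES)
      show "0 \<le> n * t" using n t by simp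
      have "(u / n)\<^sup>2 + (v / n)\<^sup>2 = n\<^sup>2 / n\<^sup>2"
        by (simp only: n(2) power_divide add_divide_distrib)
      also have "\<dots> = 1" using n(1) by simp
      finally show "(u / n)\<^sup>2 + (v / n)\<^sup>2 = 1" .
      fix s
      have "((\<lambda>s. s / n) has_vector_derivative 1 / n) (at s within {0..n*t})"
        using n(1)
        by (auto intro!: derivative_eq_intros simp flip: has_real_derivative_iff_has_vector_derivative)
      from vector_diff_chain_within[OF this Ed]
      have "((\<lambda>s. E (s / n)) has_vector_derivative (1 / n) *\<^sub>R (E (s / n) ** ctrl a u v))
          (at s within {0..n*t})" by (simp add: o_def)
      moreover have "(1 / n) *\<^sub>R (E (s / n) ** ctrl a u v) = E (s / n) ** ctrl a (u / n) (v / n)"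
        by (simp add: ctrl_entries mat3_simps diff_divide_distrib)
      ultimately show "((\<lambda>s. E (s / n)) has_vector_derivative E (s / n) ** ctrl a (u / n) (v / n))
          (at s within {0..n*t})" by simp
    qed
    from joined.arc[OF this] show ?thesis using n(1) by (simp add: E0 n_def[symmetric])
  qed
  with that E0 ES Ed show ?thesis by blast
qed

lemma cos_sin_arctan_ratio:
  fixes c s :: real
  assumes "0 < c" "c * c + s * s = 1"
  shows "cos (arctan (s / c)) = c" "sin (arctan (s / c)) = s"
proof -
  have "1 + (s / c)\<^sup>2 = (1 / c)\<^sup>2" using assms by (simp add: field_simps power2_eq_square)
  then have "sqrt (1 + (s / c)\<^sup>2) = 1 / c" using assms by (simp add: real_sqrt_unique)
  then show "cos (arctan (s / c)) = c" "sin (arctan (s / c)) = s"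
    using assms by (simp_all add: cos_arctan sin_arctan)
qed

text \<open>The two-parameter family of products \<open>Ry y ** Rx x\<close> is cut out near the identity by one equation.
This reduces the endpoint condition in \<open>corner_shortcut\<close> to a scalar one, which the intermediate
value theorem can solve.\<close>

lemma SO3_factor_Ry_Rx:
  assumes N: "N \<in> SO3" and "N$2$1 = 0" "0 < N$1$1" "0 < N$2$2"
  shows "N = Ry (arctan (- N$3$1 / N$1$1)) ** Rx (arctan (- N$2$3 / N$2$2))"
proof -
  note o = SO3_orthonormal[OF N] and c = SO3_cofactor[OF N]
  have 1: "N$1$1 * N$1$1 + (- N$3$1) * (- N$3$1) = 1" using o(7) assms by simp
  have 2: "N$2$2 * N$2$2 + (- N$2$3) * (- N$2$3) = 1" using o(2) assms by simp
  have "N$1$2 = N$3$1 * N$2$3" "N$1$3 = - (N$3$1 * N$2$2)" "N$3$2 = - (N$1$1 * N$2$3)"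
    "N$3$3 = N$1$1 * N$2$2"
    using c(2,3,8,9) assms(2) by simp_all
  then show ?thesis
    using cos_sin_arctan_ratio[OF assms(3) 1] cos_sin_arctan_ratio[OF assms(4) 2] assms(2)
    by (simp add: Rx_def Ry_def mat3_simps)
qed

lemma eventually_small_of_derivative_zero:
  assumes "(f has_real_derivative 0) (at 0 within {0..})" "0 < (k::real)"
  shows "eventually (\<lambda>h. \<bar>f h - f 0\<bar> \<le> k * h) (at_right 0)"
proof -
  obtain d where "0 < d" "\<forall>h\<in>{0..}. norm (h - 0) < d \<longrightarrow> norm (f h - f 0 - 0 * (h - 0)) \<le> k * norm (h - 0)"
    using assms unfolding has_field_derivative_def has_derivative_within_alt by blast
  then have "\<forall>h>0. h < d \<longrightarrow> \<bar>f h - f 0\<bar> \<le> k * h" by auto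
  then show ?thesis using \<open>0 < d\<close> unfolding eventually_at_right_field by auto
qed

lemma eventually_sign_of_derivative:
  fixes f :: "real \<Rightarrow> real"
  assumes "(f has_real_derivative l) (at 0 within {0..})" "f 0 = 0" 
  shows "0 < l \<Longrightarrow> eventually (\<lambda>h. 0 < f h) (at_right 0)"
    and "l < 0 \<Longrightarrow> eventually (\<lambda>h. f h < 0) (at_right 0)"
proof -
  assume "0 < l"
  from has_real_derivative_pos_inc_right[OF assms(1) this]
  show "eventually (\<lambda>h. 0 < f h) (at_right 0)"
    unfolding eventually_at_right_field using assms(2) by auto
next
  assume "l < 0"
  from has_real_derivative_neg_dec_right[OF assms(1) this]
  show "eventually (\<lambda>h. f h < 0) (at_right 0)"
    unfolding eventually_at_right_field using assms(2) by auto
qed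

lemma abs_arctan_le: "\<bar>arctan x\<bar> \<le> \<bar>x\<bar>" for x :: real
  using arctan_le_self[of "\<bar>x\<bar>"] by (simp add: abs_arctan)

lemma entry_mult_bound:
  fixes L M B :: "real^3^3"
  assumes "L \<in> SO3" "B \<in> SO3" "\<And>i j. \<bar>M $ i $ j\<bar> \<le> e"
  shows "\<bar>(L ** M ** B) $ i $ j\<bar> \<le> 9 * e"
proof -
  have e: "0 \<le> e" using assms(3)[of 1 1] by linarith
  have 1: "\<bar>(L ** M) $ i $ j\<bar> \<le> 3 * e" for i j
  proof -
    have "\<bar>L $ i $ k * M $ k $ j\<bar> \<le> e" for k
      using mult_mono[OF SO3_entry_le[OF assms(1), of i k] assms(3)[of k j]] e by (simp add: abs_mult)
    from this[of 1] this[of 2] this[of 3] show ?thesis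
      by (simp add: matrix_matrix_mult_def sum_3)
  qed
  have "\<bar>(L ** M) $ i $ k * B $ k $ j\<bar> \<le> 3 * e" for k
    using mult_mono[OF 1[of i k] SO3_entry_le[OF assms(2), of k j]] e by (simp add: abs_mult)
  from this[of 1] this[of 2] this[of 3] show ?thesis
    unfolding matrix_matrix_mult_def[of "L ** M" B] by (simp add: sum_3)
qed

text \<open>A corner between unit velocities \<open>v\<close> and \<open>u\<close> is cut by replacing a time \<open>t\<close> on each side by a move
with the constant control \<open>v + u\<close>. It saves \<open>(2 - |v + u|) t\<close> and misses the endpoint by \<open>o(t)\<close>. The
error is repaired by three small turns: two at the corner, about the first and the second axis, and
one, \<open>Z\<close>, at a later point \<open>c\<close> of the curve. Seen from the corner, the axis of \<open>Z\<close> has a component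
along the third axis, which is why one of the first two entries of the last row
of \<open>c\<close> must not vanish. The angles of
these turns are \<open>o(t)\<close> or a small multiple of \<open>t\<close>, less than what was saved.\<close>

lemma corner_shortcut:
  assumes a: "0 < a" "a < 1" and d: "0 < d"
    and A: "A 0 = mat 1" "\<And>t. t \<in> {0..d} \<Longrightarrow> A t \<in> SO3"
      "(A has_vector_derivative ctrl a v1 v2) (at 0 within {0..})"
    and B: "B 0 = mat 1" "\<And>t. t \<in> {0..d} \<Longrightarrow> B t \<in> SO3"
      "(B has_vector_derivative ctrl a u1 u2) (at 0 within {0..})"
    and unit: "v1\<^sup>2 + v2\<^sup>2 = 1" "u1\<^sup>2 + u2\<^sup>2 = 1" and ne: "(v1, v2) \<noteq> (u1, u2)"
    and c: "c \<in> SO3" "c$3$1 \<noteq> 0 \<or> c$3$2 \<noteq> 0"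
  obtains t N Z l m where "0 < t" "t < d" "Z \<in> SO3"
    "N = A t ** (c ** transpose Z ** transpose c) ** B t"
    "joined a (mat 1) N l" "joined a (mat 1) Z m" "l + m < 2 * t"
proof -
  define b where "b = sqrt (1 - a\<^sup>2)"
  have b: "0 < b" "b \<le> 1" using a power_strict_mono[of a 1 2] by (simp_all add: b_def)
  obtain E where E: "E 0 = mat 1" "\<And>t. E t \<in> SO3"
    "\<And>t F. (E has_vector_derivative E t ** ctrl a (v1 + u1) (v2 + u2)) (at t within F)"
    "\<And>t. 0 \<le> t \<Longrightarrow> joined a (mat 1) (E t) (sqrt ((v1 + u1)\<^sup>2 + (v2 + u2)\<^sup>2) * t)"
    by (rule constant_control_curve) blast
  define n where "n = sqrt ((v1 + u1)\<^sup>2 + (v2 + u2)\<^sup>2)"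
  define e where "e = 2 - n"
  have "(v1 - u1)\<^sup>2 + (v2 - u2)\<^sup>2 > 0"
    using ne by (auto simp: sum_power2_gt_zero_iff)
  moreover have "(v1 + u1)\<^sup>2 + (v2 + u2)\<^sup>2 + ((v1 - u1)\<^sup>2 + (v2 - u2)\<^sup>2) = 4"
    using unit by (simp add: power2_eq_square algebra_simps)
  ultimately have "n < sqrt (2\<^sup>2)" unfolding n_def by (intro real_sqrt_less_mono) simp
  moreover have "0 \<le> n" by (simp add: n_def)
  ultimately have e: "0 < e" "e \<le> 2" by (simp_all add: e_def)
  obtain Z Z' where Z: "Z 0 = mat 1" "\<And>t. Z t \<in> SO3" "\<And>t. \<exists>m\<le>\<bar>t\<bar> / b. joined a (mat 1) (Z t) m"
    "\<And>t i j. \<bar>(transpose (Z t) - mat 1) $ i $ j\<bar> \<le> \<bar>t\<bar>"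
    "\<And>z t F. ((\<lambda>t. Z (z * t)) has_vector_derivative Z (z * t) ** (z *\<^sub>R Z')) (at t within F)"
    "(c ** Z' ** transpose c) $ 2 $ 1 \<noteq> 0" "transpose Z' = - Z'"
  proof -
    have cos: "\<bar>cos t - 1\<bar> \<le> \<bar>t\<bar>" for t :: real
    proof -
      have "cos t = 1 - 2 * (sin (t / 2))\<^sup>2" using cos_double_sin[of "t / 2"] by simp
      moreover have "(sin (t / 2))\<^sup>2 \<le> \<bar>sin (t / 2)\<bar> * 1"
        unfolding power2_eq_square abs_mult_self_eq[symmetric, of "sin (t / 2)"]
        by (intro mult_left_mono) auto
      moreover have "\<bar>sin (t / 2)\<bar> \<le> \<bar>t / 2\<bar>" by (rule abs_sin_x_le_abs_x)
      ultimately show ?thesis using zero_le_power2[of "sin (t / 2)"] by simp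
    qed
    consider "c$3$1 \<noteq> 0" | "c$3$2 \<noteq> 0" using c(2) by blast
    then show ?thesis
    proof cases
      case 1
      show ?thesis
      proof (rule that[of Rx A1])
        show "\<exists>m\<le>\<bar>t\<bar> / b. joined a (mat 1) (Rx t) m" for t
          using joined_Rx[OF a] by (auto simp: b_def)
        show "\<bar>(transpose (Rx t) - mat 1) $ i $ j\<bar> \<le> \<bar>t\<bar>" for t i j
          using exhaust_3[of i] exhaust_3[of j] cos[of t] abs_sin_x_le_abs_x[of t]
          by (auto simp: Rx_def mat_def transpose_def)
        show "(c ** A1 ** transpose c) $ 2 $ 1 \<noteq> 0"
          using 1 SO3_cofactor(7)[OF c(1)] by (simp add: A1_def mat3_simps algebra_simps)
      qed (simp_all add: rotations_zero SO3_rotations Rx_derivative, simp add: A1_def mat3_simps)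
    next
      case 2
      show ?thesis
      proof (rule that[of Ry A2])
        show "\<exists>m\<le>\<bar>t\<bar> / b. joined a (mat 1) (Ry t) m" for t
          using joined_Ry[of a t] b mult_right_mono[of b 1 "\<bar>t\<bar>"]
          by (intro exI[of _ "\<bar>t\<bar>"]) (simp add: field_simps)
        show "\<bar>(transpose (Ry t) - mat 1) $ i $ j\<bar> \<le> \<bar>t\<bar>" for t i j
          using exhaust_3[of i] exhaust_3[of j] cos[of t] abs_sin_x_le_abs_x[of t]
          by (auto simp: Ry_def mat_def transpose_def)
        show "(c ** A2 ** transpose c) $ 2 $ 1 \<noteq> 0"
          using 2 SO3_cofactor(8)[OF c(1)] by (simp add: A2_def mat3_simps algebra_simps)
      qed (simp_all add: rotations_zero SO3_rotations Ry_derivative, simp add: A2_def mat3_simps)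
    qed
  qed
  define lam where "lam = (c ** Z' ** transpose c) $ 2 $ 1"
  define F where "F = (\<lambda>z t. (transpose (E t) ** A t) ** (c ** transpose (Z (z * t)) ** transpose c) ** B t)"
  \<comment> \<open>The turns will have total angle at most \<open>(4 k + 325 z0) t < b e t\<close>.\<close>
  define k where "k = b * e / 16"
  define z0 where "z0 = b * e / 1000"
  have pos: "0 < k" "0 < z0" using b e by (simp_all add: k_def z0_def)
  have EA: "((\<lambda>t. transpose (E t) ** A t) has_vector_derivative
      ctrl a v1 v2 - ctrl a (v1 + u1) (v2 + u2)) (at 0 within {0..})"
    using matrix_mult_derivative[OF transpose_derivative[OF E(3)] A(3)]
    by (simp add: E(1) A(1) transpose_ctrl matrix_transpose_mul transpose_mat)
  have cZ: "((\<lambda>t. c ** transpose (Z (z * t)) ** transpose c) has_vector_derivative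
      c ** transpose (z *\<^sub>R Z') ** transpose c) (at 0 within {0..})" for z
  proof -
    have bl: "bounded_linear (\<lambda>X::real^3^3. c ** X ** transpose c)"
      by (rule bounded_linear_sandwich)
    show ?thesis
      using bounded_linear.has_vector_derivative[OF bl transpose_derivative[OF Z(5)[of z 0]]]
      by (simp add: Z(1))
  qed
  have ctrl_add: "ctrl a (v1 + u1) (v2 + u2) = ctrl a v1 v2 + ctrl a u1 u2"
    by (simp add: ctrl_def algebra_simps)
  have c1: "c ** mat 1 ** transpose c = mat 1"
    using SO3_cancel[OF c(1)] by simp
  have F': "(F z has_vector_derivative (c ** transpose (z *\<^sub>R Z') ** transpose c)) (at 0 within {0..})" for z
    using matrix_mult_derivative[OF matrix_mult_derivative[OF EA cZ[of z]] B(3)]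
    by (simp add: F_def[abs_def] E(1) A(1) B(1) Z(1) transpose_mat c1 SO3_cancel(2)[OF c(1)] ctrl_add)
  have W': "((\<lambda>t. transpose (E t) ** A t ** B t) has_vector_derivative 0) (at 0 within {0..})"
    using matrix_mult_derivative[OF EA B(3)]
    by (simp add: E(1) A(1) B(1) transpose_mat ctrl_add)
  have F0: "F z 0 = mat 1" for z by (simp add: F_def E(1) A(1) B(1) Z(1) transpose_mat SO3_cancel(2)[OF c(1)])
  have cZc: "(c ** transpose (z *\<^sub>R Z') ** transpose c) $ 2 $ 1 = - z * lam" for z
  proof -
    have "transpose (z *\<^sub>R Z') = z *\<^sub>R transpose Z'"
      by (simp add: vec_eq_iff transpose_def)
    then have "transpose (z *\<^sub>R Z') = (- z) *\<^sub>R Z'" by (simp add: Z(7))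
    moreover have "c ** ((- z) *\<^sub>R Z') ** transpose c = (- z) *\<^sub>R (c ** Z' ** transpose c)"
      by (rule linear_scale[OF bounded_linear.linear[OF bounded_linear_sandwich]])
    ultimately show ?thesis by (simp add: lam_def)
  qed
  have der: "((\<lambda>t. F z t $ 2 $ 1) has_real_derivative - z * lam) (at 0 within {0..})" for z
    using entry_derivative[OF F', of z 2 1] by (simp only: cZc)
  define s where "s = sgn lam"
  have lam: "lam \<noteq> 0" using Z(6) by (simp add: lam_def)
  then have s: "s * lam > 0" "\<bar>s\<bar> = 1" by (simp_all add: s_def sgn_if)
  have F00: "F z 0 $ 2 $ 1 = 0" for z by (simp add: F0 mat_def)
  \<comment> \<open>For small \<open>t\<close> the entry that must vanish has opposite signs at the two extreme turns \<open>Z\<close>.\<close>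
  have neg: "eventually (\<lambda>t. F (s * z0) t $ 2 $ 1 < 0) (at_right 0)"
    by (rule eventually_sign_of_derivative(2)[OF der F00]) (use mult_pos_pos[OF s(1) pos(2)] in \<open>simp add: mult_ac\<close>)
  have pos': "eventually (\<lambda>t. 0 < F (s * (- z0)) t $ 2 $ 1) (at_right 0)"
    by (rule eventually_sign_of_derivative(1)[OF der F00]) (use mult_pos_pos[OF s(1) pos(2)] in \<open>simp add: mult_ac\<close>)
  define W where "W = (\<lambda>t. transpose (E t) ** A t ** B t)"
  have W0: "W 0 = mat 1" by (simp add: W_def E(1) A(1) B(1) transpose_mat)
  have "eventually (\<lambda>t. \<bar>W t $ i $ j - W 0 $ i $ j\<bar> \<le> k * t) (at_right 0)" for i j
    by (rule eventually_small_of_derivative_zero[OF _ pos(1)])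
      (use entry_derivative[OF W', of i j] in \<open>simp add: W_def\<close>)
  then have Ws: "eventually (\<lambda>t. \<forall>i j. \<bar>(W t - mat 1) $ i $ j\<bar> \<le> k * t) (at_right 0)"
    by (simp add: W0 forall_3 eventually_conj_iff)
  have small: "eventually (\<lambda>t::real. 0 < t \<and> t < min 1 d) (at_right 0)"
    using d by (intro eventually_conj eventually_at_right_less eventually_at_rightI[of 0 "min 1 d"]) auto
  have "eventually (\<lambda>t. F (s * z0) t $ 2 $ 1 < 0 \<and> 0 < F (s * (- z0)) t $ 2 $ 1 \<and>
      (\<forall>i j. \<bar>(W t - mat 1) $ i $ j\<bar> \<le> k * t) \<and> 0 < t \<and> t < min 1 d) (at_right 0)"
    by (intro eventually_conj neg pos' Ws small)
  then obtain t where t: "F (s * z0) t $ 2 $ 1 < 0" "0 < F (s * (- z0)) t $ 2 $ 1"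
    "\<And>i j. \<bar>(W t - mat 1) $ i $ j\<bar> \<le> k * t" "0 < t" "t < 1" "t < d"
    by (auto dest: eventually_happens'[OF trivial_limit_at_right_real])
  have cont: "continuous_on {- z0..z0} (\<lambda>z. F (s * z) t $ 2 $ 1)"
  proof (rule DERIV_continuous_on)
    fix z
    have "((\<lambda>z. Z (s * t * z)) has_vector_derivative Z (s * t * z) ** ((s * t) *\<^sub>R Z')) (at z within {-z0..z0})"
      by (rule Z(5))
    note this' = transpose_derivative[OF this]
    have bl: "bounded_linear (\<lambda>X::real^3^3. (transpose (E t) ** A t) ** (c ** X ** transpose c) ** B t)"
      by (rule bounded_linear_compose[OF bounded_linear_sandwich bounded_linear_sandwich])
    from entry_derivative[OF bounded_linear.has_vector_derivative[OF bl this'], of 2 1]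
    show "((\<lambda>z. F (s * z) t $ 2 $ 1) has_real_derivative
      ((transpose (E t) ** A t) ** (c ** transpose (Z (s * t * z) ** ((s * t) *\<^sub>R Z')) ** transpose c) ** B t) $ 2 $ 1)
      (at z within {- z0..z0})"
      unfolding F_def by (simp only: mult.assoc mult.commute[of z t for z])
  qed
  obtain z where z: "- z0 \<le> z" "z \<le> z0" "F (s * z) t $ 2 $ 1 = 0"
    using IVT2'[of "\<lambda>z. F (s * z) t $ 2 $ 1" z0 0 "- z0"] t(1,2) cont pos by auto
  define P where "P = F (s * z) t"
  define h where "h = s * z * t"
  have h: "\<bar>h\<bar> \<le> z0 * t" using s(2) z t(4) by (simp add: h_def abs_mult mult_right_mono)
  have At: "A t \<in> SO3" "B t \<in> SO3" using A(2) B(2) t by auto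
  have EAt: "transpose (E t) ** A t \<in> SO3" using At E(2) by (simp add: SO3_mult SO3_transpose)
  have PS: "P \<in> SO3"
    unfolding P_def F_def by (intro SO3_mult SO3_transpose E(2) At c(1) Z(2))
  have near: "\<bar>P $ i $ j - mat 1 $ i $ j\<bar> \<le> (k + 81 * z0) * t" for i j
  proof -
    have "P - W t = (transpose (E t) ** A t) ** (c ** (transpose (Z h) - mat 1) ** transpose c) ** B t"
    proof -
      have "c ** (transpose (Z h) - mat 1) ** transpose c
          = c ** transpose (Z h) ** transpose c - c ** mat 1 ** transpose c"
        by (rule linear_diff[OF bounded_linear.linear[OF bounded_linear_sandwich]])
      then have "(transpose (E t) ** A t) ** (c ** (transpose (Z h) - mat 1) ** transpose c) ** B t
          = (transpose (E t) ** A t) ** (c ** transpose (Z h) ** transpose c) ** B t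
          - (transpose (E t) ** A t) ** mat 1 ** B t"
        unfolding c1 by (simp only: linear_diff[OF bounded_linear.linear[OF bounded_linear_sandwich]])
      then show ?thesis by (simp add: P_def F_def W_def h_def)
    qed
    moreover have "\<bar>((transpose (E t) ** A t) ** (c ** (transpose (Z h) - mat 1) ** transpose c) ** B t) $ i $ j\<bar>
        \<le> 9 * (9 * (z0 * t))"
      using order.trans[OF Z(4) h] by (intro entry_mult_bound EAt At c(1) SO3_transpose)
    ultimately have "\<bar>(P - W t) $ i $ j\<bar> \<le> 81 * z0 * t" by simp
    with t(3)[of i j] show ?thesis by (simp add: algebra_simps)
  qed
  have be: "b * e \<le> 2" using b e mult_mono[of b 1 e 2] by simp
  have ks: "k + 81 * z0 \<le> 1/2" using be by (simp add: k_def z0_def)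
  have "(k + 81 * z0) * t \<le> 1/2 * 1"
    using ks t pos by (intro mult_mono) auto
  then have diag: "P$1$1 \<ge> 1/2" "P$2$2 \<ge> 1/2"
    using near[of 1 1] near[of 2 2] by (simp_all add: mat_def)
  have ratio: "\<bar>arctan (- x / y)\<bar> \<le> 2 * ((k + 81 * z0) * t)"
    if "y \<ge> 1/2" "\<bar>x\<bar> \<le> (k + 81 * z0) * t" for x y :: real
  proof -
    have "\<bar>arctan (- x / y)\<bar> \<le> \<bar>x\<bar> / y" using abs_arctan_le[of "- x / y"] that by simp
    also have "\<dots> \<le> \<bar>x\<bar> / (1/2)" using that by (intro divide_left_mono) auto
    finally show ?thesis using that by simp
  qed
  define y where "y = arctan (- P$3$1 / P$1$1)"
  define x where "x = arctan (- P$2$3 / P$2$2)"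
  have xy: "\<bar>y\<bar> \<le> 2 * ((k + 81 * z0) * t)" "\<bar>x\<bar> \<le> 2 * ((k + 81 * z0) * t)"
    unfolding x_def y_def using ratio[OF diag(1)] ratio[OF diag(2)] near[of 3 1] near[of 2 3]
    by (simp_all add: mat_def)
  have P: "P = Ry y ** Rx x"
    unfolding x_def y_def by (rule SO3_factor_Ry_Rx[OF PS]) (use z(3) diag in \<open>auto simp: P_def\<close>)
  obtain m where m: "m \<le> \<bar>h\<bar> / b" "joined a (mat 1) (Z h) m" using Z(3) by blast
  define N where "N = A t ** (c ** transpose (Z h) ** transpose c) ** B t"
  have "E t ** P = N"
    using SO3_cancel(4)[OF E(2)] by (simp add: P_def F_def N_def h_def flip: matrix_mul_assoc)
  then have N: "N = E t ** Ry y ** Rx x" by (simp add: P matrix_mul_assoc)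
  have j1: "joined a (mat 1) (E t) (n * t)" using E(4)[of t] t by (simp add: n_def)
  have j2: "joined a (E t) (E t ** Ry y) \<bar>y\<bar>"
    using joined_left_mult[OF joined_Ry E(2)] by simp
  have j3: "joined a (E t ** Ry y) (E t ** Ry y ** Rx x) (\<bar>x\<bar> / b)"
    using joined_left_mult[OF joined_Rx[OF a] SO3_mult[OF E(2) SO3_rotations(2)]] by (simp add: b_def)
  have j: "joined a (mat 1) N (n * t + \<bar>y\<bar> + \<bar>x\<bar> / b)"
    unfolding N by (rule joined.trans[OF joined.trans[OF j1 j2] j3])
  show thesis
  proof (rule that[OF t(4,6) Z(2) N_def j m(2)])
    have "\<bar>y\<bar> \<le> \<bar>y\<bar> / b" using b mult_right_mono[of b 1 "\<bar>y\<bar>"] by (simp add: field_simps)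
    then have "\<bar>y\<bar> + \<bar>x\<bar> / b + m \<le> (\<bar>y\<bar> + \<bar>x\<bar> + \<bar>h\<bar>) / b"
      using m(1) by (simp add: add_divide_distrib)
    also have "\<dots> \<le> ((4 * k + 325 * z0) * t) / b"
      using xy h b by (intro divide_right_mono) (auto simp: algebra_simps)
    also have "\<dots> = (23/40) * e * t" using b by (simp add: k_def z0_def field_simps)
    also have "\<dots> < e * t" using e t by simp
    finally show "n * t + \<bar>y\<bar> + \<bar>x\<bar> / b + m < 2 * t" by (simp add: e_def algebra_simps)
  qed
qed

section \<open>Euler angles and the diameter\<close>

lemma unit_vector_angle:
  fixes x y :: real
  assumes "x * x + y * y = 1"
  obtains t where "x = cos t" "y = sin t" "\<bar>t\<bar> \<le> pi"
proof -
  obtain s where s: "x = cos s" "y = sin s"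
    using assms sincos_total_2pi[of x y] by (auto simp: power2_eq_square)
  obtain t where "- pi < t" "t \<le> pi" "sin t = sin s" "cos t = cos s"
    using sincos_principal_value[of s] by auto
  with s show ?thesis by (intro that[of t]) auto
qed

lemma SO3_fixing_e2:
  assumes N: "N \<in> SO3" and "N$2$2 = 1"
  obtains t where "N = Ry t" "\<bar>t\<bar> \<le> pi"
proof -
  note o = SO3_orthonormal[OF N] and c = SO3_cofactor[OF N]
  have 0: "N$1$2 = 0" "N$3$2 = 0" "N$2$1 = 0" "N$2$3 = 0"
    using o(8) o(2) assms(2) by (auto simp: add_nonneg_eq_0_iff)
  have "N$1$1 * N$1$1 + (- N$3$1) * (- N$3$1) = 1" using o(7) 0 by simp
  then obtain t where t: "N$1$1 = cos t" "- N$3$1 = sin t" "\<bar>t\<bar> \<le> pi"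
    by (rule unit_vector_angle)
  have "N$3$3 = N$1$1" "N$1$3 = - N$3$1" using c(3,9) 0 assms(2) by simp_all
  with t 0 assms(2) have "N = Ry t" by (simp add: Ry_def mat3_simps)
  with t(3) that show ?thesis by blast
qed

text \<open>The triples \<open>(x, y, z)\<close> and \<open>(x \<plusminus> pi, - y, z \<plusminus> pi)\<close> describe the same rotation, and for one of
them the outer angles add up to at most \<open>pi\<close>.\<close>

lemma SO3_euler_angles:
  assumes R: "R \<in> SO3"
  obtains x y z where "R = Ry x ** Rx y ** Ry z" "\<bar>y\<bar> = arccos (R$2$2)" "\<bar>x\<bar> + \<bar>z\<bar> \<le> pi"
proof -
  note o = SO3_orthonormal[OF R]
  have r: "- 1 \<le> R$2$2" "R$2$2 \<le> 1" using SO3_entry_le[OF R, of 2 2] by auto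
  define y where "y = arccos (R$2$2)"
  have y: "cos y = R$2$2" "0 \<le> y" "y \<le> pi" "sin y * sin y = 1 - R$2$2 * R$2$2"
    using r arccos[OF r] sin_cos_squared_add3[of y] by (auto simp: y_def algebra_simps)
  obtain x where x: "R$3$2 = cos x * sin y" "R$1$2 = sin x * sin y" "\<bar>x\<bar> \<le> pi"
  proof (cases "sin y = 0")
    case True
    then have "R$3$2 = 0" "R$1$2 = 0"
      using o(8) y(4) by (auto simp: add_nonneg_eq_0_iff)
    with True that[of 0] show ?thesis by simp
  next
    case False
    have "(R$3$2 / sin y) * (R$3$2 / sin y) + (R$1$2 / sin y) * (R$1$2 / sin y) = 1"
    proof -
      have "R$3$2 * R$3$2 + R$1$2 * R$1$2 = sin y * sin y" using o(8) y(4) by simp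
      then show ?thesis using False by (simp flip: add_divide_distrib)
    qed
    then obtain x where "R$3$2 / sin y = cos x" "R$1$2 / sin y = sin x" "\<bar>x\<bar> \<le> pi"
      by (rule unit_vector_angle)
    with False that[of x] show ?thesis by (simp add: field_simps)
  qed
  define N where "N = transpose (Rx y) ** (transpose (Ry x) ** R)"
  have NS: "N \<in> SO3" by (simp add: N_def SO3_mult SO3_transpose SO3_rotations R)
  have RN: "R = Ry x ** Rx y ** N"
    by (simp add: N_def SO3_cancel(4)[OF SO3_rotations(1)] SO3_cancel(4)[OF SO3_rotations(2)]
        flip: matrix_mul_assoc)
  have "N$2$2 = cos y * R$2$2 + sin y * (sin x * R$1$2 + cos x * R$3$2)"
    by (simp add: N_def Rx_def Ry_def matrix_matrix_mult_def sum_3 transpose_def)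
  also have "\<dots> = cos y * cos y + sin y * sin y * (cos x * cos x + sin x * sin x)"
    unfolding x(1,2) y(1)[symmetric] by algebra
  finally have "N$2$2 = 1" by (simp only: sin_cos_squared_add3 mult_1_right)
  then obtain z where z: "N = Ry z" "\<bar>z\<bar> \<le> pi" by (rule SO3_fixing_e2[OF NS])
  show ?thesis
  proof (cases "\<bar>x\<bar> + \<bar>z\<bar> \<le> pi")
    case True
    with RN z y show ?thesis by (intro that[of x y z]) (auto simp: y_def)
  next
    case False
    define t where "t = (\<lambda>u::real. if 0 \<le> u then u - pi else u + pi)"
    have t: "cos (t u) = - cos u" "sin (t u) = - sin u" for u
      by (simp_all add: t_def cos_diff sin_diff)
    have "\<bar>t x\<bar> = pi - \<bar>x\<bar>" "\<bar>t z\<bar> = pi - \<bar>z\<bar>" using x z by (auto simp: t_def)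
    with False have "\<bar>t x\<bar> + \<bar>t z\<bar> \<le> pi" by simp
    moreover have "R = Ry (t x) ** Rx (- y) ** Ry (t z)"
      unfolding RN z(1) by (simp add: Ry_def Rx_def t mat3_simps)
    ultimately show ?thesis using y by (intro that[of "t x" "- y" "t z"]) (auto simp: y_def)
  qed
qed

lemma joined_bound:
  assumes a: "0 < a" "a < 1" and R: "R \<in> SO3"
  shows "\<exists>l \<le> pi + arccos (R$2$2) / sqrt (1 - a\<^sup>2). joined a (mat 1) R l"
proof -
  obtain x y z where e: "R = Ry x ** Rx y ** Ry z" "\<bar>y\<bar> = arccos (R$2$2)" "\<bar>x\<bar> + \<bar>z\<bar> \<le> pi"
    by (rule SO3_euler_angles[OF R])
  have "joined a (Ry x) (Ry x ** Rx y) (\<bar>y\<bar> / sqrt (1 - a\<^sup>2))"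
    using joined_left_mult[OF joined_Rx[OF a] SO3_rotations(2)] by simp
  moreover have "joined a (Ry x ** Rx y) (Ry x ** Rx y ** Ry z) \<bar>z\<bar>"
    using joined_left_mult[OF joined_Ry SO3_mult[OF SO3_rotations(2,1)]] by simp
  ultimately have "joined a (mat 1) R (\<bar>x\<bar> + \<bar>y\<bar> / sqrt (1 - a\<^sup>2) + \<bar>z\<bar>)"
    unfolding e(1) using joined.trans[OF joined.trans[OF joined_Ry]] by blast
  then show ?thesis using e(2,3) by (intro exI[of _ "\<bar>x\<bar> + \<bar>y\<bar> / sqrt (1 - a\<^sup>2) + \<bar>z\<bar>"]) simp
qed

section \<open>Mirrored chords\<close>

lemma eventually_nonzero_of_derivative:
  fixes f :: "real \<Rightarrow> real"
  assumes "(f has_real_derivative l) (at 0 within {0..})" "f 0 = 0" "l \<noteq> 0"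
  shows "eventually (\<lambda>h. f h \<noteq> 0) (at_right 0)"
proof (cases "0 < l")
  case True
  from eventually_sign_of_derivative(1)[OF assms(1,2) this] show ?thesis by eventually_elim simp
next
  case False
  then have "l < 0" using assms(3) by simp
  from eventually_sign_of_derivative(2)[OF assms(1,2) this] show ?thesis by eventually_elim simp
qed

lemma geodesic_shift:
  assumes geo: "arclength_geodesic a R p" and x: "0 \<le> x" and r: "0 \<le> r"
  shows "((\<lambda>r. R (x + r)) has_vector_derivative R (x + r) ** ctrl a (p (x + r) $ 1) (p (x + r) $ 2))
    (at r within {0..})"
proof -
  have "((\<lambda>r. x + r) has_vector_derivative 1) (at r within {0..})"
    by (auto intro!: derivative_eq_intros)
  moreover have "(R has_vector_derivative R (x + r) ** ctrl a (p (x + r) $ 1) (p (x + r) $ 2))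
      (at (x + r) within (\<lambda>r. x + r) ` {0..})"
    by (rule has_vector_derivative_within_subset[of _ _ _ "{0..}"])
      (use geo x r in \<open>auto simp: arclength_geodesic_def ctrl_def\<close>)
  ultimately show ?thesis using vector_diff_chain_within by (fastforce simp: o_def)
qed

lemma joined_geodesic:
  assumes geo: "arclength_geodesic a R p" and x: "0 \<le> x" "x \<le> y"
  shows "joined a (R x) (R y) (y - x)"
proof -
  have "unit_speed_arc a (y - x) (\<lambda>r. R (x + r)) (\<lambda>r. p (x + r) $ 1) (\<lambda>r. p (x + r) $ 2)"
    unfolding unit_speed_arc_def
  proof (intro conjI ballI)
    fix r assume r: "r \<in> {0..y - x}"
    show "R (x + r) \<in> SO3" "(p (x + r) $ 1)\<^sup>2 + (p (x + r) $ 2)\<^sup>2 = 1"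
      using geo x r by (auto simp: arclength_geodesic_def)
    show "((\<lambda>r. R (x + r)) has_vector_derivative
        R (x + r) ** ctrl a (p (x + r) $ 1) (p (x + r) $ 2)) (at r within {0..y - x})"
      by (rule has_vector_derivative_within_subset[OF geodesic_shift[OF geo x(1)]]) (use r in auto)
  qed (use x in simp)
  from joined.arc[OF this] show ?thesis by simp
qed

text \<open>The mirrored arc is the reversed arc conjugated by \<open>D\<close>. By assumption it has the same chord, and it
arrives with control \<open>(- D\<^sub>2\<^sub>2 p\<^sub>1, - D\<^sub>1\<^sub>1 p\<^sub>2)\<close> taken at the start of the arc, so the last
assumption says that going on along the geodesic makes a corner.\<close>

lemma not_minimizing_past_mirrored_chord:
  assumes a: "0 < a" "a < 1" and geo: "arclength_geodesic a R p"
    and s: "0 \<le> s" "s < s'" "s' < t" and D: "sign_matrix D"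
    and chord: "D ** (transpose (R s') ** R s) ** D = transpose (R s) ** R s'"
    and corner: "(- (D$2$2 * p s $ 1), - (D$1$1 * p s $ 2)) \<noteq> (p s' $ 1, p s' $ 2)"
  shows "\<not> length_minimizing a t R"
proof
  assume min: "length_minimizing a t R"
  have RS: "R x \<in> SO3" if "0 \<le> x" for x using geo that by (simp add: arclength_geodesic_def)
  have unit: "(p x $ 1)\<^sup>2 + (p x $ 2)\<^sup>2 = 1" if "0 \<le> x" for x
    using geo that by (simp add: arclength_geodesic_def)
  have s'0: "0 \<le> s'" using s by simp
  define b where "b = sqrt (1 - a\<^sup>2)"
  have b: "0 < b" using a power_strict_mono[of a 1 2] by (simp_all add: b_def)
  define B where "B = (\<lambda>r. transpose (R s') ** R (s' + r))"
  define A where "A = (\<lambda>r. D ** (transpose (R (s + r)) ** R s) ** D)"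
  have B': "(B has_vector_derivative ctrl a (p s' $ 1) (p s' $ 2)) (at 0 within {0..})"
    using bounded_linear.has_vector_derivative[OF
      bounded_bilinear.bounded_linear_right[OF bounded_bilinear_matrix_mult, of "transpose (R s')"]
      geodesic_shift[OF geo s'0 order.refl]]
    by (simp add: B_def[abs_def] SO3_cancel[OF RS[OF s'0]])
  have "((\<lambda>r. transpose (R (s + r)) ** R s) has_vector_derivative
      ctrl a (- p s $ 1) (- p s $ 2) ** mat 1) (at 0 within {0..})"
  proof -
    have "transpose (R s ** ctrl a (p s $ 1) (p s $ 2)) ** R s = ctrl a (- p s $ 1) (- p s $ 2) ** mat 1"
    proof -
      have "ctrl a (- p s $ 1) (- p s $ 2) = - ctrl a (p s $ 1) (p s $ 2)" by (simp add: ctrl_def)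
      moreover have "transpose (ctrl a (p s $ 1) (p s $ 2)) ** (transpose (R s) ** R s)
        = transpose (ctrl a (p s $ 1) (p s $ 2))" by (simp add: SO3_cancel[OF RS[OF s(1)]])
      ultimately show ?thesis by (simp add: matrix_transpose_mul transpose_ctrl flip: matrix_mul_assoc)
    qed
    then show ?thesis
      using bounded_linear.has_vector_derivative[OF
        bounded_bilinear.bounded_linear_left[OF bounded_bilinear_matrix_mult, of "R s"]
        transpose_derivative[OF geodesic_shift[OF geo s(1) order.refl]]]
      by simp
  qed
  then have "((\<lambda>r. D ** (transpose (R (s + r)) ** R s) ** D) has_vector_derivative
      D ** ctrl a (- p s $ 1) (- p s $ 2) ** D) (at 0 within {0..})"
    using bounded_linear.has_vector_derivative[OF bounded_linear_sandwich] by fastforce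
  then have A': "(A has_vector_derivative ctrl a (- (D$2$2 * p s $ 1)) (- (D$1$1 * p s $ 2)))
      (at 0 within {0..})"
    by (simp add: A_def[abs_def] sign_matrix_ctrl[OF D])
  obtain r where r: "0 < r" "s' + r < t" "B r $ 3 $ 1 \<noteq> 0 \<or> B r $ 3 $ 2 \<noteq> 0"
  proof -
    have small: "eventually (\<lambda>r::real. 0 < r \<and> r < t - s') (at_right 0)"
      using s by (intro eventually_conj eventually_at_right_less eventually_at_rightI[of 0 "t - s'"]) auto
    have d: "((\<lambda>r. B r $ 3 $ 1) has_real_derivative - p s' $ 1) (at 0 within {0..})"
      "((\<lambda>r. B r $ 3 $ 2) has_real_derivative b * p s' $ 2) (at 0 within {0..})"
      using entry_derivative[OF B', of 3 1] entry_derivative[OF B', of 3 2]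
      by (simp_all add: ctrl_entries b_def)
    have z: "B 0 $ 3 $ 1 = 0" "B 0 $ 3 $ 2 = 0"
      by (simp_all add: B_def SO3_cancel[OF RS[OF s'0]] mat_def)
    have "p s' $ 1 \<noteq> 0 \<or> p s' $ 2 \<noteq> 0" using unit[OF s'0] by auto
    then have "eventually (\<lambda>r. B r $ 3 $ 1 \<noteq> 0 \<or> B r $ 3 $ 2 \<noteq> 0) (at_right 0)"
    proof
      assume "p s' $ 1 \<noteq> 0"
      then have "- p s' $ 1 \<noteq> 0" by simp
      from eventually_nonzero_of_derivative[OF d(1) z(1) this] show ?thesis by eventually_elim simp
    next
      assume "p s' $ 2 \<noteq> 0"
      then have "b * p s' $ 2 \<noteq> 0" using b by simp
      from eventually_nonzero_of_derivative[OF d(2) z(2) this] show ?thesis by eventually_elim simp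
    qed
    from eventually_conj[OF small this] show ?thesis
      using that by (auto dest!: eventually_happens'[OF trivial_limit_at_right_real])
  qed
  define c where "c = B r"
  have cS: "c \<in> SO3" using s'0 r by (simp add: c_def B_def SO3_mult SO3_transpose RS)
  define d where "d = min (s' - s) r"
  obtain e N Z l m where e: "0 < e" "e < d" and Z: "Z \<in> SO3"
    and N: "N = A e ** (c ** transpose Z ** transpose c) ** B e"
    and j: "joined a (mat 1) N l" "joined a (mat 1) Z m" "l + m < 2 * e"
  proof (rule corner_shortcut[OF a _ _ _ A' _ _ B' _ _ corner cS])
    show "0 < d" using s r by (simp add: d_def)
    show "A 0 = mat 1" "B 0 = mat 1"
      by (simp_all add: A_def B_def SO3_cancel[OF RS[OF s'0]] SO3_cancel[OF RS[OF s(1)]]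
          sign_matrix_square[OF D])
    show "A x \<in> SO3" "B x \<in> SO3" if "x \<in> {0..d}" for x
      using that s s'0 by (simp_all add: A_def B_def SO3_mult SO3_transpose RS sign_matrix_SO3[OF D])
    show "(- (D$2$2 * p s $ 1))\<^sup>2 + (- (D$1$1 * p s $ 2))\<^sup>2 = 1" "(p s' $ 1)\<^sup>2 + (p s' $ 2)\<^sup>2 = 1"
      using unit s'0 s sign_matrix_entry_square[OF D] by (simp_all add: power_mult_distrib)
    show "c $ 3 $ 1 \<noteq> 0 \<or> c $ 3 $ 2 \<noteq> 0" using r by (simp add: c_def)
  qed blast
  have es: "s + e \<le> s'" "e \<le> r" using e by (auto simp: d_def)
  define V where "V = D ** (transpose (R s') ** R (s + e)) ** D"
  define K where "K = R s' ** (c ** transpose Z ** transpose c) ** transpose (R s')"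
  have VS: "V \<in> SO3" using s s'0 e by (simp add: V_def SO3_mult SO3_transpose RS sign_matrix_SO3[OF D])
  have KS: "K \<in> SO3" using s'0 by (simp add: K_def SO3_mult SO3_transpose RS cS Z)
  have se: "0 \<le> s + e" using s e by simp
  have VA: "V ** A e = transpose (R s) ** R s'"
    by (simp add: V_def A_def sign_matrix_square(2)[OF D] SO3_cancel(4)[OF RS[OF se]] chord[symmetric]
        flip: matrix_mul_assoc)
  have "joined a (R s) (R s ** V) (s' - (s + e))"
  proof -
    have "joined a (R s') (R (s + e)) (s' - (s + e))"
      by (rule joined_sym[OF joined_geodesic[OF geo se es(1)]])
    from joined_conjugate[OF joined_left_mult[OF this SO3_transpose[OF RS[OF s'0]]] D]
    have "joined a (mat 1) V (s' - (s + e))"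
      by (simp add: V_def SO3_cancel[OF RS[OF s'0]] sign_matrix_square[OF D])
    from joined_left_mult[OF this RS[OF s(1)]] show ?thesis by simp
  qed
  note p1 = joined.trans[OF joined_geodesic[OF geo order.refl s(1)] this]
  have "R s ** V ** N = K ** R (s' + e)"
  proof -
    have "R s ** V ** N = R s ** (V ** A e) ** (c ** transpose Z ** transpose c) ** B e"
      by (simp add: N matrix_mul_assoc)
    also have "R s ** (V ** A e) = R s'" unfolding VA by (rule SO3_cancel(4)[OF RS[OF s(1)]])
    finally show ?thesis by (simp add: K_def B_def matrix_mul_assoc)
  qed
  then have "joined a (R s ** V) (K ** R (s' + e)) l"
    using joined_left_mult[OF j(1) SO3_mult[OF RS[OF s(1)] VS]] by simp
  note p2 = joined.trans[OF p1 this]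
  have "joined a (K ** R (s' + e)) (K ** R (s' + r)) (s' + r - (s' + e))"
    by (intro joined_left_mult joined_geodesic[OF geo] KS) (use s'0 e es in auto)
  note p3 = joined.trans[OF p2 this]
  have sr: "R (s' + r) = R s' ** c"
    by (simp add: c_def B_def SO3_cancel(4)[OF RS[OF s'0]])
  have "K ** R (s' + r) = R s' ** c ** transpose Z"
    by (simp add: K_def sr SO3_cancel(3)[OF RS[OF s'0]] SO3_cancel(1)[OF cS] flip: matrix_mul_assoc)
  then have "K ** R (s' + r) ** Z = R (s' + r)"
    by (simp add: sr SO3_cancel(1)[OF Z] flip: matrix_mul_assoc)
  then have "joined a (K ** R (s' + r)) (R (s' + r)) m"
    using joined_left_mult[OF j(2) SO3_mult[OF KS RS[of "s' + r"]]] s'0 r by simp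
  note p4 = joined.trans[OF p3 this]
  have "joined a (R (s' + r)) (R t) (t - (s' + r))"
    by (rule joined_geodesic[OF geo]) (use s'0 r in auto)
  note p5 = joined.trans[OF p4 this]
  have "R 0 = mat 1" using geo by (simp add: arclength_geodesic_def)
  with length_minimizing_le_joined[OF a geo min] p5
  have "t \<le> s - 0 + (s' - (s + e)) + l + (s' + r - (s' + e)) + m + (t - (s' + r))" by metis
  with j(3) show False by simp
qed

section \<open>The moving frame and the precession angle\<close>

text \<open>The angular momentum, in body coordinates and scaled by \<open>sqrt (1 - a\<^sup>2)\<close>. For a geodesic \<open>R\<close> with
covector \<open>p\<close>, the vector \<open>R t *v momentum a (p t)\<close> does not depend on \<open>t\<close>.\<close>

definition momentum :: "real \<Rightarrow> real^3 \<Rightarrow> real^3" where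
  "momentum a q = vector [q$2, sqrt (1 - a\<^sup>2) * q$1, q$3]"

text \<open>On the cylinder, the length of the first two components of the momentum.\<close>

definition horizontal_momentum :: "real \<Rightarrow> real^3 \<Rightarrow> real" where
  "horizontal_momentum a q = sqrt (1 - a\<^sup>2 * (q$1)\<^sup>2)"

definition frame_matrix :: "real \<Rightarrow> real \<Rightarrow> real \<Rightarrow> real \<Rightarrow> real \<Rightarrow> real^3^3" where
  "frame_matrix n1 n2 m1 m2 m3 = vector [vector [n1, n2, 0],
     vector [- m3 * n2, m3 * n1, m1 * n2 - m2 * n1], vector [m1, m2, m3]]"

text \<open>The rows are a right-handed orthonormal frame in body coordinates. The third row is the direction of
the momentum, of length \<open>M\<close>, and the first is the horizontal direction orthogonal to it.\<close>

definition base_frame :: "real \<Rightarrow> real \<Rightarrow> real^3 \<Rightarrow> real^3^3" where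
  "base_frame a M q =
     (let r = horizontal_momentum a q; m = momentum a q; n1 = m$2 / r; n2 = - m$1 / r
      in frame_matrix n1 n2 (m$1 / M) (m$2 / M) (m$3 / M))"

lemma momentum_nth [simp]:
  "momentum a q $ 1 = q$2" "momentum a q $ 2 = sqrt (1 - a\<^sup>2) * q$1" "momentum a q $ 3 = q$3"
  by (simp_all add: momentum_def)

lemma contraction_factor:
  fixes a :: real
  assumes "0 < a" "a < 1"
  shows "0 < sqrt (1 - a\<^sup>2)" "sqrt (1 - a\<^sup>2) < 1" "(sqrt (1 - a\<^sup>2))\<^sup>2 = 1 - a\<^sup>2"
  using assms power_strict_mono[of a 1 2] by simp_all

lemma horizontal_momentum_pos:
  assumes a: "0 < a" "a < 1" and q: "(q$1)\<^sup>2 + (q$2)\<^sup>2 = 1"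
  shows "0 < horizontal_momentum a q"
    "(horizontal_momentum a q)\<^sup>2 = (momentum a q $ 1)\<^sup>2 + (momentum a q $ 2)\<^sup>2"
    "(horizontal_momentum a q)\<^sup>2 = 1 - a\<^sup>2 * (q$1)\<^sup>2"
proof -
  have "(q$1)\<^sup>2 \<le> 1" using q zero_le_power2[of "q$2"] by linarith
  then have "a\<^sup>2 * (q$1)\<^sup>2 \<le> a\<^sup>2 * 1" by (intro mult_left_mono) auto
  also have "\<dots> < 1" using a power_strict_mono[of a 1 2] by simp
  finally have p: "0 < 1 - a\<^sup>2 * (q$1)\<^sup>2" by simp
  then show "0 < horizontal_momentum a q"
    and e: "(horizontal_momentum a q)\<^sup>2 = 1 - a\<^sup>2 * (q$1)\<^sup>2"
    by (simp_all add: horizontal_momentum_def)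
  show "(horizontal_momentum a q)\<^sup>2 = (momentum a q $ 1)\<^sup>2 + (momentum a q $ 2)\<^sup>2"
    unfolding e using q
    by (simp add: power_mult_distrib contraction_factor(3)[OF a] algebra_simps)
qed

lemma base_frame_entries:
  assumes a: "0 < a" "a < 1" and q: "(q$1)\<^sup>2 + (q$2)\<^sup>2 = 1"
    and M: "0 < M" "M\<^sup>2 = 1 - a\<^sup>2 * (q$1)\<^sup>2 + (q$3)\<^sup>2"
  obtains n1 n2 m1 m2 m3 where
    "base_frame a M q = frame_matrix n1 n2 m1 m2 m3"
    "n1 = sqrt (1 - a\<^sup>2) * q$1 / horizontal_momentum a q" "n2 = - q$2 / horizontal_momentum a q"
    "m1 = q$2 / M" "m2 = sqrt (1 - a\<^sup>2) * q$1 / M" "m3 = q$3 / M"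
    "n1\<^sup>2 + n2\<^sup>2 = 1" "m1\<^sup>2 + m2\<^sup>2 + m3\<^sup>2 = 1" "m1 * n1 + m2 * n2 = 0"
proof -
  define r where "r = horizontal_momentum a q"
  note r = horizontal_momentum_pos[OF a q, folded r_def]
  show ?thesis
  proof (rule that)
    show "(sqrt (1 - a\<^sup>2) * q$1 / horizontal_momentum a q)\<^sup>2 + (- q$2 / horizontal_momentum a q)\<^sup>2 = 1"
    proof -
      have "(sqrt (1 - a\<^sup>2) * q$1 / r)\<^sup>2 + (- q$2 / r)\<^sup>2
          = ((momentum a q $ 1)\<^sup>2 + (momentum a q $ 2)\<^sup>2) / r\<^sup>2"
        by (simp add: power_divide add_divide_distrib)
      then have "(sqrt (1 - a\<^sup>2) * q$1 / r)\<^sup>2 + (- q$2 / r)\<^sup>2 = r\<^sup>2 / r\<^sup>2"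
        by (simp only: r(2))
      then show ?thesis using r(1) by (simp add: r_def)
    qed
    show "(q$2 / M)\<^sup>2 + (sqrt (1 - a\<^sup>2) * q$1 / M)\<^sup>2 + (q$3 / M)\<^sup>2 = 1"
    proof -
      have "M\<^sup>2 = (q$2)\<^sup>2 + (sqrt (1 - a\<^sup>2) * q$1)\<^sup>2 + (q$3)\<^sup>2"
        using M(2) r(2,3) by simp
      then have "(q$2 / M)\<^sup>2 + (sqrt (1 - a\<^sup>2) * q$1 / M)\<^sup>2 + (q$3 / M)\<^sup>2 = M\<^sup>2 / M\<^sup>2"
        by (simp only: power_divide add_divide_distrib)
      then show ?thesis using M(1) by simp
    qed
    show "q$2 / M * (sqrt (1 - a\<^sup>2) * q$1 / horizontal_momentum a q)
      + sqrt (1 - a\<^sup>2) * q$1 / M * (- q$2 / horizontal_momentum a q) = 0" by simp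
  qed (simp_all add: base_frame_def Let_def)
qed

lemma base_frame_SO3:
  assumes a: "0 < a" "a < 1" and q: "(q$1)\<^sup>2 + (q$2)\<^sup>2 = 1"
    and M: "0 < M" "M\<^sup>2 = 1 - a\<^sup>2 * (q$1)\<^sup>2 + (q$3)\<^sup>2"
  shows "base_frame a M q \<in> SO3"
proof -
  obtain n1 n2 m1 m2 m3 where B: "base_frame a M q = frame_matrix n1 n2 m1 m2 m3"
    and n: "n1\<^sup>2 + n2\<^sup>2 = 1" "m1\<^sup>2 + m2\<^sup>2 + m3\<^sup>2 = 1" "m1 * n1 + m2 * n2 = 0"
    by (rule base_frame_entries[OF a q M])
  have "orthogonal_matrix (base_frame a M q)"
  proof -
    have "base_frame a M q ** transpose (base_frame a M q) = mat 1"
      unfolding B frame_matrix_def using n by (simp add: mat3_simps) algebra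
    then show ?thesis
      unfolding orthogonal_matrix_def using matrix_left_right_inverse by blast
  qed
  moreover have "det (base_frame a M q) = 1"
    unfolding B frame_matrix_def det_3 using n by simp algebra
  ultimately show ?thesis by (simp add: SO3_def)
qed

text \<open>Undoing the precession turns the frame into one that is fixed in space, so this matrix moves exactly
as the geodesic does, up to a constant rotation on the left.\<close>

definition spatial_frame :: "real \<Rightarrow> real \<Rightarrow> real \<Rightarrow> real^3 \<Rightarrow> real^3^3" where
  "spatial_frame a M ph q = Rz ph ** base_frame a M q"

text \<open>Seen from the body, vectors fixed in space obey \<open>r' = r \<times> \<omega>\<close>. The third row does. The other two fail to by
a rotation in their plane at rate \<open>k\<close>, which is the speed of precession.\<close>

lemma base_frame_derivative:
  fixes p :: "real \<Rightarrow> real^3"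
  assumes a: "0 < a" "a < 1" and q: "\<And>t. (p t$1)\<^sup>2 + (p t$2)\<^sup>2 = 1"
    and M: "0 < M" "\<And>t. M\<^sup>2 = 1 - a\<^sup>2 * (p t$1)\<^sup>2 + (p t$3)\<^sup>2"
    and d: "((\<lambda>t. p t $ 1) has_real_derivative p t $ 3 * p t $ 2) (at t)"
      "((\<lambda>t. p t $ 2) has_real_derivative - (p t $ 3 * p t $ 1)) (at t)"
      "((\<lambda>t. p t $ 3) has_real_derivative a\<^sup>2 * p t $ 1 * p t $ 2) (at t)"
  defines "b \<equiv> sqrt (1 - a\<^sup>2)"
  defines "k \<equiv> b * M / (1 - a\<^sup>2 * (p t$1)\<^sup>2)"
  shows "((\<lambda>t. base_frame a M (p t)) has_vector_derivative
    base_frame a M (p t) ** ctrl a (p t $ 1) (p t $ 2)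
    - (k *\<^sub>R A3) ** base_frame a M (p t)) (at t)"
proof -
  define r where "r = (\<lambda>t. horizontal_momentum a (p t))"
  define n1 where "n1 = (\<lambda>t. b * p t $ 1 / r t)"
  define n2 where "n2 = (\<lambda>t. - p t $ 2 / r t)"
  define m1 where "m1 = (\<lambda>t. p t $ 2 / M)"
  define m2 where "m2 = (\<lambda>t. b * p t $ 1 / M)"
  define m3 where "m3 = (\<lambda>t. p t $ 3 / M)"
  note b = contraction_factor[OF a, folded b_def]
  have r: "0 < r t" "(r t)\<^sup>2 = (momentum a (p t) $ 1)\<^sup>2 + (momentum a (p t) $ 2)\<^sup>2"
    "(r t)\<^sup>2 = 1 - a\<^sup>2 * (p t $ 1)\<^sup>2" for t
    unfolding r_def by (rule horizontal_momentum_pos[OF a q])+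
  have B: "base_frame a M (p t) = frame_matrix (n1 t) (n2 t) (m1 t) (m2 t) (m3 t)" for t
    by (simp add: base_frame_def Let_def r_def n1_def n2_def m1_def m2_def m3_def b_def)
  have k: "k = b * M / (r t)\<^sup>2" using r(3)[of t] by (simp add: k_def)
  have rd: "(r has_real_derivative - (a\<^sup>2 * p t $ 1 * p t $ 2 * p t $ 3) / r t) (at t)"
  proof -
    have "((\<lambda>t. sqrt (1 - a\<^sup>2 * (p t $ 1)\<^sup>2)) has_real_derivative
        - (a\<^sup>2 * (2 * p t $ 1 * (p t $ 3 * p t $ 2))) / (2 * sqrt (1 - a\<^sup>2 * (p t $ 1)\<^sup>2))) (at t)"
      using r(1)[of t] r(3)[of t]
      by (auto intro!: derivative_eq_intros d simp: r_def horizontal_momentum_def field_simps)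
    then show ?thesis by (simp add: r_def horizontal_momentum_def mult_ac)
  qed
  have r2: "(r t)\<^sup>2 = b\<^sup>2 * (p t $ 1)\<^sup>2 + (p t $ 2)\<^sup>2" "a\<^sup>2 = 1 - b\<^sup>2"
  proof -
    have "(r t)\<^sup>2 = 1 - a\<^sup>2 * (p t $ 1)\<^sup>2" using r(3)[of t] by simp
    then show "(r t)\<^sup>2 = b\<^sup>2 * (p t $ 1)\<^sup>2 + (p t $ 2)\<^sup>2"
      using q[of t] b(3) by algebra
    show "a\<^sup>2 = 1 - b\<^sup>2" using b(3) by simp
  qed
  have rne: "r t \<noteq> 0" using r(1)[of t] by simp
  have n1d: "(n1 has_real_derivative k * (- m3 t * n2 t)) (at t)"
  proof -
    have "(n1 has_real_derivative (b * (p t $ 3 * p t $ 2) * r t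
        - b * p t $ 1 * (- (a\<^sup>2 * p t $ 1 * p t $ 2 * p t $ 3) / r t)) / (r t * r t)) (at t)"
      unfolding n1_def by (rule DERIV_divide[OF DERIV_cmult[OF d(1)] rd rne])
    moreover have "(b * (p t $ 3 * p t $ 2) * r t
        - b * p t $ 1 * (- (a\<^sup>2 * p t $ 1 * p t $ 2 * p t $ 3) / r t)) / (r t * r t)
        = b * p t $ 2 * p t $ 3 * ((r t)\<^sup>2 + a\<^sup>2 * (p t $ 1)\<^sup>2) / (r t * r t * r t)"
      using rne by (simp add: field_simps power2_eq_square)
    moreover have "(r t)\<^sup>2 + a\<^sup>2 * (p t $ 1)\<^sup>2 = 1" using r(3)[of t] by simp
    moreover have "k * (- m3 t * n2 t) = b * p t $ 2 * p t $ 3 / (r t * r t * r t)"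
      using rne M(1) by (simp add: k m3_def n2_def field_simps power2_eq_square)
    ultimately show ?thesis by simp
  qed
  have n2d: "(n2 has_real_derivative k * (m3 t * n1 t)) (at t)"
  proof -
    have "(n2 has_real_derivative (- (- (p t $ 3 * p t $ 1)) * r t
        - (- p t $ 2) * (- (a\<^sup>2 * p t $ 1 * p t $ 2 * p t $ 3) / r t)) / (r t * r t)) (at t)"
      unfolding n2_def by (rule DERIV_divide[OF DERIV_minus[OF d(2)] rd rne])
    moreover have "(- (- (p t $ 3 * p t $ 1)) * r t
        - (- p t $ 2) * (- (a\<^sup>2 * p t $ 1 * p t $ 2 * p t $ 3) / r t)) / (r t * r t)
        = p t $ 1 * p t $ 3 * ((r t)\<^sup>2 - a\<^sup>2 * (p t $ 2)\<^sup>2) / (r t * r t * r t)"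
      using rne by (simp add: field_simps power2_eq_square)
    moreover have "(r t)\<^sup>2 - a\<^sup>2 * (p t $ 2)\<^sup>2 = b\<^sup>2"
    proof -
      have "(r t)\<^sup>2 - a\<^sup>2 * (p t $ 2)\<^sup>2 = b\<^sup>2 * ((p t $ 1)\<^sup>2 + (p t $ 2)\<^sup>2)"
        unfolding r2 by (simp add: algebra_simps)
      then show ?thesis using q[of t] by simp
    qed
    moreover have "k * (m3 t * n1 t) = p t $ 1 * p t $ 3 * b\<^sup>2 / (r t * r t * r t)"
      using rne M(1) by (simp add: k m3_def n1_def field_simps power2_eq_square)
    ultimately show ?thesis by simp
  qed
  have m1d: "(m1 has_real_derivative - m3 t * p t $ 1) (at t)"
    unfolding m1_def m3_def using DERIV_cdivide[OF d(2), of M] by simp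
  have m2d: "(m2 has_real_derivative m3 t * (b * p t $ 2)) (at t)"
    unfolding m2_def m3_def using DERIV_cdivide[OF DERIV_cmult[OF d(1), of b], of M] by (simp add: mult_ac)
  have m3d: "(m3 has_real_derivative m1 t * p t $ 1 - m2 t * (b * p t $ 2)) (at t)"
  proof -
    have "a\<^sup>2 * p t $ 1 * p t $ 2 / M = m1 t * p t $ 1 - m2 t * (b * p t $ 2)"
      unfolding r2(2) m1_def m2_def using M(1) by (simp add: field_simps power2_eq_square)
    then show ?thesis unfolding m3_def using DERIV_cdivide[OF d(3), of M] by simp
  qed
  have "n1 t * n1 t + n2 t * n2 t = (b\<^sup>2 * (p t $ 1)\<^sup>2 + (p t $ 2)\<^sup>2) / (r t)\<^sup>2"
    by (simp add: n1_def n2_def add_divide_distrib power2_eq_square mult_ac)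
  then have nn: "n1 t * n1 t + n2 t * n2 t = 1" using rne by (simp add: r2(1)[symmetric])
  have c3: "k * (m1 t * n2 t - m2 t * n1 t) = b * p t $ 2 * n2 t - p t $ 1 * n1 t"
  proof -
    have "m1 t * n2 t - m2 t * n1 t = - ((r t)\<^sup>2 / (r t * M))"
      unfolding r2(1) m1_def m2_def n1_def n2_def
      by (simp add: add_divide_distrib power2_eq_square mult_ac)
    then have "k * (m1 t * n2 t - m2 t * n1 t) = - (b / r t)"
      using rne M(1) by (simp add: k power2_eq_square)
    also have "b / r t = b * ((p t $ 1)\<^sup>2 + (p t $ 2)\<^sup>2) / r t" using q[of t] by simp
    finally show ?thesis
      by (simp add: n1_def n2_def power2_eq_square add_divide_distrib algebra_simps)
  qed
  have ent: "base_frame a M (p t) $ 1 $ 1 = n1 t" "base_frame a M (p t) $ 1 $ 2 = n2 t"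
    "base_frame a M (p t) $ 1 $ 3 = 0" "base_frame a M (p t) $ 2 $ 1 = - m3 t * n2 t"
    "base_frame a M (p t) $ 2 $ 2 = m3 t * n1 t" "base_frame a M (p t) $ 2 $ 3 = m1 t * n2 t - m2 t * n1 t"
    "base_frame a M (p t) $ 3 $ 1 = m1 t" "base_frame a M (p t) $ 3 $ 2 = m2 t"
    "base_frame a M (p t) $ 3 $ 3 = m3 t" for t
    by (simp_all add: B frame_matrix_def)
  define c where "c = m1 t * n2 t - m2 t * n1 t"
  have c3': "k * c = b * p t $ 2 * n2 t - p t $ 1 * n1 t" using c3 by (simp add: c_def)
  have cn: "m1 t = c * n2 t" "m2 t = - c * n1 t" "1 - m3 t * m3 t = c * c"
  proof -
    have "c = - (r t / M)"
      unfolding c_def m1_def m2_def n1_def n2_def using rne M(1) r2(1)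
      by (simp add: field_simps power2_eq_square)
    then show "m1 t = c * n2 t" "m2 t = - c * n1 t"
      using rne by (simp_all add: m1_def m2_def n1_def n2_def)
    have "m3 t * m3 t = (M\<^sup>2 - (r t)\<^sup>2) / M\<^sup>2"
      using M(2)[of t] r(3)[of t] by (simp add: m3_def power2_eq_square)
    moreover have "c * c = (r t)\<^sup>2 / M\<^sup>2" by (simp add: \<open>c = - (r t / M)\<close> power2_eq_square)
    ultimately show "1 - m3 t * m3 t = c * c" using M(1) by (simp add: diff_divide_distrib)
  qed
  have D: "((\<lambda>t. - m3 t * n2 t) has_real_derivative - (c * p t $ 1) - k * n1 t) (at t)"
    "((\<lambda>t. m3 t * n1 t) has_real_derivative c * (b * p t $ 2) - k * n2 t) (at t)"
    "((\<lambda>t. m1 t * n2 t - m2 t * n1 t) has_real_derivative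
      - m3 t * n2 t * p t $ 1 - m3 t * n1 t * (b * p t $ 2)) (at t)"
  proof -
    have 1: "- (m1 t * p t $ 1 - m2 t * (b * p t $ 2)) * n2 t + (k * (m3 t * n1 t)) * (- m3 t)
        = - (c * p t $ 1) - k * n1 t"
      using c3' cn nn by algebra
    show "((\<lambda>t. - m3 t * n2 t) has_real_derivative - (c * p t $ 1) - k * n1 t) (at t)"
      using DERIV_mult[OF DERIV_minus[OF m3d] n2d] unfolding 1 .
    have 2: "(m1 t * p t $ 1 - m2 t * (b * p t $ 2)) * n1 t + (k * (- m3 t * n2 t)) * m3 t
        = c * (b * p t $ 2) - k * n2 t"
      using c3' cn nn by algebra
    show "((\<lambda>t. m3 t * n1 t) has_real_derivative c * (b * p t $ 2) - k * n2 t) (at t)"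
      using DERIV_mult[OF m3d n1d] unfolding 2 .
    have 3: "(- m3 t * p t $ 1) * n2 t + (k * (m3 t * n1 t)) * m1 t
        - ((m3 t * (b * p t $ 2)) * n1 t + (k * (- m3 t * n2 t)) * m2 t)
        = - m3 t * n2 t * p t $ 1 - m3 t * n1 t * (b * p t $ 2)"
      using cn nn by algebra
    show "((\<lambda>t. m1 t * n2 t - m2 t * n1 t) has_real_derivative
      - m3 t * n2 t * p t $ 1 - m3 t * n1 t * (b * p t $ 2)) (at t)"
      using DERIV_diff[OF DERIV_mult[OF m1d n2d] DERIV_mult[OF m2d n1d]] unfolding 3 .
  qed
  have main: "((\<lambda>t. base_frame a M (p t) $ i $ j) has_real_derivative
      (base_frame a M (p t) ** ctrl a (p t $ 1) (p t $ 2) - (k *\<^sub>R A3) ** base_frame a M (p t)) $ i $ j) (at t)"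
    for i j
    using exhaust_3[of i] exhaust_3[of j] n1d n2d D m1d m2d m3d c3'
    by (auto simp: ent matrix_matrix_mult_def sum_3 ctrl_entries b_def[symmetric] A3_def c_def[symmetric]
        mult_ac)
  then show ?thesis by (rule derivative_from_entries)
qed


lemma transpose_frame_mult:
  "transpose (spatial_frame a M x q) ** spatial_frame a M y r
    = transpose (base_frame a M q) ** Rz (y - x) ** base_frame a M r"
proof -
  have "transpose (Rz x) ** Rz y = Rz (y - x)"
    by (simp add: Rz_def mat3_simps cos_diff sin_diff algebra_simps)
  then show ?thesis
    unfolding spatial_frame_def
    by (metis matrix_mul_assoc matrix_transpose_mul)
qed

lemma spatial_frame_derivative:
  fixes p :: "real \<Rightarrow> real^3"
  assumes a: "0 < a" "a < 1" and q: "\<And>t. (p t$1)\<^sup>2 + (p t$2)\<^sup>2 = 1"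
    and M: "0 < M" "\<And>t. M\<^sup>2 = 1 - a\<^sup>2 * (p t$1)\<^sup>2 + (p t$3)\<^sup>2"
    and d: "((\<lambda>t. p t $ 1) has_real_derivative p t $ 3 * p t $ 2) (at t)"
      "((\<lambda>t. p t $ 2) has_real_derivative - (p t $ 3 * p t $ 1)) (at t)"
      "((\<lambda>t. p t $ 3) has_real_derivative a\<^sup>2 * p t $ 1 * p t $ 2) (at t)"
    and ph: "(ph has_real_derivative sqrt (1 - a\<^sup>2) * M / (1 - a\<^sup>2 * (p t$1)\<^sup>2)) (at t)"
  shows "((\<lambda>t. spatial_frame a M (ph t) (p t)) has_vector_derivative
    spatial_frame a M (ph t) (p t) ** ctrl a (p t $ 1) (p t $ 2)) (at t)"
proof -
  define k where "k = sqrt (1 - a\<^sup>2) * M / (1 - a\<^sup>2 * (p t$1)\<^sup>2)"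
  have "((\<lambda>t. Rz (ph t)) has_vector_derivative Rz (ph t) ** (k *\<^sub>R A3)) (at t)"
  proof (rule derivative_from_entries)
    fix i j :: 3
    show "((\<lambda>t. Rz (ph t) $ i $ j) has_real_derivative (Rz (ph t) ** (k *\<^sub>R A3)) $ i $ j) (at t)"
      using exhaust_3[of i] exhaust_3[of j]
      by (auto simp: Rz_def A3_def mat3_simps intro!: derivative_eq_intros ph[folded k_def])
  qed
  from matrix_mult_derivative[OF this base_frame_derivative[OF a q M d]]
  have "((\<lambda>t. spatial_frame a M (ph t) (p t)) has_vector_derivative
      Rz (ph t) ** (base_frame a M (p t) ** ctrl a (p t $ 1) (p t $ 2) - (k *\<^sub>R A3) ** base_frame a M (p t))
      + Rz (ph t) ** (k *\<^sub>R A3) ** base_frame a M (p t)) (at t)"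
    by (simp add: spatial_frame_def k_def)
  moreover have "X ** (Y - Z) = X ** Y - X ** Z" for X Y Z :: "real^3^3"
    using linear_diff[OF bounded_linear.linear[OF bounded_linear_sandwich[of X "mat 1"]]] by simp
  ultimately show ?thesis
    by (simp add: spatial_frame_def matrix_mul_assoc)
qed

lemma spatial_frame_SO3:
  assumes "0 < a" "a < 1" "(q$1)\<^sup>2 + (q$2)\<^sup>2 = 1"
    and "0 < M" "M\<^sup>2 = 1 - a\<^sup>2 * (q$1)\<^sup>2 + (q$3)\<^sup>2"
  shows "spatial_frame a M ph q \<in> SO3"
  unfolding spatial_frame_def using assms by (intro SO3_mult SO3_rotations base_frame_SO3)

lemma spatial_frame_momentum:
  assumes a: "0 < a" "a < 1" and q: "(q$1)\<^sup>2 + (q$2)\<^sup>2 = 1" "(r$1)\<^sup>2 + (r$2)\<^sup>2 = 1"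
    and M: "0 < M" "M\<^sup>2 = 1 - a\<^sup>2 * (q$1)\<^sup>2 + (q$3)\<^sup>2" "M\<^sup>2 = 1 - a\<^sup>2 * (r$1)\<^sup>2 + (r$3)\<^sup>2"
  shows "(transpose (spatial_frame a M x q) ** spatial_frame a M y r) *v momentum a r = momentum a q"
proof -
  have e: "spatial_frame a M x q *v momentum a q = vector [0, 0, M]"
    if q: "(q$1)\<^sup>2 + (q$2)\<^sup>2 = 1" and M': "M\<^sup>2 = 1 - a\<^sup>2 * (q$1)\<^sup>2 + (q$3)\<^sup>2" for x q
  proof -
    obtain n1 n2 m1 m2 m3 where B: "base_frame a M q = frame_matrix n1 n2 m1 m2 m3"
      and m: "m1 = q$2 / M" "m2 = sqrt (1 - a\<^sup>2) * q$1 / M" "m3 = q$3 / M"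
      and n: "m1\<^sup>2 + m2\<^sup>2 + m3\<^sup>2 = 1" "m1 * n1 + m2 * n2 = 0"
      by (rule base_frame_entries[OF a q M(1) M'])
    have "momentum a q = M *\<^sub>R vector [m1, m2, m3]"
      using M(1) by (simp add: vec_eq_iff forall_3 m)
    moreover have "base_frame a M q *v vector [m1, m2, m3] = vector [0, 0, 1]"
      unfolding B frame_matrix_def using n by (simp add: mat3_simps power2_eq_square algebra_simps)
    ultimately have "base_frame a M q *v momentum a q = M *\<^sub>R vector [0, 0, 1]"
      by (simp only: matrix_vector_mult_scaleR)
    also have "\<dots> = vector [0, 0, M]" by (simp add: vec_eq_iff forall_3)
    finally have bm: "base_frame a M q *v momentum a q = vector [0, 0, M]" .
    have "Rz x *v vector [0, 0, M] = vector [0, 0, M]"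
      by (simp add: Rz_def mat3_simps)
    then show ?thesis
      by (simp only: spatial_frame_def matrix_vector_mul_assoc[symmetric] bm)
  qed
  have "transpose (spatial_frame a M x q) *v (spatial_frame a M x q *v momentum a q) = momentum a q"
    using SO3_cancel(1)[OF spatial_frame_SO3[OF a q(1) M(1,2)]] by (simp add: matrix_vector_mul_assoc)
  then show ?thesis
    using e[OF q(1) M(2)] e[OF q(2) M(3)] by (simp flip: matrix_vector_mul_assoc)
qed

text \<open>The chord of a symmetric arc about a turning point of the covector, with precession \<open>pi\<close>.\<close>

lemma trace_chord_p3_reversed:
  assumes a: "0 < a" "a < 1" and q: "(q$1)\<^sup>2 + (q$2)\<^sup>2 = 1"
    and M: "0 < M" "M\<^sup>2 = 1 - a\<^sup>2 * (q$1)\<^sup>2 + (q$3)\<^sup>2"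
    and r: "r$1 = q$1" "r$2 = q$2" "r$3 = - q$3"
  shows "trace (transpose (base_frame a M q) ** Rz pi ** base_frame a M r) = - 1"
proof -
  obtain n1 n2 m1 m2 m3 where B: "base_frame a M q = frame_matrix n1 n2 m1 m2 m3"
    and e: "n1 = sqrt (1 - a\<^sup>2) * q$1 / horizontal_momentum a q" "n2 = - q$2 / horizontal_momentum a q"
    "m1 = q$2 / M" "m2 = sqrt (1 - a\<^sup>2) * q$1 / M" "m3 = q$3 / M"
    and n: "n1\<^sup>2 + n2\<^sup>2 = 1" "m1\<^sup>2 + m2\<^sup>2 + m3\<^sup>2 = 1" "m1 * n1 + m2 * n2 = 0"
    by (rule base_frame_entries[OF a q M])
  have B': "base_frame a M r = frame_matrix n1 n2 m1 m2 (- m3)"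
    by (simp add: base_frame_def Let_def horizontal_momentum_def r e)
  show ?thesis
    unfolding B B' frame_matrix_def trace_def using n by (simp add: Rz_def mat3_simps) algebra
qed

text \<open>The chord of a symmetric arc about a zero of \<open>p\<^sub>1\<close>, with precession \<open>2 pi\<close>. The second alternative for
\<open>r$2\<close> covers arcs that last exactly half a period, for which \<open>p\<^sub>1\<close> and \<open>p\<^sub>2\<close> both change sign.\<close>

lemma trace_chord_p1_reversed:
  assumes a: "0 < a" "a < 1" and q: "(q$1)\<^sup>2 + (q$2)\<^sup>2 = 1"
    and M: "0 < M" "M\<^sup>2 = 1 - a\<^sup>2 * (q$1)\<^sup>2 + (q$3)\<^sup>2"
    and r: "r$1 = - q$1" "r$2 = q$2 \<or> r$2 = - q$2" "r$3 = q$3"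
  shows "trace (diag3 1 (-1) (-1) ** (transpose (base_frame a M q) ** Rz (2 * pi) ** base_frame a M r)) = - 1"
proof -
  obtain n1 n2 m1 m2 m3 where B: "base_frame a M q = frame_matrix n1 n2 m1 m2 m3"
    and e: "n1 = sqrt (1 - a\<^sup>2) * q$1 / horizontal_momentum a q" "n2 = - q$2 / horizontal_momentum a q"
    "m1 = q$2 / M" "m2 = sqrt (1 - a\<^sup>2) * q$1 / M" "m3 = q$3 / M"
    and n: "n1\<^sup>2 + n2\<^sup>2 = 1" "m1\<^sup>2 + m2\<^sup>2 + m3\<^sup>2 = 1" "m1 * n1 + m2 * n2 = 0"
    by (rule base_frame_entries[OF a q M])
  from r(2) show ?thesis
  proof
    assume r2: "r$2 = q$2"
    have B': "base_frame a M r = frame_matrix (- n1) n2 m1 (- m2) m3"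
      by (simp add: base_frame_def Let_def horizontal_momentum_def r(1,3) r2 e)
    show ?thesis
      unfolding B B' frame_matrix_def trace_def using n by (simp add: Rz_def diag3_def mat3_simps) algebra
  next
    assume r2: "r$2 = - q$2"
    have B': "base_frame a M r = frame_matrix (- n1) (- n2) (- m1) (- m2) m3"
      by (simp add: base_frame_def Let_def horizontal_momentum_def r(1,3) r2 e)
    show ?thesis
      unfolding B B' frame_matrix_def trace_def using n by (simp add: Rz_def diag3_def mat3_simps) algebra
  qed
qed

lemma equal_controls_constant:
  fixes R S :: "real \<Rightarrow> real^3^3"
  assumes R: "\<And>t. 0 \<le> t \<Longrightarrow> (R has_vector_derivative R t ** ctrl a (u t) (v t)) (at t within {0..})"
    and S: "\<And>t. 0 \<le> t \<Longrightarrow> (S has_vector_derivative S t ** ctrl a (u t) (v t)) (at t within {0..})"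
    and SO3: "\<And>t. 0 \<le> t \<Longrightarrow> R t \<in> SO3" "\<And>t. 0 \<le> t \<Longrightarrow> S t \<in> SO3"
    and st: "0 \<le> s" "0 \<le> t"
  shows "transpose (R s) ** R t = transpose (S s) ** S t"
proof -
  define X where "X = (\<lambda>t. R t ** transpose (S t))"
  have d: "(X has_vector_derivative 0) (at r within {0..})" if r: "0 \<le> r" for r
  proof -
    have 1: "R r ** transpose (S r ** ctrl a (u r) (v r)) = - (R r ** ctrl a (u r) (v r) ** transpose (S r))"
      using linear_neg[OF bounded_linear.linear[OF bounded_linear_sandwich[of "R r" "transpose (S r)"]]]
      by (simp add: matrix_transpose_mul transpose_ctrl matrix_mul_assoc)
    show ?thesis
      using matrix_mult_derivative[OF R[OF r] transpose_derivative[OF S[OF r]]]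
      by (simp add: X_def 1)
  qed
  have "X s = X t"
    by (rule has_derivative_zero_unique[of "{0..}"])
      (use st d in \<open>auto simp: has_vector_derivative_def\<close>)
  then have "transpose (R s) ** (X s ** S t) = transpose (R s) ** (X t ** S t)" by simp
  moreover have "transpose (R s) ** (X s ** S t) = transpose (S s) ** S t"
    by (simp add: X_def SO3_cancel(3)[OF SO3(1)[OF st(1)]] flip: matrix_mul_assoc)
  moreover have "transpose (R s) ** (X t ** S t) = transpose (R s) ** R t"
    by (simp add: X_def SO3_cancel(1)[OF SO3(2)[OF st(2)]] flip: matrix_mul_assoc)
  ultimately show ?thesis by simp
qed

section \<open>Half-turn chords of fixed length\<close>

lemma trace_3: "trace (A :: real^3^3) = A$1$1 + A$2$2 + A$3$3"
  by (simp add: trace_def sum_3)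

text \<open>In terms of a unit quaternion, \<open>1 + trace Q\<close> is four times the square of the real part, and the
antisymmetric part of \<open>Q\<close> is proportional to the real part.\<close>

lemma symmetric_if_half_turn:
  assumes Q: "Q \<in> SO3" and t: "trace Q = - 1"
  shows "transpose Q = Q"
proof -
  note o = SO3_orthonormal[OF Q] and c = SO3_cofactor[OF Q]
  have tr: "Q$1$1 + Q$2$2 + Q$3$3 = - 1" using t by (simp add: trace_3)
  have "(Q$3$2 - Q$2$3)\<^sup>2 = 0" using tr o(2,3,7) c(1) by algebra
  moreover have "(Q$1$3 - Q$3$1)\<^sup>2 = 0" using tr o(1,3,8) c(5) by algebra
  moreover have "(Q$2$1 - Q$1$2)\<^sup>2 = 0" using tr o(1,2,9) c(9) by algebra
  ultimately show ?thesis by (simp add: mat3_simps)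
qed

text \<open>If \<open>q\<close> is a unit quaternion of \<open>Q\<close>, then \<open>Q *v y = x\<close> means \<open>q y = x q\<close>. This is the third component of
that equation, multiplied by four times the real part of \<open>q\<close> so that it becomes a statement about \<open>Q\<close>.\<close>

lemma momentum_trace_identity:
  assumes Q: "Q \<in> SO3" and y: "Q *v y = x"
  shows "(x$3 - y$3) * (1 + trace Q) + (x$1 + y$1) * (Q$1$3 - Q$3$1) - (x$2 + y$2) * (Q$3$2 - Q$2$3) = 0"
proof -
  note o = SO3_orthonormal[OF Q] and c = SO3_cofactor[OF Q]
  have 1: "Q$3$1 * (1 + Q$1$1 + Q$2$2 + Q$3$3) + (Q$1$1 + 1) * (Q$1$3 - Q$3$1) - Q$2$1 * (Q$3$2 - Q$2$3) = 0"
    using o(11) c(3) by algebra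
  have 2: "Q$3$2 * (1 + Q$1$1 + Q$2$2 + Q$3$3) + Q$1$2 * (Q$1$3 - Q$3$1) - (Q$2$2 + 1) * (Q$3$2 - Q$2$3) = 0"
    using o(12) c(6) by algebra
  have 3: "(Q$3$3 - 1) * (1 + Q$1$1 + Q$2$2 + Q$3$3) + Q$1$3 * (Q$1$3 - Q$3$1) - Q$2$3 * (Q$3$2 - Q$2$3) = 0"
    using o(9) c(9,1,5) o(3) by algebra
  have x: "x$1 = Q$1$1 * y$1 + Q$1$2 * y$2 + Q$1$3 * y$3" "x$2 = Q$2$1 * y$1 + Q$2$2 * y$2 + Q$2$3 * y$3"
    "x$3 = Q$3$1 * y$1 + Q$3$2 * y$2 + Q$3$3 * y$3"
    by (simp_all add: y[symmetric] matrix_vector_mult_def sum_3)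
  show ?thesis unfolding x trace_3 using 1 2 3 by algebra
qed

text \<open>The derivative is a combination of two antisymmetric parts of \<open>K\<close>. The identity above eliminates
either of them, and the coefficient of the other then vanishes because both controls have norm 1.
Two forms are needed because neither factor \<open>l\<^sub>i + r\<^sub>i\<close> stays away from zero in all cases.\<close>

lemma chord_trace_derivative:
  fixes K :: "real \<Rightarrow> real^3^3"
  assumes a: "0 < a" "a < 1"
    and K: "K t \<in> SO3" "K t *v momentum a r = momentum a l"
    and K': "(K has_vector_derivative K t ** ctrl a (r$1) (r$2) - ctrl a (l$1) (l$2) ** K t) (at t)"
    and unit: "(l$1)\<^sup>2 + (l$2)\<^sup>2 = 1" "(r$1)\<^sup>2 + (r$2)\<^sup>2 = 1"
  obtains f' where "((\<lambda>t. 1 + trace (K t)) has_real_derivative f') (at t)"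
    "(l$1 + r$1) * f' = (l$2 - r$2) * (l$3 - r$3) * (1 + trace (K t))"
    "(l$2 + r$2) * f' = (r$1 - l$1) * (l$3 - r$3) * (1 + trace (K t))"
proof -
  define b where "b = sqrt (1 - a\<^sup>2)"
  have b: "0 < b" using contraction_factor(1)[OF a] by (simp add: b_def)
  define f' where "f' = - (b * (r$2 - l$2)) * (K t $ 3 $ 2 - K t $ 2 $ 3) - (r$1 - l$1) * (K t $ 1 $ 3 - K t $ 3 $ 1)"
  have "((\<lambda>t. 1 + trace (K t)) has_real_derivative
      0 + ((K t ** ctrl a (r$1) (r$2) - ctrl a (l$1) (l$2) ** K t)$1$1
      + (K t ** ctrl a (r$1) (r$2) - ctrl a (l$1) (l$2) ** K t)$2$2
      + (K t ** ctrl a (r$1) (r$2) - ctrl a (l$1) (l$2) ** K t)$3$3)) (at t)"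
    unfolding trace_3 by (intro DERIV_add DERIV_const entry_derivative[OF K'])
  then have d: "((\<lambda>t. 1 + trace (K t)) has_real_derivative f') (at t)"
    by (simp add: f'_def ctrl_entries matrix_matrix_mult_def sum_3 b_def algebra_simps)
  have id: "(l$3 - r$3) * (1 + trace (K t)) + (l$2 + r$2) * (K t$1$3 - K t$3$1)
      - b * (l$1 + r$1) * (K t$3$2 - K t$2$3) = 0"
    using momentum_trace_identity[OF K] by (simp add: b_def algebra_simps)
  have "(l$1 + r$1) * f' = (l$2 - r$2) * (l$3 - r$3) * (1 + trace (K t))"
    unfolding f'_def using id unit by algebra
  moreover have "(l$2 + r$2) * f' = (r$1 - l$1) * (l$3 - r$3) * (1 + trace (K t))"
    unfolding f'_def using id unit by algebra
  ultimately show ?thesis using that d by blast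
qed

lemma linear_ode_zero:
  fixes f h :: "real \<Rightarrow> real"
  assumes f: "\<And>t. t \<in> {x..y} \<Longrightarrow> (f has_real_derivative h t * f t) (at t within {x..y})"
    and h: "continuous_on {x..y} h" and s: "s \<in> {x..y}" "f s = 0" and t: "t \<in> {x..y}"
  shows "f t = 0"
proof -
  define H where "H = (\<lambda>t. integral {x..t} h)"
  have H: "(H has_real_derivative h t) (at t within {x..y})" if "t \<in> {x..y}" for t
    unfolding H_def by (rule integral_has_real_derivative[OF h that])
  have "((\<lambda>t. f t * exp (- H t)) has_real_derivative 0) (at t within {x..y})" if "t \<in> {x..y}" for t
    using that by (auto intro!: derivative_eq_intros f H simp: algebra_simps)
  then have "((\<lambda>t. f t * exp (- H t)) has_derivative (\<lambda>_. 0)) (at t within {x..y})" if "t \<in> {x..y}" for t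
    unfolding lambda_zero using that by (simp add: has_field_derivative_def)
  from has_derivative_zero_unique[OF _ this t s(1)] show ?thesis using s by simp
qed

lemma half_turn_chord_propagates:
  fixes K :: "real \<Rightarrow> real^3^3" and l r :: "real \<Rightarrow> real^3"
  assumes a: "0 < a" "a < 1"
    and K: "\<And>t. K t \<in> SO3" "\<And>t. K t *v momentum a (r t) = momentum a (l t)"
    and K': "\<And>t. (K has_vector_derivative K t ** ctrl a (r t$1) (r t$2) - ctrl a (l t$1) (l t$2) ** K t) (at t)"
    and unit: "\<And>t. (l t$1)\<^sup>2 + (l t$2)\<^sup>2 = 1" "\<And>t. (r t$1)\<^sup>2 + (r t$2)\<^sup>2 = 1"
    and cont: "\<And>i. continuous_on UNIV (\<lambda>t. l t $ i)" "\<And>i. continuous_on UNIV (\<lambda>t. r t $ i)"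
    and st: "s \<in> {x..y}" "t \<in> {x..y}" and s0: "trace (K s) = - 1"
    and ne: "(\<forall>t\<in>{x..y}. l t$1 + r t$1 \<noteq> 0) \<or> (\<forall>t\<in>{x..y}. l t$2 + r t$2 \<noteq> 0)"
  shows "trace (K t) = - 1"
proof -
  have c: "continuous_on {x..y} (\<lambda>t. l t $ i)" "continuous_on {x..y} (\<lambda>t. r t $ i)" for i
    by (rule continuous_on_subset[OF cont(1)], simp) (rule continuous_on_subset[OF cont(2)], simp)
  have zero: "1 + trace (K t) = 0"
    if n: "\<forall>t\<in>{x..y}. g t \<noteq> 0" and cg: "continuous_on {x..y} g" "continuous_on {x..y} k"
      and d: "\<And>t. \<exists>f'. ((\<lambda>t. 1 + trace (K t)) has_real_derivative f') (at t) \<and>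
        g t * f' = k t * (1 + trace (K t))" for g k :: "real \<Rightarrow> real"
  proof (rule linear_ode_zero[where f = "\<lambda>t. 1 + trace (K t)" and h = "\<lambda>t. k t / g t"])
    show "continuous_on {x..y} (\<lambda>t. k t / g t)" using n cg by (intro continuous_intros) auto
    fix t assume t: "t \<in> {x..y}"
    from d[of t] obtain f' where f': "((\<lambda>t. 1 + trace (K t)) has_real_derivative f') (at t)"
      "g t * f' = k t * (1 + trace (K t))" by (elim exE conjE)
    then have "f' = k t / g t * (1 + trace (K t))" using n t by (simp add: field_simps)
    with f'(1) show "((\<lambda>t. 1 + trace (K t)) has_real_derivative k t / g t * (1 + trace (K t))) (at t within {x..y})"
      by (simp add: has_field_derivative_at_within)
  qed (use st s0 in auto)
  note ode = chord_trace_derivative[OF a K K' unit]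
  from ne have "1 + trace (K t) = 0"
  proof
    assume "\<forall>t\<in>{x..y}. l t$1 + r t$1 \<noteq> 0"
    then show ?thesis
      by (rule zero[where k = "\<lambda>t. (l t$2 - r t$2) * (l t$3 - r t$3)"])
        (intro continuous_intros c | rule ode, blast)+
  next
    assume "\<forall>t\<in>{x..y}. l t$2 + r t$2 \<noteq> 0"
    then show ?thesis
      by (rule zero[where k = "\<lambda>t. (r t$1 - l t$1) * (l t$3 - r t$3)"])
        (intro continuous_intros c | rule ode, blast)+
  qed
  then show ?thesis by simp
qed

section \<open>Elliptic integrals and the amplitude\<close>

lemma antiderivative_exists:
  fixes f :: "real \<Rightarrow> real"
  assumes "continuous_on UNIV f"
  obtains F where "F 0 = 0" "\<And>x. (F has_real_derivative f x) (at x)"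
proof -
  have "\<exists>F. \<forall>x::real. (-\<infinity>::ereal) < x \<longrightarrow> x < (\<infinity>::ereal) \<longrightarrow> (F has_vector_derivative f x) (at x)"
    by (rule einterval_antiderivative) (use assms in \<open>auto simp: continuous_on_eq_continuous_at\<close>)
  then obtain F where F: "\<And>x. (F has_real_derivative f x) (at x)"
    by (auto simp: has_real_derivative_iff_has_vector_derivative)
  show ?thesis
    by (rule that[of "\<lambda>x. F x - F 0"]) (auto intro!: derivative_eq_intros F)
qed

lemma antiderivative_reflect:
  fixes F :: "real \<Rightarrow> real"
  assumes F: "\<And>x. (F has_real_derivative f x) (at x)" and f: "\<And>y. f (c + y) = f (d - y)"
  shows "F (c + y) - F c = F d - F (d - y)"
proof -
  have "((\<lambda>y. F (c + y) + F (d - y)) has_real_derivative 0) (at y)" for y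
  proof -
    have "((\<lambda>y. F (c + y)) has_real_derivative f (c + y) * 1) (at y)"
      by (rule DERIV_chain2[OF F]) (auto intro!: derivative_eq_intros)
    moreover have "((\<lambda>y. F (d - y)) has_real_derivative f (d - y) * (- 1)) (at y)"
      by (rule DERIV_chain2[OF F]) (auto intro!: derivative_eq_intros)
    ultimately show ?thesis using DERIV_add f by fastforce
  qed
  then have "F (c + y) + F (d - y) = F (c + 0) + F (d - 0)"
    by (intro DERIV_isconst_all) auto
  then show ?thesis by simp
qed

lemma sin_squared_reflect:
  fixes c y :: real
  assumes "cos c = 0"
  shows "(sin (c + y))\<^sup>2 = (sin (c - y))\<^sup>2" "(sin (c + y))\<^sup>2 = (sin (pi/2 - y))\<^sup>2"
    "sin (c + y) = sin (c - y)" "cos (c + y) = - cos (c - y)"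
proof -
  have "(sin c)\<^sup>2 = 1" using assms sin_cos_squared_add[of c] by simp
  then show "(sin (c + y))\<^sup>2 = (sin (c - y))\<^sup>2" "(sin (c + y))\<^sup>2 = (sin (pi/2 - y))\<^sup>2"
    "sin (c + y) = sin (c - y)" "cos (c + y) = - cos (c - y)"
    using assms by (simp_all add: sin_add sin_diff cos_add cos_diff power_mult_distrib)
qed

text \<open>Both the elliptic integral and the precession are antiderivatives of functions of \<open>sin\<^sup>2\<close>. They
inherit the reflection symmetries and the period \<open>pi\<close>.\<close>

lemma antiderivative_sin_squared:
  fixes F :: "real \<Rightarrow> real"
  assumes F: "F 0 = 0" "\<And>x. (F has_real_derivative g ((sin x)\<^sup>2)) (at x)"
  shows "cos c = 0 \<Longrightarrow> F (c + y) - F c = F (pi/2) - F (pi/2 - y)"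
    and "cos c = 0 \<Longrightarrow> F c - F (c - y) = F (pi/2) - F (pi/2 - y)"
    and "F (- x) = - F x"
    and "F (x + pi) = F x + 2 * F (pi/2)"
proof -
  show 1: "F (c + y) - F c = F (pi/2) - F (pi/2 - y)" if "cos c = 0" for c y
    by (rule antiderivative_reflect[OF F(2)]) (simp add: sin_squared_reflect(2)[OF that])
  have "F (c + y) - F c = F c - F (c - y)" if "cos c = 0" for c y
    by (rule antiderivative_reflect[OF F(2)]) (simp add: sin_squared_reflect(1)[OF that])
  with 1 show "F c - F (c - y) = F (pi/2) - F (pi/2 - y)" if "cos c = 0" for c y
    using that by metis
  show odd: "F (- x) = - F x" for x
    using antiderivative_reflect[OF F(2), of 0 0 x] by (simp add: F(1))
  have "F (x + pi) = F (pi/2 + (pi/2 + x))" by (simp add: algebra_simps)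
  also have "\<dots> = F (pi/2) + F (pi/2) - F (pi/2 - (pi/2 + x))"
    using 1[of "pi/2" "pi/2 + x"] by simp
  finally show "F (x + pi) = F x + 2 * F (pi/2)" using odd[of x] by simp
qed

text \<open>Jacobi's \<open>\<Delta>\<close>, as a function of the amplitude.\<close>

definition delta :: "real \<Rightarrow> real \<Rightarrow> real" where
  "delta k x = sqrt (1 - k\<^sup>2 * (sin x)\<^sup>2)"

lemma delta_bounds:
  assumes "0 < k" "k < 1"
  shows "0 < delta k x" "delta k x \<le> 1" "(delta k x)\<^sup>2 = 1 - k\<^sup>2 * (sin x)\<^sup>2"
proof -
  have "k\<^sup>2 * (sin x)\<^sup>2 \<le> k\<^sup>2 * 1"
    by (intro mult_left_mono) (auto simp: abs_square_le_1)
  also have "\<dots> < 1" using assms power_strict_mono[of k 1 2] by simp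
  finally have p: "0 < 1 - k\<^sup>2 * (sin x)\<^sup>2" by simp
  then show "0 < delta k x" "(delta k x)\<^sup>2 = 1 - k\<^sup>2 * (sin x)\<^sup>2" by (simp_all add: delta_def)
  show "delta k x \<le> 1" by (simp add: delta_def)
qed

lemma delta_derivative:
  assumes "0 < k" "k < 1"
  shows "(delta k has_real_derivative - (k\<^sup>2 * sin x * cos x) / delta k x) (at x)"
proof -
  have p: "0 < 1 - k\<^sup>2 * (sin x)\<^sup>2" using delta_bounds[OF assms, of x] by (simp add: delta_def)
  have "((\<lambda>x. sqrt (1 - k\<^sup>2 * (sin x)\<^sup>2)) has_real_derivative
      - (k\<^sup>2 * (2 * sin x * cos x)) / (2 * sqrt (1 - k\<^sup>2 * (sin x)\<^sup>2))) (at x)"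
    using p by (auto intro!: derivative_eq_intros simp: field_simps)
  then show ?thesis by (simp add: delta_def[abs_def] mult_ac)
qed

lemma incomplete_integral:
  assumes k: "0 < k" "k < 1"
  obtains G where "G 0 = 0" "\<And>x. (G has_real_derivative 1 / delta k x) (at x)"
    "G (pi/2) = elliptic_K (k\<^sup>2)" "\<And>x y. x < y \<Longrightarrow> G x < G y" "\<And>z. \<exists>x. G x = z"
proof -
  have "continuous_on UNIV (\<lambda>x. 1 / delta k x)"
    using delta_bounds(1)[OF k] unfolding delta_def
    by (intro continuous_intros) (auto simp: less_le)
  then obtain G where G: "G 0 = 0" "\<And>x. (G has_real_derivative 1 / delta k x) (at x)"
    by (rule antiderivative_exists) blast
  have cont: "isCont G x" for x using G(2) by (rule DERIV_isCont)
  have inc: "G x + (y - x) \<le> G y" if "x \<le> y" for x y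
  proof (cases "x = y")
    case False
    with that have "x < y" by simp
    from MVT2[OF this, of G "\<lambda>x. 1 / delta k x"]
    obtain z where "x < z" "z < y" "G y - G x = (y - x) * (1 / delta k z)"
      using G(2) by blast
    moreover have "1 \<le> 1 / delta k z" using delta_bounds(1,2)[OF k, of z] by simp
    ultimately show ?thesis using that mult_left_mono[of 1 "1 / delta k z" "y - x"] by simp
  qed simp
  have "((\<lambda>x. 1 / delta k x) has_integral (G (pi/2) - G 0)) {0..pi/2}"
    by (rule fundamental_theorem_of_calculus)
      (auto simp: has_real_derivative_iff_has_vector_derivative[symmetric] intro: has_field_derivative_at_within G)
  then have "G (pi/2) = elliptic_K (k\<^sup>2)"
    unfolding elliptic_K_def delta_def using G(1) by (simp add: integral_unique)
  moreover have "\<exists>x. G x = z" for z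
  proof -
    have "G (- \<bar>z\<bar>) \<le> z" "z \<le> G \<bar>z\<bar>" using inc[of "- \<bar>z\<bar>" 0] inc[of 0 "\<bar>z\<bar>"] G(1) by auto
    then show ?thesis using IVT[of G "- \<bar>z\<bar>" z "\<bar>z\<bar>"] cont by auto
  qed
  moreover have "G x < G y" if "x < y" for x y using inc[of x y] that by simp
  ultimately show ?thesis using that G by blast
qed

text \<open>The amplitude is obtained by inverting the incomplete elliptic integral, which increases by \<open>lam\<close> per
unit of time.\<close>

lemma amplitude_exists:
  assumes k: "0 < k" "k < 1"
    and G: "\<And>x. (G has_real_derivative 1 / delta k x) (at x)" "\<And>x y. x < y \<Longrightarrow> G x < G y" "\<And>z. \<exists>x. G x = z"
  obtains x where "x 0 = x0" "\<And>t. G (x t) = G x0 + lam * t"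
    "\<And>t. (x has_real_derivative lam * delta k (x t)) (at t)"
proof -
  define g where "g = (\<lambda>z. SOME x. G x = z)"
  have Gg: "G (g z) = z" for z unfolding g_def using G(3) by (rule someI_ex)
  have inj: "x = y" if "G x = G y" for x y using G(2)[of x y] G(2)[of y x] that by (cases x y rule: linorder_cases) auto
  have gG: "g (G x) = x" for x using Gg inj by blast
  have gc: "isCont g z" for z
  proof -
    have "isCont g (G (g z))"
      by (rule isCont_inverse_function[where d = 1]) (auto simp: gG intro: DERIV_isCont[OF G(1)])
    then show ?thesis by (simp add: Gg)
  qed
  have gd: "(g has_real_derivative delta k (g z)) (at z)" for z
  proof -
    have "(g has_real_derivative inverse (1 / delta k (g z))) (at z)"
      by (rule DERIV_inverse_function[where f = G and a = "z - 1" and b = "z + 1"])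
        (use G(1) gc Gg delta_bounds(1)[OF k, of "g z"] in auto)
    then show ?thesis by simp
  qed
  show ?thesis
  proof (rule that[of "\<lambda>t. g (G x0 + lam * t)"])
    fix t
    have "((\<lambda>t. g (G x0 + lam * t)) has_real_derivative delta k (g (G x0 + lam * t)) * lam) (at t)"
      by (rule DERIV_chain2[OF gd]) (auto intro!: derivative_eq_intros)
    then show "((\<lambda>t. g (G x0 + lam * t)) has_real_derivative lam * delta k (g (G x0 + lam * t))) (at t)"
      by (simp add: mult.commute)
  qed (simp_all add: gG Gg)
qed

text \<open>The function is the continuous branch of \<open>arctan ((M / b) tan x)\<close>, written as \<open>x\<close> plus an arctangent
that never meets a pole.\<close>

lemma stretched_angle:
  fixes b M :: real
  assumes b: "0 < b" "0 < M"
  obtains g where "g 0 = 0" "g (pi/2) = pi/2"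
    "\<And>x. (g has_real_derivative M * b / (b\<^sup>2 * (cos x)\<^sup>2 + M\<^sup>2 * (sin x)\<^sup>2)) (at x)"
proof -
  define N where "N = (\<lambda>x. (M - b) * sin x * cos x)"
  define E where "E = (\<lambda>x. b * (cos x)\<^sup>2 + M * (sin x)\<^sup>2)"
  have E: "0 < E x" for x
  proof -
    have "0 < (cos x)\<^sup>2 \<or> 0 < (sin x)\<^sup>2" using sin_cos_squared_add[of x] by (metis add_0_left less_le zero_le_power2 zero_neq_one)
    then show ?thesis unfolding E_def using b
      by (metis add_nonneg_pos add_pos_nonneg less_eq_real_def mult_nonneg_nonneg mult_pos_pos zero_le_power2)
  qed
  show ?thesis
  proof (rule that[of "\<lambda>x. x + arctan (N x / E x)"])
    fix x
    have "((\<lambda>x. x + arctan (N x / E x)) has_real_derivative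
        1 + inverse (1 + (N x / E x)\<^sup>2) * (((M - b) * ((cos x)\<^sup>2 - (sin x)\<^sup>2) * E x - N x * (2 * (M - b) * sin x * cos x)) / (E x * E x))) (at x)"
    proof -
      have N': "(N has_real_derivative (M - b) * ((cos x)\<^sup>2 - (sin x)\<^sup>2)) (at x)"
        unfolding N_def by (auto intro!: derivative_eq_intros simp: algebra_simps power2_eq_square)
      have E': "(E has_real_derivative 2 * (M - b) * sin x * cos x) (at x)"
        unfolding E_def by (auto intro!: derivative_eq_intros simp: algebra_simps power2_eq_square)
      have "E x \<noteq> 0" using E[of x] by simp
      from DERIV_chain2[OF DERIV_arctan DERIV_divide[OF N' E' this]]
      show ?thesis by (intro DERIV_add DERIV_ident)
    qed
    moreover have "1 + inverse (1 + (N x / E x)\<^sup>2) * (((M - b) * ((cos x)\<^sup>2 - (sin x)\<^sup>2) * E x - N x * (2 * (M - b) * sin x * cos x)) / (E x * E x))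
      = M * b / (b\<^sup>2 * (cos x)\<^sup>2 + M\<^sup>2 * (sin x)\<^sup>2)"
    proof -
      have s: "(sin x)\<^sup>2 + (cos x)\<^sup>2 = 1" by simp
      have q: "(E x)\<^sup>2 + (N x)\<^sup>2 = b\<^sup>2 * (cos x)\<^sup>2 + M\<^sup>2 * (sin x)\<^sup>2"
        unfolding E_def N_def using s by algebra
      have n: "(E x)\<^sup>2 + (N x)\<^sup>2 + ((M - b) * ((cos x)\<^sup>2 - (sin x)\<^sup>2) * E x - N x * (2 * (M - b) * sin x * cos x)) = M * b"
        unfolding E_def N_def using s by algebra
      have p: "0 < (E x)\<^sup>2 + (N x)\<^sup>2" using E[of x] by (simp add: add_pos_nonneg)
      define Y where "Y = ((M - b) * ((cos x)\<^sup>2 - (sin x)\<^sup>2) * E x - N x * (2 * (M - b) * sin x * cos x))"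
      have "1 + (N x / E x)\<^sup>2 = ((E x)\<^sup>2 + (N x)\<^sup>2) / (E x * E x)"
        using E[of x] by (simp add: power_divide add_divide_distrib power2_eq_square)
      then have "inverse (1 + (N x / E x)\<^sup>2) * (Y / (E x * E x)) = Y / ((E x)\<^sup>2 + (N x)\<^sup>2)"
        using E[of x] p by simp
      also have "1 + \<dots> = ((E x)\<^sup>2 + (N x)\<^sup>2 + Y) / ((E x)\<^sup>2 + (N x)\<^sup>2)"
        unfolding add_divide_distrib[of "(E x)\<^sup>2 + (N x)\<^sup>2" Y]
        by (simp only: divide_self[OF less_imp_neq[OF p, symmetric]])
      also have "\<dots> = M * b / (b\<^sup>2 * (cos x)\<^sup>2 + M\<^sup>2 * (sin x)\<^sup>2)"
        using n by (simp only: q Y_def)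
      finally show ?thesis by (simp only: Y_def)
    qed
    ultimately show "((\<lambda>x. x + arctan (N x / E x)) has_real_derivative
        M * b / (b\<^sup>2 * (cos x)\<^sup>2 + M\<^sup>2 * (sin x)\<^sup>2)) (at x)" by simp
  qed (simp_all add: N_def)
qed

lemma derivative_le_imp_increment_le:
  fixes f g :: "real \<Rightarrow> real"
  assumes "\<And>x. (f has_real_derivative f' x) (at x)" "\<And>x. (g has_real_derivative g' x) (at x)"
    and "\<And>x. f' x \<le> g' x" "x \<le> y"
  shows "f y - f x \<le> g y - g x"
proof -
  have "(\<lambda>x. g x - f x) x \<le> (\<lambda>x. g x - f x) y"
    by (rule DERIV_nonneg_imp_nondecreasing[OF assms(4)])
      (use assms in \<open>auto intro!: exI derivative_eq_intros\<close>)
  then show ?thesis by simp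
qed

section \<open>Lower bounds for the precession\<close>

text \<open>Up to a factor \<open>1 / (a \<Delta>) \<ge> 1\<close>, the precession per unit of amplitude is the derivative of a stretched angle, which
increases by exactly \<open>pi / 2\<close> over a quarter period.\<close>

lemma oscillating_precession_bound:
  fixes a k :: real
  assumes a: "0 < a" "a < 1" and k: "0 < k" "k < 1"
  defines "b \<equiv> sqrt (1 - a\<^sup>2)"
  defines "M \<equiv> sqrt (b\<^sup>2 + a\<^sup>2 * k\<^sup>2)"
  assumes P: "P 0 = 0"
    "\<And>x. (P has_real_derivative M * b / (a * delta k x * (b\<^sup>2 + a\<^sup>2 * k\<^sup>2 * (sin x)\<^sup>2))) (at x)"
  shows "pi / 2 \<le> P (pi/2)"
proof -
  note b = contraction_factor[OF a, folded b_def]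
  have M: "0 < M" "M\<^sup>2 = b\<^sup>2 + a\<^sup>2 * k\<^sup>2" using b(1) by (simp_all add: M_def add_pos_nonneg)
  obtain g where g: "g 0 = 0" "g (pi/2) = pi/2"
    "\<And>x. (g has_real_derivative M * b / (b\<^sup>2 * (cos x)\<^sup>2 + M\<^sup>2 * (sin x)\<^sup>2)) (at x)"
    by (rule stretched_angle[OF b(1) M(1)]) blast
  have "g (pi/2) - g 0 \<le> P (pi/2) - P 0"
  proof (rule derivative_le_imp_increment_le[OF g(3) P(2)])
    fix x
    have w: "b\<^sup>2 * (cos x)\<^sup>2 + M\<^sup>2 * (sin x)\<^sup>2 = b\<^sup>2 + a\<^sup>2 * k\<^sup>2 * (sin x)\<^sup>2"
      unfolding M(2) cos_squared_eq by (simp add: algebra_simps)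
    have p: "0 < b\<^sup>2 + a\<^sup>2 * k\<^sup>2 * (sin x)\<^sup>2" using b(1) by (simp add: add_pos_nonneg)
    have "a * delta k x \<le> 1 * 1" using a delta_bounds[OF k, of x] by (intro mult_mono) auto
    then have "a * delta k x * (b\<^sup>2 + a\<^sup>2 * k\<^sup>2 * (sin x)\<^sup>2) \<le> 1 * (b\<^sup>2 + a\<^sup>2 * k\<^sup>2 * (sin x)\<^sup>2)"
      using p by (intro mult_right_mono) auto
    then show "M * b / (b\<^sup>2 * (cos x)\<^sup>2 + M\<^sup>2 * (sin x)\<^sup>2)
        \<le> M * b / (a * delta k x * (b\<^sup>2 + a\<^sup>2 * k\<^sup>2 * (sin x)\<^sup>2))"
      unfolding w using M(1) b(1) a(1) delta_bounds(1)[OF k, of x] p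
      by (intro divide_left_mono) auto
  qed simp
  then show ?thesis using g P by simp
qed

text \<open>Let \<open>s\<close> be the speed \<open>p\<^sub>3\<close> and \<open>w\<close> the squared horizontal momentum. Per unit of amplitude, the precession
increases by \<open>M b / (s w) = b / w + b / ((M + s) s)\<close>: a stretched angle plus a
term that contributes at least \<open>b / (2 M)\<close> per unit of time. If half a period takes time at most \<open>pi\<close>, the stretched angle alone
gives \<open>pi / 2\<close> on each quarter, and \<open>x = pi / 2\<close> works. Otherwise \<open>x\<close> is the amplitude reached in
time \<open>pi / 2\<close>. The stretched angle then falls short of \<open>pi / 2\<close> by at most \<open>2 b e\<close>, where
\<open>e = pi / 2 - x\<close>, and the second term, accumulated over the long half period, makes up for that.\<close>

lemma rotating_precession_bound:
  fixes a k :: real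
  assumes a: "0 < a" "a < 1" and k: "0 < k" "k < 1"
  defines "b \<equiv> sqrt (1 - a\<^sup>2)"
  defines "c \<equiv> a / k"
  defines "M \<equiv> sqrt (b\<^sup>2 + c\<^sup>2)"
  assumes G: "G 0 = 0" "\<And>x. (G has_real_derivative 1 / delta k x) (at x)"
  assumes P: "P 0 = 0"
    "\<And>x. (P has_real_derivative M * b / (c * delta k x * (b\<^sup>2 + a\<^sup>2 * (sin x)\<^sup>2))) (at x)"
  obtains x where "0 < x" "x \<le> pi / 2" "pi \<le> P (pi/2) + P x" "2 / c * G x \<le> pi"
proof -
  note b = contraction_factor[OF a, folded b_def]
  have c: "0 < c" "c * k = a" using a k by (simp_all add: c_def)
  have M: "0 < M" "M\<^sup>2 = b\<^sup>2 + c\<^sup>2" using b(1) by (simp_all add: M_def add_pos_nonneg)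
  define s where "s = (\<lambda>x. c * delta k x)"
  define w where "w = (\<lambda>x. b\<^sup>2 + a\<^sup>2 * (sin x)\<^sup>2)"
  have s: "0 < s x" "(s x)\<^sup>2 = c\<^sup>2 - a\<^sup>2 * (sin x)\<^sup>2" for x
  proof -
    show "0 < s x" using c(1) delta_bounds(1)[OF k, of x] by (simp add: s_def)
    show "(s x)\<^sup>2 = c\<^sup>2 - a\<^sup>2 * (sin x)\<^sup>2"
      unfolding s_def power_mult_distrib delta_bounds(3)[OF k]
      by (simp add: c(2)[symmetric] power_mult_distrib algebra_simps)
  qed
  have w: "0 < w x" for x using b(1) by (simp add: w_def add_pos_nonneg)
  have sw: "(s x)\<^sup>2 + w x = M\<^sup>2" for x by (simp add: s(2) w_def M(2))
  have sM: "s x < M" for x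
    by (rule power2_less_imp_less) (use sw[of x] w[of x] M(1) in auto)
  define T where "T = (\<lambda>x. G x / c)"
  have T: "T 0 = 0" "(T has_real_derivative 1 / s x) (at x)" for x
    using DERIV_cdivide[OF G(2), of c x] G(1) by (simp_all add: T_def[abs_def] s_def mult.commute)
  obtain g where g: "g 0 = 0" "g (pi/2) = pi/2"
    "\<And>x. (g has_real_derivative 1 * b / (b\<^sup>2 * (cos x)\<^sup>2 + 1\<^sup>2 * (sin x)\<^sup>2)) (at x)"
    by (rule stretched_angle[OF b(1) zero_less_one]) blast
  have w': "b\<^sup>2 * (cos x)\<^sup>2 + 1\<^sup>2 * (sin x)\<^sup>2 = w x" for x
    unfolding w_def cos_squared_eq b(3) by (simp add: algebra_simps)
  have g': "(g has_real_derivative b / w x) (at x)" for x using g(3)[of x] by (simp only: w') simp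
  have lower: "g x + b / (2 * M) * T x \<le> P x" if "0 \<le> x" for x
  proof -
    have "(g x + b / (2 * M) * T x) - (g 0 + b / (2 * M) * T 0) \<le> P x - P 0"
    proof (rule derivative_le_imp_increment_le[OF _ P(2) _ that])
      fix x
      show "((\<lambda>x. g x + b / (2 * M) * T x) has_real_derivative b / w x + b / (2 * M) * (1 / s x)) (at x)"
        by (intro DERIV_add g' DERIV_cmult T(2))
      have "w x = (M + s x) * (M - s x)" using sw[of x] by (simp add: power2_eq_square algebra_simps)
      then have "M * b / (s x * w x) = b / w x + b / ((M + s x) * s x)"
        using s(1)[of x] M(1) sM[of x] by (simp add: divide_simps) (simp add: algebra_simps)
      moreover have "b / ((2 * M) * s x) \<le> b / ((M + s x) * s x)"
        using sM[of x] s(1)[of x] M(1) b(1) by (intro divide_left_mono mult_right_mono) auto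
      ultimately show "b / w x + b / (2 * M) * (1 / s x) \<le> M * b / (c * delta k x * (b\<^sup>2 + a\<^sup>2 * (sin x)\<^sup>2))"
        by (simp add: s_def w_def)
    qed
    then show ?thesis by (simp add: g(1) T(1) P(1))
  qed
  have coef: "0 < b / (2 * M)" using b(1) M(1) by simp
  have Tmono: "T x < T y" if "x < y" for x y
    by (rule DERIV_pos_imp_increasing[OF that]) (use T(2) s(1) in \<open>auto intro!: exI\<close>)
  show thesis
  proof (cases "2 * T (pi/2) \<le> pi")
    case True
    have "0 < T (pi/2)" using Tmono[of 0 "pi/2"] T(1) by simp
    then have "0 \<le> b / (2 * M) * T (pi/2)" using coef by (intro mult_nonneg_nonneg) auto
    then have "pi / 2 \<le> P (pi/2)" using lower[of "pi/2"] g(2) by simp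
    then show thesis using that[of "pi/2"] True by (simp add: T_def)
  next
    case False
    \<comment> \<open>\<open>H\<close> is half a period of the covector.\<close>
    define H where "H = 2 * T (pi/2)"
    have H: "pi < H" using False by (simp add: H_def)
    have "\<exists>x\<ge>0. x \<le> pi/2 \<and> T x = pi/2"
      using H T(1) by (intro IVT) (auto simp: H_def intro: DERIV_isCont[OF T(2)])
    then obtain x where x: "0 \<le> x" "x \<le> pi/2" "T x = pi/2" by blast
    have x0: "0 < x" using x T(1) by (cases "x = 0") auto
    have x1: "x < pi/2" using x H by (cases "x = pi/2") (auto simp: H_def)
    define e where "e = pi/2 - x"
    obtain u where u: "0 < u" "u < x" "T x - T 0 = (x - 0) * (1 / s u)"
      using MVT2[OF x0, of T "\<lambda>x. 1 / s x"] T(2) by blast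
    obtain v where v: "x < v" "v < pi/2" "T (pi/2) - T x = (pi/2 - x) * (1 / s v)"
      using MVT2[OF x1, of T "\<lambda>x. 1 / s x"] T(2) by blast
    obtain z where z: "x < z" "z < pi/2" "g (pi/2) - g x = (pi/2 - x) * (b / w z)"
      using MVT2[OF x1, of g "\<lambda>x. b / w x"] g' by blast
    have xu: "x = s u * (pi/2)" using u(3) s(1)[of u] x(3) T(1) by (simp add: field_simps)
    have ev: "e = s v * ((H - pi) / 2)" using v(3) s(1)[of v] x(3) by (simp add: field_simps e_def H_def)
    have "sin u \<le> sin v" using u v x by (intro sin_monotone_2pi_le) auto
    then have "(sin u)\<^sup>2 \<le> (sin v)\<^sup>2" using u v sin_ge_zero[of u] by (intro power_mono) auto
    then have "(s v)\<^sup>2 \<le> (s u)\<^sup>2" unfolding s(2) by (simp add: mult_left_mono)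
    then have "s v \<le> s u" by (rule power2_le_imp_le[OF _ less_imp_le[OF s(1)]])
    then have "s v * ((H - pi) / 2 * pi) \<le> s u * ((H - pi) / 2 * pi)"
      using H by (intro mult_right_mono) auto
    moreover have "e * pi = s v * ((H - pi) / 2 * pi)" by (subst ev) simp
    moreover have "x * (H - pi) = s u * ((H - pi) / 2 * pi)" by (subst xu) simp
    ultimately have "e * pi \<le> x * (H - pi)" by (simp only:)
    then have eH: "e * H \<le> pi / 2 * (H - pi)" by (simp add: e_def algebra_simps)
    \<comment> \<open>A long half period forces the speed below \<open>1\<close> somewhere, so \<open>c\<^sup>2 < 1 + a\<^sup>2\<close> and \<open>M\<^sup>2 < 2\<close>.\<close>
    have M2: "M < sqrt 2"
    proof -
      obtain r where r: "0 < r" "r < pi/2" "T (pi/2) - T 0 = (pi/2 - 0) * (1 / s r)"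
        using MVT2[of 0 "pi/2" T "\<lambda>x. 1 / s x"] T(2) by auto
      have "H = pi / s r" using r(3) T(1) by (simp add: H_def)
      then have "H * s r = pi" using s(1)[of r] by simp
      then have "H * s r < H * 1" using H by simp
      then have "s r < 1" using H pi_gt_zero by (simp only: mult_less_cancel_left_pos)
      then have "(s r)\<^sup>2 < 1" using s(1)[of r] by (simp add: power_strict_mono[of _ 1 2, simplified])
      moreover have "a\<^sup>2 * (sin r)\<^sup>2 \<le> a\<^sup>2 * 1" by (intro mult_left_mono) (auto simp: abs_square_le_1)
      ultimately have "M\<^sup>2 < 2" unfolding s(2) M(2) using b(3) by simp
      then show ?thesis using M(1) by (simp add: real_less_rsqrt)
    qed
    \<comment> \<open>If \<open>a\<^sup>2 > 1/2\<close>, the amplitude passes \<open>pi / 4\<close> before time \<open>pi / 2\<close>, since up to there the speed is at least \<open>1/2\<close>.\<close>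
    have wz: "1 / 2 \<le> w z"
    proof (cases "a\<^sup>2 \<le> 1/2")
      case True
      moreover have "0 \<le> a\<^sup>2 * (sin z)\<^sup>2" by simp
      ultimately show ?thesis unfolding w_def b(3) by linarith
    next
      case False
      have "pi / 4 \<le> x"
      proof (rule ccontr)
        assume "\<not> pi / 4 \<le> x"
        then have u4: "0 \<le> u" "u \<le> pi/4" using u by auto
        then have "cos (pi/4) \<le> cos u" by (intro cos_monotone_0_pi_le) auto
        then have "(sqrt 2 / 2)\<^sup>2 \<le> (cos u)\<^sup>2" unfolding cos_45 by (intro power_mono) auto
        then have "1/2 \<le> (cos u)\<^sup>2" by (simp add: power_divide)
        then have "1/2 * (1/2) \<le> a\<^sup>2 * (cos u)\<^sup>2" using False by (intro mult_mono) auto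
        also have "\<dots> \<le> (s u)\<^sup>2"
        proof -
          have "a \<le> c" using c k a by (metis mult.right_neutral mult_left_mono less_imp_le)
          then have "a\<^sup>2 \<le> c\<^sup>2" using a by (intro power_mono) auto
          then show ?thesis unfolding s(2) cos_squared_eq by (simp add: algebra_simps)
        qed
        finally have "(1/2)\<^sup>2 \<le> (s u)\<^sup>2" by (simp add: power2_eq_square)
        then have "1/2 \<le> s u" by (rule power2_le_imp_le[OF _ less_imp_le[OF s(1)]])
        then have "1/2 * (pi / 2) \<le> s u * (pi / 2)" by (intro mult_right_mono) auto
        then show False using xu \<open>\<not> pi / 4 \<le> x\<close> by linarith
      qed
      then have "sin (pi/4) \<le> sin z" using z by (intro sin_monotone_2pi_le) auto
      then have "(sqrt 2 / 2)\<^sup>2 \<le> (sin z)\<^sup>2" unfolding sin_45 by (intro power_mono) auto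
      then have "1/2 \<le> (sin z)\<^sup>2" by (simp add: power_divide)
      then have "a\<^sup>2 * (1/2) \<le> a\<^sup>2 * (sin z)\<^sup>2" by (intro mult_left_mono) auto
      moreover have "a\<^sup>2 \<le> 1" using a by (simp add: power_le_one)
      ultimately show ?thesis unfolding w_def b(3) by simp
    qed
    have e0: "0 < e" using x1 by (simp add: e_def)
    have "g (pi/2) - g x = e * (b / w z)" using z(3) by (simp add: e_def)
    also have "\<dots> \<le> e * (b / (1/2))" using wz e0 b(1) w[of z] by (intro mult_left_mono divide_left_mono) auto
    finally have gx: "pi/2 - g x \<le> b * (2 * e)" using g(2) by (simp add: mult_ac)
    have key: "2 * e \<le> (H + pi) / (4 * M)"
    proof -
      have "sqrt 2 \<le> 1.415" by (rule real_le_lsqrt) (simp_all add: power2_eq_square)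
      then have M3: "4 * M \<le> 5.66" using M2 by simp
      have "5.66 * (pi * (H - pi)) \<le> H * (H + pi)"
      proof -
        \<comment> \<open>Completing the square: \<open>5.66 = 1 + 2 * 2.33 = 2.33\<^sup>2 + 0.2311\<close>.\<close>
        have "0 \<le> (H - 2.33 * pi)\<^sup>2 + 0.2311 * pi\<^sup>2" by simp
        then show ?thesis by (simp add: power2_eq_square algebra_simps)
      qed
      moreover have "4 * M * (pi * (H - pi)) \<le> 5.66 * (pi * (H - pi))"
        using M3 H by (intro mult_right_mono) auto
      moreover have "4 * M * (2 * (e * H)) \<le> 4 * M * (pi * (H - pi))"
        using eH M(1) by (intro mult_left_mono) auto
      ultimately have "H * (4 * M * (2 * e)) \<le> H * (H + pi)" by (simp add: algebra_simps)
      then have "4 * M * (2 * e) \<le> H + pi" using H pi_gt_zero by (simp add: mult_le_cancel_left_pos)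
      then show ?thesis using M(1) by (simp add: field_simps)
    qed
    have "pi/2 - g x \<le> b * ((H + pi) / (4 * M))" using gx key b(1) mult_left_mono[OF key, of b] by simp
    also have "\<dots> = b / (2 * M) * T (pi/2) + b / (2 * M) * T x"
      using M(1) by (simp add: x(3) H_def field_simps)
    finally have "pi \<le> P (pi/2) + P x" using lower[of "pi/2"] lower[of x] x0 g(2) by simp
    moreover have "2 / c * G x \<le> pi" using x(3) by (simp add: T_def mult.commute)
    ultimately show thesis using that[of x] x0 x1 by simp
  qed
qed

section \<open>Geodesics as solutions on the whole line\<close>

definition reflect_covector :: "real^3^3 \<Rightarrow> real^3 \<Rightarrow> real^3" where
  "reflect_covector D q = vector [D$2$2 * q$1, D$1$1 * q$2, D$3$3 * q$3]"

lemma reflect_covector_nth [simp]: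
  "reflect_covector D q $ 1 = D$2$2 * q$1" "reflect_covector D q $ 2 = D$1$1 * q$2"
  "reflect_covector D q $ 3 = D$3$3 * q$3"
  by (simp_all add: reflect_covector_def)

lemma sign_matrix_cases:
  assumes "sign_matrix D"
  obtains "D = diag3 1 1 1" | "D = diag3 1 (-1) (-1)" | "D = diag3 (-1) 1 (-1)" | "D = diag3 (-1) (-1) 1"
  using assms unfolding sign_matrix_def by blast

lemma sign_matrix_entries:
  assumes "sign_matrix D"
  shows "D$1$1 * D$2$2 = D$3$3" "D$3$3 * D$1$1 = D$2$2" "D$3$3 * D$2$2 = D$1$1"
  by (rule sign_matrix_cases[OF assms]; simp add: diag3_def)+

lemma reflect_covector_unit:
  assumes "sign_matrix D"
  shows "(reflect_covector D q $ 1)\<^sup>2 + (reflect_covector D q $ 2)\<^sup>2 = (q$1)\<^sup>2 + (q$2)\<^sup>2"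
  by (simp add: power_mult_distrib sign_matrix_entry_square[OF assms])

lemma momentum_reflect:
  assumes "sign_matrix D"
  shows "momentum a (reflect_covector D q) = D *v momentum a q"
  by (rule sign_matrix_cases[OF assms]; simp add: diag3_def mat3_simps)

text \<open>Conjugation by \<open>diag (-1, -1, 1)\<close> changes the signs of \<open>p\<^sub>1\<close> and \<open>p\<^sub>2\<close>, and conjugation by
\<open>diag (1, -1, -1)\<close> those of \<open>p\<^sub>1\<close> and \<open>p\<^sub>3\<close>. This reduces \<open>C1\<close> to \<open>p\<^sub>1 > 0\<close> and \<open>C2\<close> to \<open>p\<^sub>3 > 0\<close>.\<close>

lemma geodesic_reflect:
  assumes D: "sign_matrix D" and geo: "arclength_geodesic a R p"
  shows "arclength_geodesic a (\<lambda>t. D ** R t ** D) (\<lambda>t. reflect_covector D (p t))"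
  unfolding arclength_geodesic_def
proof (intro conjI allI impI)
  show "D ** R 0 ** D = mat 1"
    using geo sign_matrix_square[OF D] by (simp add: arclength_geodesic_def)
  fix t :: real assume t: "0 \<le> t"
  show "D ** R t ** D \<in> SO3"
    using geo t sign_matrix_SO3[OF D] by (simp add: arclength_geodesic_def SO3_mult)
  have R: "(R has_vector_derivative R t ** ctrl a (p t $ 1) (p t $ 2)) (at t within {0..})"
    and d: "((\<lambda>s. p s $ 1) has_real_derivative p t $ 3 * p t $ 2) (at t within {0..})"
      "((\<lambda>s. p s $ 2) has_real_derivative - (p t $ 3 * p t $ 1)) (at t within {0..})"
      "((\<lambda>s. p s $ 3) has_real_derivative a\<^sup>2 * p t $ 1 * p t $ 2) (at t within {0..})"
    and u: "(p t $ 1)\<^sup>2 + (p t $ 2)\<^sup>2 = 1"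
    using geo t by (auto simp: arclength_geodesic_def ctrl_def)
  note e = sign_matrix_entries[OF D]
  show "((\<lambda>t. D ** R t ** D) has_vector_derivative D ** R t ** D **
      (reflect_covector D (p t) $ 1 *\<^sub>R X1 + reflect_covector D (p t) $ 2 *\<^sub>R X2 a)) (at t within {0..})"
    using conjugate_derivative[OF D R] by (simp add: ctrl_def)
  have e1: "D$2$2 * (p t $ 3 * p t $ 2) = (D$3$3 * p t $ 3) * (D$1$1 * p t $ 2)"
    by (simp add: e(2)[symmetric])
  show "((\<lambda>s. reflect_covector D (p s) $ 1) has_real_derivative
      reflect_covector D (p t) $ 3 * reflect_covector D (p t) $ 2) (at t within {0..})"
    using DERIV_cong[OF DERIV_cmult[OF d(1)] e1] by simp
  have e2: "D$1$1 * - (p t $ 3 * p t $ 1) = - ((D$3$3 * p t $ 3) * (D$2$2 * p t $ 1))"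
    by (simp add: e(3)[symmetric])
  show "((\<lambda>s. reflect_covector D (p s) $ 2) has_real_derivative
      - (reflect_covector D (p t) $ 3 * reflect_covector D (p t) $ 1)) (at t within {0..})"
    using DERIV_cong[OF DERIV_cmult[OF d(2)] e2] by simp
  have e3: "D$3$3 * (a\<^sup>2 * p t $ 1 * p t $ 2) = a\<^sup>2 * (D$2$2 * p t $ 1) * (D$1$1 * p t $ 2)"
    by (simp add: e(1)[symmetric])
  show "((\<lambda>s. reflect_covector D (p s) $ 3) has_real_derivative
      a\<^sup>2 * reflect_covector D (p t) $ 1 * reflect_covector D (p t) $ 2) (at t within {0..})"
    using DERIV_cong[OF DERIV_cmult[OF d(3)] e3] by simp
  show "(reflect_covector D (p t) $ 1)\<^sup>2 + (reflect_covector D (p t) $ 2)\<^sup>2 = 1"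
    using u reflect_covector_unit[OF D] by simp
qed

definition covector_flow :: "real \<Rightarrow> (real \<Rightarrow> real^3) \<Rightarrow> bool" where
  "covector_flow a p \<longleftrightarrow> (\<forall>t\<ge>0.
     ((\<lambda>s. p s $ 1) has_real_derivative p t $ 3 * p t $ 2) (at t within {0..}) \<and>
     ((\<lambda>s. p s $ 2) has_real_derivative - (p t $ 3 * p t $ 1)) (at t within {0..}) \<and>
     ((\<lambda>s. p s $ 3) has_real_derivative a\<^sup>2 * p t $ 1 * p t $ 2) (at t within {0..}) \<and>
     (p t $ 1)\<^sup>2 + (p t $ 2)\<^sup>2 = 1)"

text \<open>The component \<open>p\<^sub>3\<close> is not bounded a priori. But in the derivative of the squared distance its
contributions to the first two components cancel, so the distance grows at a bounded rate.\<close>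

lemma covector_flow_unique:
  assumes a: "0 < a" "a < 1" and p: "covector_flow a p" and q: "covector_flow a q"
    and eq: "p 0 = q 0" and t: "0 \<le> t"
  shows "p t = q t"
proof (cases "t = 0")
  case False
  with t have t: "0 < t" by simp
  define e where "e = (\<lambda>t. (p t$1 - q t$1)\<^sup>2 + (p t$2 - q t$2)\<^sup>2 + (p t$3 - q t$3)\<^sup>2)"
  define e' where "e' = (\<lambda>t. 2 * (p t$3 - q t$3) * ((p t$1 - q t$1) * q t$2 - (p t$2 - q t$2) * q t$1
      + a\<^sup>2 * (p t$1 * (p t$2 - q t$2) + (p t$1 - q t$1) * q t$2)))"
  have d: "(e has_real_derivative e' s) (at s within {0..})" if s: "0 \<le> s" for s
  proof -
    have P: "((\<lambda>s. p s $ 1) has_real_derivative p s $ 3 * p s $ 2) (at s within {0..})"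
      "((\<lambda>s. p s $ 2) has_real_derivative - (p s $ 3 * p s $ 1)) (at s within {0..})"
      "((\<lambda>s. p s $ 3) has_real_derivative a\<^sup>2 * p s $ 1 * p s $ 2) (at s within {0..})"
      and Q: "((\<lambda>s. q s $ 1) has_real_derivative q s $ 3 * q s $ 2) (at s within {0..})"
      "((\<lambda>s. q s $ 2) has_real_derivative - (q s $ 3 * q s $ 1)) (at s within {0..})"
      "((\<lambda>s. q s $ 3) has_real_derivative a\<^sup>2 * q s $ 1 * q s $ 2) (at s within {0..})"
      using p q s by (auto simp: covector_flow_def)
    have sq: "((\<lambda>s. (p s$i - q s$i)\<^sup>2) has_real_derivative 2 * ((p s$i - q s$i) * (x - y))) (at s within {0..})"
      if "((\<lambda>s. p s$i) has_real_derivative x) (at s within {0..})"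
        "((\<lambda>s. q s$i) has_real_derivative y) (at s within {0..})" for i x y
      using DERIV_power[OF DERIV_diff[OF that], of 2] by (simp only: mult.commute[of "x - y"]) simp
    show ?thesis unfolding e_def
      by (rule DERIV_cong[OF DERIV_add[OF DERIV_add[OF sq[OF P(1) Q(1)] sq[OF P(2) Q(2)]] sq[OF P(3) Q(3)]]])
        (unfold e'_def, algebra)
  qed
  \<comment> \<open>A crude constant: all that matters is that \<open>e\<close> cannot leave \<open>0\<close>.\<close>
  have bound: "e' s \<le> 8 * e s" if s: "0 \<le> s" for s
  proof -
    have "(p s$1)\<^sup>2 + (p s$2)\<^sup>2 = 1" "(q s$1)\<^sup>2 + (q s$2)\<^sup>2 = 1"
      using p q s by (auto simp: covector_flow_def)
    then have "(p s$1)\<^sup>2 \<le> 1" "(q s$1)\<^sup>2 \<le> 1" "(q s$2)\<^sup>2 \<le> 1"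
      using zero_le_power2[of "p s$2"] zero_le_power2[of "q s$1"] zero_le_power2[of "q s$2"] by linarith+
    then have u: "\<bar>p s$1\<bar> \<le> 1" "\<bar>q s$1\<bar> \<le> 1" "\<bar>q s$2\<bar> \<le> 1"
      by (simp_all add: abs_square_le_1)
    define x y z where "x = p s$1 - q s$1" and "y = p s$2 - q s$2" and "z = p s$3 - q s$3"
    have a2: "\<bar>a\<^sup>2\<bar> \<le> 1" using a by (simp add: power_le_one)
    have m: "\<bar>u * v\<bar> \<le> \<bar>u\<bar>" "\<bar>v * u\<bar> \<le> \<bar>u\<bar>" if "\<bar>v\<bar> \<le> 1" for u v :: real
      using that by (simp_all add: abs_mult mult_left_le mult_left_le_one_le)
    have tri: "\<bar>A - B + C\<bar> \<le> \<bar>A\<bar> + \<bar>B\<bar> + \<bar>C\<bar>" for A B C :: real by arith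
    have "\<bar>x * q s$2 - y * q s$1 + a\<^sup>2 * (p s$1 * y + x * q s$2)\<bar> \<le> 2 * \<bar>x\<bar> + 2 * \<bar>y\<bar>"
      using tri[of "x * q s$2" "y * q s$1" "a\<^sup>2 * (p s$1 * y + x * q s$2)"]
        m(1)[OF u(3), of x] m(1)[OF u(2), of y] m(2)[OF a2, of "p s$1 * y + x * q s$2"]
        abs_triangle_ineq[of "p s$1 * y" "x * q s$2"] m(2)[OF u(1), of y]
      by linarith
    then have "\<bar>2 * z\<bar> * \<bar>x * q s$2 - y * q s$1 + a\<^sup>2 * (p s$1 * y + x * q s$2)\<bar>
        \<le> \<bar>2 * z\<bar> * (2 * \<bar>x\<bar> + 2 * \<bar>y\<bar>)"
      by (intro mult_left_mono) auto
    moreover have "e' s \<le> \<bar>2 * z\<bar> * \<bar>x * q s$2 - y * q s$1 + a\<^sup>2 * (p s$1 * y + x * q s$2)\<bar>"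
      unfolding e'_def x_def y_def z_def abs_mult[symmetric] by (rule abs_ge_self)
    moreover have "\<bar>2 * z\<bar> * (2 * \<bar>x\<bar> + 2 * \<bar>y\<bar>) \<le> 8 * (x\<^sup>2 + y\<^sup>2 + z\<^sup>2)"
    proof -
      have "0 \<le> 2 * (\<bar>x\<bar> - \<bar>z\<bar>)\<^sup>2 + 2 * (\<bar>y\<bar> - \<bar>z\<bar>)\<^sup>2 + 6 * x\<^sup>2 + 6 * y\<^sup>2 + 4 * z\<^sup>2" by simp
      then show ?thesis by (simp add: power2_diff abs_mult algebra_simps)
    qed
    ultimately show ?thesis by (simp add: e_def x_def y_def z_def)
  qed
  define f where "f = (\<lambda>s. e s * exp (- (8 * s)))"
  have f': "(f has_real_derivative (e' s - 8 * e s) * exp (- (8 * s))) (at s within {0..})" if "0 \<le> s" for s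
    unfolding f_def using that by (auto intro!: derivative_eq_intros d simp: algebra_simps)
  have "f t \<le> f 0"
  proof (rule DERIV_nonpos_imp_decreasing_open[OF less_imp_le[OF t]])
    fix s assume s: "0 < s" "s < t"
    have "at s within {0..} = at s" by (rule at_within_interior) (use s in simp)
    then have "(f has_real_derivative (e' s - 8 * e s) * exp (- (8 * s))) (at s)" using f'[of s] s by simp
    moreover have "(e' s - 8 * e s) * exp (- (8 * s)) \<le> 0"
      using bound[of s] s by (intro mult_nonpos_nonneg) auto
    ultimately show "\<exists>y. (f has_real_derivative y) (at s) \<and> y \<le> 0" by blast
  next
    show "continuous_on {0..t} f"
      by (rule DERIV_continuous_on, rule DERIV_subset[OF f']) auto
  qed
  moreover have "f 0 = 0" by (simp add: f_def e_def eq)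
  ultimately have "e t \<le> 0" by (simp add: f_def mult_le_0_iff)
  then have "p t$1 = q t$1 \<and> p t$2 = q t$2 \<and> p t$3 = q t$3"
  proof -
    have "(p t$1 - q t$1)\<^sup>2 = 0" "(p t$2 - q t$2)\<^sup>2 = 0" "(p t$3 - q t$3)\<^sup>2 = 0"
      using \<open>e t \<le> 0\<close> zero_le_power2[of "p t$1 - q t$1"] zero_le_power2[of "p t$2 - q t$2"]
        zero_le_power2[of "p t$3 - q t$3"] unfolding e_def by linarith+
    then show ?thesis by simp
  qed
  then show ?thesis by (simp add: vec_eq_iff forall_3)
qed (use eq in simp)

text \<open>An arc symmetric about a given midpoint may start before time 0, so the covector and its precession
angle are taken on the whole line.\<close>

locale covector_line =
  fixes a M :: real and ph :: "real \<Rightarrow> real" and q :: "real \<Rightarrow> real^3"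
  assumes a: "0 < a" "a < 1"
    and unit: "\<And>t. (q t$1)\<^sup>2 + (q t$2)\<^sup>2 = 1"
    and M: "0 < M" "\<And>t. M\<^sup>2 = 1 - a\<^sup>2 * (q t$1)\<^sup>2 + (q t$3)\<^sup>2"
    and flow: "\<And>t. ((\<lambda>t. q t $ 1) has_real_derivative q t $ 3 * q t $ 2) (at t)"
      "\<And>t. ((\<lambda>t. q t $ 2) has_real_derivative - (q t $ 3 * q t $ 1)) (at t)"
      "\<And>t. ((\<lambda>t. q t $ 3) has_real_derivative a\<^sup>2 * q t $ 1 * q t $ 2) (at t)"
    and precession: "\<And>t. (ph has_real_derivative sqrt (1 - a\<^sup>2) * M / (1 - a\<^sup>2 * (q t$1)\<^sup>2)) (at t)"
begin

definition frame :: "real \<Rightarrow> real^3^3" where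
  "frame t = spatial_frame a M (ph t) (q t)"

lemma frame_SO3: "frame t \<in> SO3"
  unfolding frame_def by (rule spatial_frame_SO3[OF a unit M])

lemma frame_derivative: "(frame has_vector_derivative frame t ** ctrl a (q t $ 1) (q t $ 2)) (at t)"
  using spatial_frame_derivative[OF a unit M flow precession] by (simp add: frame_def[abs_def])

lemma geodesic_eq:
  assumes geo: "arclength_geodesic a R p" and eq: "p 0 = q 0" and t: "0 \<le> t"
  shows "p t = q t"
proof (rule covector_flow_unique[where a = a and p = p and q = q])
  show "covector_flow a p" using geo by (simp add: covector_flow_def arclength_geodesic_def)
  show "covector_flow a q"
    unfolding covector_flow_def using flow unit by (simp add: has_field_derivative_at_within)
qed (use a eq t in simp_all)

lemma geodesic_chord:
  assumes geo: "arclength_geodesic a R p" and eq: "p 0 = q 0" and st: "0 \<le> s" "0 \<le> t"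
  shows "transpose (R s) ** R t = transpose (frame s) ** frame t"
proof (rule equal_controls_constant[OF _ _ _ _ st])
  fix t :: real assume t: "0 \<le> t"
  show "(R has_vector_derivative R t ** ctrl a (q t $ 1) (q t $ 2)) (at t within {0..})" "R t \<in> SO3"
    using geo t by (auto simp: arclength_geodesic_def ctrl_def geodesic_eq[OF geo eq t, symmetric])
  show "(frame has_vector_derivative frame t ** ctrl a (q t $ 1) (q t $ 2)) (at t within {0..})"
    by (rule has_vector_derivative_at_within[OF frame_derivative])
qed (rule frame_SO3)

lemma chord_eq:
  "transpose (frame s) ** frame t
    = transpose (base_frame a M (q s)) ** Rz (ph t - ph s) ** base_frame a M (q t)"
  unfolding frame_def by (rule transpose_frame_mult)

lemma chord_trace_propagates:
  assumes D: "sign_matrix D" and st: "s \<in> {x..y}" "t \<in> {x..y}"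
    and s: "trace (D ** (transpose (frame s) ** frame (s + L))) = - 1"
    and ne: "(\<forall>t\<in>{x..y}. D$2$2 * q t$1 + q (t + L)$1 \<noteq> 0) \<or> (\<forall>t\<in>{x..y}. D$1$1 * q t$2 + q (t + L)$2 \<noteq> 0)"
  shows "trace (D ** (transpose (frame t) ** frame (t + L))) = - 1"
proof -
  let ?w = "\<lambda>t. ctrl a (q t $ 1) (q t $ 2)"
  let ?v = "\<lambda>t. ctrl a (reflect_covector D (q t) $ 1) (reflect_covector D (q t) $ 2)"
  define K where "K = (\<lambda>t. D ** (transpose (frame t) ** frame (t + L)))"
  have cont: "continuous_on UNIV (\<lambda>t. q t $ i)" for i
  proof -
    have "continuous_on UNIV (\<lambda>t. q t $ 1)" "continuous_on UNIV (\<lambda>t. q t $ 2)"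
      "continuous_on UNIV (\<lambda>t. q t $ 3)"
      by (rule DERIV_continuous_on, rule flow)+
    then show ?thesis using exhaust_3[of i] by auto
  qed
  have "trace (K t) = - 1"
  proof (rule half_turn_chord_propagates[OF a, where l = "\<lambda>t. reflect_covector D (q t)" and r = "\<lambda>t. q (t + L)"])
    fix t i
    show "K t \<in> SO3"
      unfolding K_def by (intro SO3_mult SO3_transpose frame_SO3 sign_matrix_SO3[OF D])
    show "K t *v momentum a (q (t + L)) = momentum a (reflect_covector D (q t))"
      unfolding K_def momentum_reflect[OF D] matrix_vector_mul_assoc[symmetric, of D]
      using spatial_frame_momentum[OF a unit unit M] M(2) by (simp add: frame_def)
    show "(reflect_covector D (q t) $ 1)\<^sup>2 + (reflect_covector D (q t) $ 2)\<^sup>2 = 1"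
      using unit reflect_covector_unit[OF D] by simp
    show "(q (t + L) $ 1)\<^sup>2 + (q (t + L) $ 2)\<^sup>2 = 1" by (rule unit)
    show "continuous_on UNIV (\<lambda>t. q (t + L) $ i)"
      using continuous_on_compose2[OF cont, of UNIV "\<lambda>t. t + L"] by (simp add: continuous_on_add)
    show "continuous_on UNIV (\<lambda>t. reflect_covector D (q t) $ i)"
      using exhaust_3[of i] by (auto intro!: continuous_on_mult_left cont)
    have "((\<lambda>t. frame (t + L)) has_vector_derivative
        frame (t + L) ** ?w (t + L)) (at t)"
    proof -
      have "((\<lambda>t. t + L) has_vector_derivative 1) (at t)" by (auto intro!: derivative_eq_intros)
      from vector_diff_chain_at[OF this frame_derivative] show ?thesis by (simp add: o_def)
    qed
    from matrix_mult_derivative[OF transpose_derivative[OF frame_derivative] this]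
    have "((\<lambda>t. transpose (frame t) ** frame (t + L)) has_vector_derivative
        transpose (frame t) ** (frame (t + L) ** ?w (t + L))
        + transpose (frame t ** ?w t) ** frame (t + L)) (at t)" .
    from bounded_linear.has_vector_derivative[OF bounded_linear_sandwich[of D "mat 1"] this]
    have 1: "(K has_vector_derivative
        D ** (transpose (frame t) ** (frame (t + L) ** ?w (t + L))
        + transpose (frame t ** ?w t) ** frame (t + L))) (at t)"
      by (simp add: K_def)
    have add: "D ** (X + Y) = D ** X + D ** Y" for X Y :: "real^3^3"
      by (rule matrix_add_ldistrib)
    have neg: "A ** (- X) ** B = - (A ** X ** B)" for A X B :: "real^3^3"
      by (rule linear_neg[OF bounded_linear.linear[OF bounded_linear_sandwich]])
    have "D ** (transpose (frame t ** ?w t) ** frame (t + L))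
        = D ** (- ?w t) ** (transpose (frame t) ** frame (t + L))"
      by (simp add: matrix_transpose_mul transpose_ctrl matrix_mul_assoc)
    also have "\<dots> = - (D ** ?w t ** D ** K t)"
      unfolding neg K_def by (simp add: sign_matrix_square(2)[OF D] flip: matrix_mul_assoc)
    also have "\<dots> = - (?v t ** K t)"
      by (simp add: sign_matrix_ctrl[OF D])
    finally have 2: "D ** (transpose (frame t ** ?w t) ** frame (t + L))
      = - (?v t ** K t)" .
    show "(K has_vector_derivative K t ** ?w (t + L)
        - ?v t ** K t) (at t)"
      using 1 unfolding add 2 by (simp add: K_def matrix_mul_assoc)
  qed (use st s ne in \<open>simp_all add: K_def\<close>)
  then show ?thesis by (simp add: K_def)
qed

end

section \<open>Mirrored chords of oscillating and rotating geodesics\<close>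

text \<open>The arc of precession \<open>pi\<close> centred at the turning point of amplitude \<open>pi / 2\<close> lasts at most half a
period. Since \<open>p\<^sub>1\<close> never vanishes, its half-turn chord propagates to the arc that starts at time 0.\<close>

lemma oscillating_chord:
  assumes a: "0 < a" "a < 1" and k: "0 < k" "k < 1" and geo: "arclength_geodesic a R p"
    and p0: "p 0 = vector [delta k x0, - k * sin x0, a * k * cos x0]"
  obtains L where "0 < L" "L \<le> 2 * elliptic_K (k\<^sup>2) / a" "trace (transpose (R 0) ** R L) = - 1"
    "0 < p 0 $ 1 * p L $ 1"
proof -
  define b where "b = sqrt (1 - a\<^sup>2)"
  note b = contraction_factor[OF a, folded b_def]
  define M where "M = sqrt (b\<^sup>2 + a\<^sup>2 * k\<^sup>2)"
  have M: "0 < M" "M\<^sup>2 = b\<^sup>2 + a\<^sup>2 * k\<^sup>2" using b(1) by (simp_all add: M_def add_pos_nonneg)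
  obtain G where G: "G 0 = 0" "\<And>x. (G has_real_derivative 1 / delta k x) (at x)"
    "G (pi/2) = elliptic_K (k\<^sup>2)" "\<And>x y. x < y \<Longrightarrow> G x < G y" "\<And>z. \<exists>x. G x = z"
    by (rule incomplete_integral[OF k]) blast
  have G_inj: "x = y" if "G x = G y" for x y
    using G(4)[of x y] G(4)[of y x] that by (cases x y rule: linorder_cases) auto
  have G_le: "G x \<le> G y" if "x \<le> y" for x y
    using G(4)[of x y] that by (cases "x = y") auto
  obtain x where x: "x 0 = x0" "\<And>t. G (x t) = G x0 + a * t"
    "\<And>t. (x has_real_derivative a * delta k (x t)) (at t)"
    by (rule amplitude_exists[OF k G(2,4,5), of x0 a], assumption, rule that)
  define rate where "rate = (\<lambda>s. M * b / (a * sqrt (1 - k\<^sup>2 * s) * (b\<^sup>2 + a\<^sup>2 * k\<^sup>2 * s)))"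
  have w: "0 < b\<^sup>2 + a\<^sup>2 * k\<^sup>2 * (sin x)\<^sup>2" for x using b(1) by (simp add: add_pos_nonneg)
  have "continuous_on UNIV (\<lambda>x. rate ((sin x)\<^sup>2))"
    unfolding rate_def using a(1) w delta_bounds(1)[OF k]
    by (intro continuous_intros) (auto simp: delta_def less_le)
  then obtain P where P: "P 0 = 0" "\<And>x. (P has_real_derivative rate ((sin x)\<^sup>2)) (at x)"
    by (rule antiderivative_exists) blast
  have Ph: "pi / 2 \<le> P (pi/2)"
    by (rule oscillating_precession_bound[OF a k, of P])
      (use P in \<open>simp_all add: rate_def delta_def b_def M_def\<close>)
  define q :: "real \<Rightarrow> real^3" where
    "q = (\<lambda>t. vector [delta k (x t), - k * sin (x t), a * k * cos (x t)])"
  have q: "q t $ 1 = delta k (x t)" "q t $ 2 = - k * sin (x t)" "q t $ 3 = a * k * cos (x t)" for t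
    by (simp_all add: q_def)
  note dk = delta_bounds[OF k]
  have hw: "1 - a\<^sup>2 * (q t $ 1)\<^sup>2 = b\<^sup>2 + a\<^sup>2 * k\<^sup>2 * (sin (x t))\<^sup>2" for t
    unfolding q dk(3) b(3) by (simp add: algebra_simps)
  interpret covector_line a M "\<lambda>t. P (x t)" q
  proof
    fix t
    have dne: "delta k (x t) \<noteq> 0" using dk(1)[of "x t"] by simp
    show "(q t $ 1)\<^sup>2 + (q t $ 2)\<^sup>2 = 1" unfolding q dk(3) by (simp add: power_mult_distrib)
    show "M\<^sup>2 = 1 - a\<^sup>2 * (q t $ 1)\<^sup>2 + (q t $ 3)\<^sup>2"
      unfolding M(2) hw by (simp add: q power_mult_distrib cos_squared_eq algebra_simps)
    have "((\<lambda>t. delta k (x t)) has_real_derivative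
        - (k\<^sup>2 * sin (x t) * cos (x t)) / delta k (x t) * (a * delta k (x t))) (at t)"
      by (rule DERIV_chain2[OF delta_derivative[OF k] x(3)])
    then show "((\<lambda>t. q t $ 1) has_real_derivative q t $ 3 * q t $ 2) (at t)"
      using dne by (simp add: q power2_eq_square mult_ac)
    show "((\<lambda>t. q t $ 2) has_real_derivative - (q t $ 3 * q t $ 1)) (at t)"
      unfolding q by (auto intro!: derivative_eq_intros x(3))
    show "((\<lambda>t. q t $ 3) has_real_derivative a\<^sup>2 * q t $ 1 * q t $ 2) (at t)"
      unfolding q by (auto intro!: derivative_eq_intros x(3) simp: power2_eq_square)
    have "((\<lambda>t. P (x t)) has_real_derivative rate ((sin (x t))\<^sup>2) * (a * delta k (x t))) (at t)"
      by (rule DERIV_chain2[OF P(2) x(3)])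
    moreover have "rate ((sin (x t))\<^sup>2) * (a * delta k (x t)) = b * M / (1 - a\<^sup>2 * (q t $ 1)\<^sup>2)"
      unfolding hw rate_def delta_def[symmetric] using dne a(1) by (simp add: mult_ac)
    ultimately show "((\<lambda>t. P (x t)) has_real_derivative
        sqrt (1 - a\<^sup>2) * M / (1 - a\<^sup>2 * (q t $ 1)\<^sup>2)) (at t)" by (simp add: b_def)
  qed (use a M in auto)
  have "\<exists>y\<ge>0. y \<le> pi/2 \<and> 2 * (P (pi/2) - P (pi/2 - y)) = pi"
    using Ph P(1) by (intro IVT) (auto intro!: continuous_intros DERIV_isCont[OF P(2)]
        isCont_o2[where g = P])
  then obtain y where y: "0 \<le> y" "y \<le> pi/2" "2 * (P (pi/2) - P (pi/2 - y)) = pi" by blast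
  have "y \<noteq> 0" using y(3) by auto
  then have y0: "0 < y" using y(1) by simp
  define c where "c = pi / 2"
  have c: "cos c = 0" by (simp add: c_def)
  note Gs = antiderivative_sin_squared[of G "\<lambda>s. 1 / sqrt (1 - k\<^sup>2 * s)", OF G(1) G(2)[unfolded delta_def]]
  note Ps = antiderivative_sin_squared[of P rate, OF P]
  define m where "m = (G c - G x0) / a"
  define L where "L = 2 * (G (pi/2) - G (pi/2 - y)) / a"
  have am: "a * (m + L / 2) = G c - G x0 + (G (pi/2) - G (pi/2 - y))"
    "a * (m - L / 2) = G c - G x0 - (G (pi/2) - G (pi/2 - y))"
    using a(1) by (simp_all add: m_def L_def field_simps)
  have xp: "x (m + L / 2) = c + y"
    by (rule G_inj) (use x(2)[of "m + L / 2"] am(1) Gs(1)[OF c, of y] in simp)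
  have xm: "x (m - L / 2) = c - y"
    by (rule G_inj) (use x(2)[of "m - L / 2"] am(2) Gs(2)[OF c, of y] in simp)
  have L0: "0 < L" using G(4)[of "pi/2 - y" "pi/2"] y0 a(1) by (simp add: L_def)
  have "0 \<le> G (pi/2 - y)"
    using G_le[of 0 "pi/2 - y"] G(1) y(2) by simp
  then have L1: "L \<le> 2 * elliptic_K (k\<^sup>2) / a"
    unfolding L_def G(3)[symmetric] using a(1) by (intro divide_right_mono) auto
  have half: "m - L / 2 + L = m + L / 2" by simp
  note sr = sin_squared_reflect[OF c, of y]
  have centre: "trace (diag3 1 1 1 ** (transpose (frame (m - L / 2)) ** frame (m - L / 2 + L))) = - 1"
  proof -
    have "P (x (m + L / 2)) - P (x (m - L / 2)) = pi"
      unfolding xp xm using Ps(1)[OF c, of y] Ps(2)[OF c, of y] y(3) by simp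
    moreover have "diag3 1 1 1 = mat 1" by (simp add: diag3_def mat3_simps)
    moreover have "q (m + L / 2) $ 1 = q (m - L / 2) $ 1" "q (m + L / 2) $ 2 = q (m - L / 2) $ 2"
      "q (m + L / 2) $ 3 = - q (m - L / 2) $ 3"
      unfolding q xp xm delta_def sr(3,4) by simp_all
    ultimately show ?thesis
      unfolding half chord_eq using trace_chord_p3_reversed[OF a unit M(1)] covector_line.M(2)[OF covector_line_axioms]
      by simp
  qed
  let ?J = "{min (m - L / 2) 0..max (m - L / 2) 0}"
  from centre have "trace (diag3 1 1 1 ** (transpose (frame 0) ** frame (0 + L))) = - 1"
  proof (rule chord_trace_propagates[rotated 3])
    \<comment> \<open>The symmetric arc may start before or after time \<open>0\<close>.\<close>
    show "m - L / 2 \<in> ?J" "0 \<in> ?J"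
      by auto
    have "0 < delta k (x t) + delta k (x (t + L))" for t using dk(1) by (simp add: add_pos_pos)
    then show "(\<forall>t\<in>?J. diag3 1 1 1 $ 2 $ 2 * q t $ 1 + q (t + L) $ 1 \<noteq> 0) \<or>
      (\<forall>t\<in>?J. diag3 1 1 1 $ 1 $ 1 * q t $ 2 + q (t + L) $ 2 \<noteq> 0)"
      by (metis (no_types, lifting) less_irrefl q(1) diag3_def vector_3 mult_1)
  qed (simp add: sign_matrix_def)
  moreover have "diag3 1 1 1 = mat 1" by (simp add: diag3_def mat3_simps)
  moreover have p0q: "p 0 = q 0" by (simp add: p0 q_def x(1))
  ultimately have "trace (transpose (R 0) ** R L) = - 1"
    using geodesic_chord[OF geo p0q, of 0 L] L0 by simp
  moreover have "0 < p 0 $ 1 * p L $ 1"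
    using geodesic_eq[OF geo p0q, of L] L0 dk(1) by (simp add: p0q q)
  ultimately show ?thesis using that L0 L1 by blast
qed

text \<open>This moves the starting time slightly away from the exceptional ones.\<close>

lemma strictly_increasing_sin_nonzero:
  fixes h :: "real \<Rightarrow> real"
  assumes "\<And>s t. s < t \<Longrightarrow> h s < h t" "isCont h 0" "0 < e"
  obtains s where "0 \<le> s" "s < e" "sin (h s) \<noteq> 0"
proof (cases "sin (h 0) = 0")
  case True
  have "eventually (\<lambda>s. h s < h 0 + pi) (at_right 0)"
    by (rule order_tendstoD(2)[of _ "h 0"])
      (use assms(2) in \<open>auto simp: isCont_def filterlim_at_split\<close>)
  moreover have "eventually (\<lambda>s. 0 < s \<and> s < e) (at_right 0)"
    using assms(3) by (intro eventually_conj eventually_at_right_less eventually_at_rightI[of 0 e]) auto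
  ultimately have "eventually (\<lambda>s. h s < h 0 + pi \<and> 0 < s \<and> s < e) (at_right 0)"
    by (rule eventually_conj)
  then obtain s where s: "h s < h 0 + pi" "0 < s" "s < e"
    using eventually_happens'[OF trivial_limit_at_right_real] by blast
  have "0 < sin (h s - h 0)" using s assms(1)[OF s(2)] by (intro sin_gt_zero) auto
  moreover have "cos (h 0) \<noteq> 0" using True sin_zero_abs_cos_one by fastforce
  moreover have "sin (h s) = sin (h s - h 0) * cos (h 0)"
    using sin_add[of "h s - h 0" "h 0"] True by simp
  ultimately show ?thesis using that[of s] s by simp
qed (use that[of 0] assms(3) in auto)

text \<open>Propagation stops where \<open>p\<^sub>2 (s) + p\<^sub>2 (s + L) = 0\<close>, and there the mirrored arc may also join without a
corner. Between two such times the mean amplitude of the two ends runs through an interval of length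
\<open>pi\<close>, whose centre belongs to an arc symmetric about a zero of \<open>p\<^sub>1\<close>. This reaches every
non-exceptional starting time, and arbitrarily small ones among them.\<close>

lemma rotating_chord:
  assumes a: "0 < a" "a < 1" and k: "0 < k" "k < 1" and geo: "arclength_geodesic a R p"
    and p0: "p 0 = vector [cos x0, - sin x0, a / k * delta k x0]"
  shows "\<exists>L. 0 < L \<and> L \<le> 2 * k * elliptic_K (k\<^sup>2) / a + pi \<and> (\<forall>e>0. \<exists>s. 0 \<le> s \<and> s < e \<and>
      trace (diag3 1 (-1) (-1) ** (transpose (R s) ** R (s + L))) = - 1 \<and>
      \<not> (p (s + L) $ 1 = p s $ 1 \<and> p (s + L) $ 2 = - p s $ 2))"
proof -
  let ?D = "diag3 1 (-1) (-1)"
  define b where "b = sqrt (1 - a\<^sup>2)"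
  note b = contraction_factor[OF a, folded b_def]
  define v where "v = a / k"
  have v: "0 < v" "v * k = a" using a k by (simp_all add: v_def)
  define M where "M = sqrt (b\<^sup>2 + v\<^sup>2)"
  have M: "0 < M" "M\<^sup>2 = b\<^sup>2 + v\<^sup>2" using b(1) by (simp_all add: M_def add_pos_nonneg)
  obtain G where G: "G 0 = 0" "\<And>x. (G has_real_derivative 1 / delta k x) (at x)"
    "G (pi/2) = elliptic_K (k\<^sup>2)" "\<And>x y. x < y \<Longrightarrow> G x < G y" "\<And>z. \<exists>x. G x = z"
    by (rule incomplete_integral[OF k]) blast
  have G_inj: "x = y" if "G x = G y" for x y
    using G(4)[of x y] G(4)[of y x] that by (cases x y rule: linorder_cases) auto
  have G_le: "G x \<le> G y" if "x \<le> y" for x y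
    using G(4)[of x y] that by (cases "x = y") auto
  have G_less: "x < y" if "G x < G y" for x y using G_le[of y x] that by (cases "x < y") auto
  obtain x where x: "x 0 = x0" "\<And>t. G (x t) = G x0 + v * t"
    "\<And>t. (x has_real_derivative v * delta k (x t)) (at t)"
    by (rule amplitude_exists[OF k G(2,4,5), of x0 v], assumption, rule that)
  have x_less: "x s < x t" if "s < t" for s t
    by (rule G_less) (use x(2)[of s] x(2)[of t] v(1) that in simp)
  define rate where "rate = (\<lambda>s. M * b / (v * sqrt (1 - k\<^sup>2 * s) * (b\<^sup>2 + a\<^sup>2 * s)))"
  have w: "0 < b\<^sup>2 + a\<^sup>2 * (sin x)\<^sup>2" for x using b(1) by (simp add: add_pos_nonneg)
  have "continuous_on UNIV (\<lambda>x. rate ((sin x)\<^sup>2))"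
    unfolding rate_def using v(1) w delta_bounds(1)[OF k]
    by (intro continuous_intros) (auto simp: delta_def less_le)
  then obtain P where P: "P 0 = 0" "\<And>x. (P has_real_derivative rate ((sin x)\<^sup>2)) (at x)"
    by (rule antiderivative_exists) blast
  obtain u where u: "0 < u" "u \<le> pi / 2" "pi \<le> P (pi/2) + P u" "2 / v * G u \<le> pi"
    by (rule rotating_precession_bound[OF a k, of G P])
      (use P G in \<open>simp_all add: rate_def delta_def b_def M_def v_def\<close>)
  define q :: "real \<Rightarrow> real^3" where
    "q = (\<lambda>t. vector [cos (x t), - sin (x t), v * delta k (x t)])"
  have q: "q t $ 1 = cos (x t)" "q t $ 2 = - sin (x t)" "q t $ 3 = v * delta k (x t)" for t
    by (simp_all add: q_def)
  note dk = delta_bounds[OF k]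
  have hw: "1 - a\<^sup>2 * (q t $ 1)\<^sup>2 = b\<^sup>2 + a\<^sup>2 * (sin (x t))\<^sup>2" for t
    unfolding q cos_squared_eq b(3) by (simp add: algebra_simps)
  interpret covector_line a M "\<lambda>t. P (x t)" q
  proof
    fix t
    have dne: "delta k (x t) \<noteq> 0" using dk(1)[of "x t"] by simp
    show "(q t $ 1)\<^sup>2 + (q t $ 2)\<^sup>2 = 1" unfolding q by simp
    have "(q t $ 3)\<^sup>2 = v\<^sup>2 - a\<^sup>2 * (sin (x t))\<^sup>2"
      unfolding q power_mult_distrib dk(3) by (simp add: v(2)[symmetric] power_mult_distrib algebra_simps)
    then show "M\<^sup>2 = 1 - a\<^sup>2 * (q t $ 1)\<^sup>2 + (q t $ 3)\<^sup>2"
      unfolding M(2) hw by simp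
    show "((\<lambda>t. q t $ 1) has_real_derivative q t $ 3 * q t $ 2) (at t)"
      unfolding q by (auto intro!: derivative_eq_intros x(3))
    show "((\<lambda>t. q t $ 2) has_real_derivative - (q t $ 3 * q t $ 1)) (at t)"
      unfolding q by (auto intro!: derivative_eq_intros x(3))
    have "((\<lambda>t. delta k (x t)) has_real_derivative
        - (k\<^sup>2 * sin (x t) * cos (x t)) / delta k (x t) * (v * delta k (x t))) (at t)"
      by (rule DERIV_chain2[OF delta_derivative[OF k] x(3)])
    from DERIV_cmult[OF this, of v]
    have "((\<lambda>t. q t $ 3) has_real_derivative - ((v * k)\<^sup>2 * sin (x t) * cos (x t))) (at t)"
      using dne by (simp add: q power2_eq_square mult_ac)
    then show "((\<lambda>t. q t $ 3) has_real_derivative a\<^sup>2 * q t $ 1 * q t $ 2) (at t)"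
      unfolding v(2) by (simp add: q mult_ac)
    have "((\<lambda>t. P (x t)) has_real_derivative rate ((sin (x t))\<^sup>2) * (v * delta k (x t))) (at t)"
      by (rule DERIV_chain2[OF P(2) x(3)])
    moreover have "rate ((sin (x t))\<^sup>2) * (v * delta k (x t)) = b * M / (1 - a\<^sup>2 * (q t $ 1)\<^sup>2)"
      unfolding hw rate_def delta_def[symmetric] using dne v(1) by (simp add: mult_ac)
    ultimately show "((\<lambda>t. P (x t)) has_real_derivative
        sqrt (1 - a\<^sup>2) * M / (1 - a\<^sup>2 * (q t $ 1)\<^sup>2)) (at t)" by (simp add: b_def)
  qed (use a M in auto)
  note Gs = antiderivative_sin_squared[of G "\<lambda>s. 1 / sqrt (1 - k\<^sup>2 * s)", OF G(1) G(2)[unfolded delta_def]]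
  note Ps = antiderivative_sin_squared[of P rate, OF P]
  have "P (pi/2 - (pi/2 + u)) = - P u" using Ps(3)[of u] by simp
  then have "\<exists>y\<ge>0. y \<le> pi/2 + u \<and> P (pi/2) - P (pi/2 - y) = pi"
    using u P(1) by (intro IVT) (auto intro!: continuous_intros DERIV_isCont[OF P(2)]
        isCont_o2[where g = P])
  then obtain y where y: "0 \<le> y" "y \<le> pi/2 + u" "P (pi/2) - P (pi/2 - y) = pi" by blast
  have "y \<noteq> 0" using y(3) by auto
  then have y0: "0 < y" using y(1) by simp
  define L where "L = 2 * (G (pi/2) - G (pi/2 - y)) / v"
  have vL: "v * L = 2 * (G (pi/2) - G (pi/2 - y))" using v(1) by (simp add: L_def)
  have L0: "0 < L" using G(4)[of "pi/2 - y" "pi/2"] y0 v(1) by (simp add: L_def)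
  have L1: "L \<le> 2 * k * elliptic_K (k\<^sup>2) / a + pi"
  proof -
    \<comment> \<open>The arc of amplitude \<open>2 (pi / 2 + u)\<close> lasts half a period plus at most \<open>pi\<close>.\<close>
    have "- G u \<le> G (pi/2 - y)" using G_le[of "- u" "pi/2 - y"] y(2) Gs(3)[of u] by simp
    then have "L \<le> 2 * (G (pi/2) + G u) / v"
      unfolding L_def using v(1) by (intro divide_right_mono) auto
    also have "\<dots> = 2 * G (pi/2) / v + 2 / v * G u"
      by (simp add: add_divide_distrib distrib_left)
    also have "2 * G (pi/2) / v = 2 * k * elliptic_K (k\<^sup>2) / a" by (simp add: G(3) v_def mult_ac)
    finally show ?thesis using u(4) by simp
  qed
  have p0q: "p 0 = q 0" by (simp add: p0 q_def x(1) v_def)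
  have pq: "p t = q t" if "0 \<le> t" for t by (rule geodesic_eq[OF geo p0q that])
  have chord: "transpose (R s) ** R (s + L) = transpose (frame s) ** frame (s + L)" if "0 \<le> s" for s
    by (rule geodesic_chord[OF geo p0q]) (use that L0 in auto)
  have x_cont: "isCont x t" for t by (rule DERIV_isCont[OF x(3)])
  have "\<exists>s. 0 \<le> s \<and> s < e \<and>
      trace (?D ** (transpose (R s) ** R (s + L))) = - 1 \<and>
      \<not> (p (s + L) $ 1 = p s $ 1 \<and> p (s + L) $ 2 = - p s $ 2)" if e: "0 < e" for e
  proof (cases "y = pi / 2")
    case True
    \<comment> \<open>Here \<open>L\<close> is exactly half a period, every chord is a half turn after mirroring, and the corner is missing only where \<open>p\<^sub>1 = 0\<close>.\<close>
    have shift: "x (s + L) = x s + pi" for s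
      by (rule G_inj) (use x(2)[of "s + L"] x(2)[of s] vL Gs(4)[of "x s"] True G(1) in \<open>simp add: algebra_simps\<close>)
    obtain s where s: "0 \<le> s" "s < e" "sin (x s + pi / 2) \<noteq> 0"
      by (rule strictly_increasing_sin_nonzero[of "\<lambda>s. x s + pi / 2", OF _ _ e])
        (use x_less x_cont in \<open>auto intro!: continuous_intros\<close>)
    have "P (x (s + L)) - P (x s) = 2 * pi"
      unfolding shift using Ps(4)[of "x s"] y(3) True P(1) by simp
    moreover have "q (s + L) $ 1 = - q s $ 1" "q (s + L) $ 2 = - q s $ 2" "q (s + L) $ 3 = q s $ 3"
      unfolding q shift delta_def by simp_all
    ultimately have "trace (?D ** (transpose (frame s) ** frame (s + L))) = - 1"
      unfolding chord_eq
      using trace_chord_p1_reversed[OF a unit M(1) covector_line.M(2)[OF covector_line_axioms], of "q (s + L)" s]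
      by simp
    moreover have "\<not> (p (s + L) $ 1 = p s $ 1)"
      using s L0 by (simp add: pq q shift sin_add)
    ultimately show ?thesis using s chord[OF s(1)] by auto
  next
    case False
    define h where "h = (\<lambda>s. (x s + x (s + L)) / 2)"
    have h_less: "h s < h t" if "s < t" for s t
      using x_less[OF that] x_less[of "s + L" "t + L"] that by (simp add: h_def)
    have h_cont: "isCont h t" for t
      unfolding h_def by (intro continuous_intros x_cont isCont_o2[where g = x]) auto
    have gap: "0 < x (s + L) - x s" "x (s + L) - x s < 3 * pi" "x (s + L) - x s \<noteq> pi" for s
    proof -
      show "0 < x (s + L) - x s" using x_less[of s "s + L"] L0 by simp
      have d: "G (x (s + L)) - G (x s) = 2 * (G (pi/2) - G (pi/2 - y))"
        using x(2)[of "s + L"] x(2)[of s] vL by (simp add: algebra_simps)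
      have "x s + pi + pi + pi = x s + 3 * pi" by simp
      then have 3: "G (x s + 3 * pi) = G (x s) + 6 * G (pi/2)"
        using Gs(4)[of "x s"] Gs(4)[of "x s + pi"] Gs(4)[of "x s + pi + pi"]
        by (simp add: add.commute)
      have "G (- (pi/2)) \<le> G (pi/2 - y)" using y(2) u(2) by (intro G_le) simp
      then have "- G (pi/2) \<le> G (pi/2 - y)" using Gs(3)[of "pi/2"] by simp
      moreover have "0 < G (pi/2)" using G(4)[of 0 "pi/2"] G(1) by simp
      ultimately have "G (x (s + L)) < G (x s + 3 * pi)" using d 3 by simp
      from G_less[OF this] show "x (s + L) - x s < 3 * pi" by simp
      show "x (s + L) - x s \<noteq> pi"
      proof
        assume "x (s + L) - x s = pi"
        then have "x (s + L) = x s + pi" by simp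
        then have "G (pi/2 - y) = G 0" using d Gs(4)[of "x s"] G(1) by simp
        from G_inj[OF this] False show False by simp
      qed
    qed
    have sum_sin: "q s $ 2 + q (s + L) $ 2 = 0 \<longleftrightarrow> sin (h s) = 0" for s
    proof -
      define d where "d = (x (s + L) - x s) / 2"
      have d: "0 < d" "d < 3 * pi / 2" "d \<noteq> pi / 2" using gap[of s] by (simp_all add: d_def)
      have "cos d \<noteq> 0"
      proof (cases "d < pi / 2")
        case True
        then have "0 < cos d" using d(1) by (intro cos_gt_zero_pi) auto
        then show ?thesis by simp
      next
        case False
        then have "0 < cos (pi - d)" using d(2,3) by (intro cos_gt_zero_pi) auto
        then show ?thesis by (simp add: cos_diff)
      qed
      then have "cos ((x (s + L) - x s) / 2) \<noteq> 0" by (simp add: d_def)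
      moreover have "q s $ 2 + q (s + L) $ 2 = - (2 * sin (h s) * cos ((x (s + L) - x s) / 2))"
        using sin_plus_sin[of "x (s + L)" "x s"] by (simp add: q h_def add.commute)
      ultimately show ?thesis by simp
    qed
    obtain s where s: "0 \<le> s" "s < e" "sin (h s) \<noteq> 0"
      by (rule strictly_increasing_sin_nonzero[of h, OF _ h_cont e]) (use h_less in auto)
    define j where "j = \<lfloor>h s / pi\<rfloor>"
    define c where "c = of_int j * pi + pi / 2"
    have c: "cos c = 0" using sin_npi_int[of j] by (simp add: c_def cos_add mult.commute)
    have j0: "of_int j * pi \<le> h s" "h s < (of_int j + 1) * pi"
      unfolding j_def using floor_correct[of "h s / pi"]
      by (simp_all only: pos_le_divide_eq[OF pi_gt_zero] pos_divide_less_eq[OF pi_gt_zero]) simp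
    have "of_int j * pi \<noteq> h s" using s(3) by (metis mult.commute sin_npi_int)
    with j0 have j: "of_int j * pi < h s" "h s < of_int j * pi + pi" by (simp_all add: algebra_simps)
    define m where "m = (G c - G x0) / v"
    have vm: "v * (m + L / 2) = G c - G x0 + (G (pi/2) - G (pi/2 - y))"
      "v * (m - L / 2) = G c - G x0 - (G (pi/2) - G (pi/2 - y))"
      using v(1) by (simp_all add: m_def L_def field_simps)
    have xp: "x (m + L / 2) = c + y"
      by (rule G_inj) (use x(2)[of "m + L / 2"] vm(1) Gs(1)[OF c, of y] in simp)
    have xm: "x (m - L / 2) = c - y"
      by (rule G_inj) (use x(2)[of "m - L / 2"] vm(2) Gs(2)[OF c, of y] in simp)
    have half: "m - L / 2 + L = m + L / 2" by simp
    note sr = sin_squared_reflect[OF c, of y]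
    have hm: "h (m - L / 2) = c" by (simp add: h_def half xp xm)
    have centre: "trace (?D ** (transpose (frame (m - L / 2)) ** frame (m - L / 2 + L))) = - 1"
    proof -
      have "P (x (m + L / 2)) - P (x (m - L / 2)) = 2 * pi"
        unfolding xp xm using Ps(1)[OF c, of y] Ps(2)[OF c, of y] y(3) by simp
      moreover have "q (m + L / 2) $ 1 = - q (m - L / 2) $ 1" "q (m + L / 2) $ 2 = q (m - L / 2) $ 2"
        "q (m + L / 2) $ 3 = q (m - L / 2) $ 3"
        unfolding q xp xm delta_def sr(3,4) by simp_all
      ultimately show ?thesis
        unfolding half chord_eq
        using trace_chord_p1_reversed[OF a unit M(1) covector_line.M(2)[OF covector_line_axioms], of "q (m + L / 2)" "m - L / 2"]
        by simp
    qed
    let ?J = "{min (m - L / 2) s..max (m - L / 2) s}"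
    have "trace (?D ** (transpose (frame s) ** frame (s + L))) = - 1"
    proof (rule chord_trace_propagates[rotated 3])
      show "m - L / 2 \<in> ?J" "s \<in> ?J"
        by auto
      have "q t $ 2 + q (t + L) $ 2 \<noteq> 0" if t: "t \<in> ?J" for t
      proof -
        have h_le: "h t \<le> h t'" if "t \<le> t'" for t t' using h_less[of t t'] that by (cases "t = t'") auto
        have "min (h (m - L / 2)) (h s) \<le> h t" "h t \<le> max (h (m - L / 2)) (h s)"
          using t h_le[of "m - L / 2" t] h_le[of s t] h_le[of t "m - L / 2"] h_le[of t s]
          by (auto simp: min_le_iff_disj le_max_iff_disj min_def max_def split: if_splits)
        moreover have "of_int j * pi < c" "c < of_int j * pi + pi" by (simp_all add: c_def)
        ultimately have "of_int j * pi < h t" "h t < of_int j * pi + pi"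
          using j hm by (auto simp: min_def max_def split: if_splits)
        then have "0 < sin (h t - of_int j * pi)" by (intro sin_gt_zero) auto
        then have "sin (h t) \<noteq> 0"
          using sin_npi_int[of j] by (auto simp: sin_diff mult.commute)
        then show ?thesis using sum_sin by simp
      qed
      then show "(\<forall>t\<in>?J. ?D $ 2 $ 2 * q t $ 1 + q (t + L) $ 1 \<noteq> 0) \<or>
        (\<forall>t\<in>?J. ?D $ 1 $ 1 * q t $ 2 + q (t + L) $ 2 \<noteq> 0)"
        by (simp add: diag3_def)
    qed (use centre in \<open>simp_all add: sign_matrix_def\<close>)
    moreover have "p (s + L) $ 2 \<noteq> - p s $ 2"
      using sum_sin[of s] s L0 by (simp add: pq eq_neg_iff_add_eq_0 add.commute)
    ultimately show ?thesis using s chord[OF s(1)] by auto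
  qed
  with L0 L1 show ?thesis by blast
qed

lemma cut_time_le:
  assumes "\<And>t. l < t \<Longrightarrow> \<not> length_minimizing a t R"
  shows "cut_time a R \<le> ereal l"
  unfolding cut_time_def by (rule Sup_least) (use assms in \<open>auto simp: not_less[symmetric]\<close>)

lemma cut_time_le_diameter:
  assumes a: "0 < a" "a < 1" and geo: "arclength_geodesic a R p"
    and l: "\<And>t. 0 \<le> t \<Longrightarrow> pi + arccos (R t $ 2 $ 2) / sqrt (1 - a\<^sup>2) \<le> l" "0 \<le> l"
  shows "cut_time a R \<le> ereal l"
proof (rule cut_time_le, rule notI)
  fix t assume t: "l < t" "length_minimizing a t R"
  have "R t \<in> SO3" using geo t l(2) by (simp add: arclength_geodesic_def)
  then obtain d where d: "d \<le> pi + arccos (R t $ 2 $ 2) / sqrt (1 - a\<^sup>2)" "joined a (mat 1) (R t) d"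
    using joined_bound[OF a] by blast
  have "t \<le> d" by (rule length_minimizing_le_joined[OF a geo t(2) d(2)])
  then show False using l(1)[of t] l(2) t(1) d(1) by linarith
qed

text \<open>With \<open>k = modulus a p\<close>, the energy equation reads \<open>p\<^sub>3\<^sup>2 + a\<^sup>2 p\<^sub>2\<^sup>2 = a\<^sup>2 k\<^sup>2\<close>, which is an ellipse.\<close>

lemma covector_C1:
  assumes a: "0 < a" "a < 1" and p: "p \<in> C1 a"
  obtains x where "p$2 = - modulus a p * sin x" "p$3 = a * modulus a p * cos x"
    "\<bar>p$1\<bar> = delta (modulus a p) x" "p$1 \<noteq> 0"
proof -
  define k where "k = modulus a p"
  have k: "0 < k" "k < 1" "k\<^sup>2 = (energy a p + a\<^sup>2) / (2 * a\<^sup>2)"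
    using modulus_C1[OF a(1) p] by (simp_all add: k_def)
  have cyl: "p \<in> cylinder" using p by (simp add: C1_def)
  note ps = psi_cylinder[OF cyl]
  have "energy a p + a\<^sup>2 = 2 * ((p$3)\<^sup>2 + a\<^sup>2 * (p$2)\<^sup>2)"
    unfolding energy_def cos_double_sin ps(2) by (simp add: algebra_simps)
  then have e: "a\<^sup>2 * k\<^sup>2 = (p$3)\<^sup>2 + a\<^sup>2 * (p$2)\<^sup>2" using a(1) by (simp add: k(3))
  have "(p$3 / (a * k))\<^sup>2 + (- p$2 / k)\<^sup>2 = ((p$3)\<^sup>2 + a\<^sup>2 * (p$2)\<^sup>2) / (a\<^sup>2 * k\<^sup>2)"
    using a(1) k(1) by (simp add: power_divide add_divide_distrib power_mult_distrib)
  also have "\<dots> = 1" unfolding e[symmetric] using a(1) k(1) by simp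
  finally have "(p$3 / (a * k))\<^sup>2 + (- p$2 / k)\<^sup>2 = 1" .
  then have "(p$3 / (a * k)) * (p$3 / (a * k)) + (- p$2 / k) * (- p$2 / k) = 1"
    using a(1) k(1) by (simp add: power2_eq_square)
  then obtain x where x: "p$3 / (a * k) = cos x" "- p$2 / k = sin x" by (rule unit_vector_angle) blast
  then have x': "p$3 = a * k * cos x" "p$2 = - k * sin x" using a(1) k(1) by (simp_all add: field_simps)
  have "(p$1)\<^sup>2 = 1 - k\<^sup>2 * (sin x)\<^sup>2" using cyl x'(2) by (simp add: cylinder_def power_mult_distrib)
  then have "sqrt ((p$1)\<^sup>2) = delta k x" by (simp add: delta_def)
  then have d: "\<bar>p$1\<bar> = delta k x" by simp
  then have "p$1 \<noteq> 0" using delta_bounds(1)[OF k(1,2), of x] by auto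
  with x' d show ?thesis by (intro that[of x]) (simp_all add: k_def)
qed

text \<open>With \<open>k = modulus a p\<close>, the energy equation reads \<open>p\<^sub>3\<^sup>2 + a\<^sup>2 p\<^sub>2\<^sup>2 = (a / k)\<^sup>2\<close>.\<close>

lemma covector_C2:
  assumes a: "0 < a" "a < 1" and p: "p \<in> C2 a"
  obtains x where "p$1 = cos x" "p$2 = - sin x" "\<bar>p$3\<bar> = a / modulus a p * delta (modulus a p) x" "p$3 \<noteq> 0"
proof -
  define k where "k = modulus a p"
  have k: "0 < k" "k < 1" "k\<^sup>2 = 2 * a\<^sup>2 / (energy a p + a\<^sup>2)"
    using modulus_C2[OF a(1) p] by (simp_all add: k_def)
  have cyl: "p \<in> cylinder" and E: "a\<^sup>2 < energy a p" using p by (simp_all add: C2_def)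
  note ps = psi_cylinder[OF cyl]
  have e: "energy a p + a\<^sup>2 = 2 * ((p$3)\<^sup>2 + a\<^sup>2 * (sin (psi p))\<^sup>2)"
    unfolding energy_def cos_double_sin by (simp add: algebra_simps)
  have "0 < energy a p + a\<^sup>2" using E zero_le_power2[of a] by linarith
  then have "(a / k)\<^sup>2 = (p$3)\<^sup>2 + a\<^sup>2 * (sin (psi p))\<^sup>2"
    unfolding power_divide k(3) using a(1) e by simp
  then have "(p$3)\<^sup>2 = (a / k)\<^sup>2 * (delta k (psi p))\<^sup>2"
    unfolding delta_bounds(3)[OF k(1,2)] using k(1) by (simp add: power_divide field_simps)
  then have "sqrt ((p$3)\<^sup>2) = sqrt ((a / k * delta k (psi p))\<^sup>2)" by (simp only: power_mult_distrib)
  then have d: "\<bar>p$3\<bar> = a / k * delta k (psi p)"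
    using a(1) k(1) delta_bounds(1)[OF k(1,2), of "psi p"] by (simp add: abs_mult)
  then have "p$3 \<noteq> 0" using a(1) k(1) delta_bounds(1)[OF k(1,2), of "psi p"] by auto
  with ps d show ?thesis by (intro that[of "psi p"]) (simp_all add: k_def)
qed

lemma trace_conjugate:
  assumes "sign_matrix D"
  shows "trace (D ** A ** D) = trace A"
  using trace_mul_sym[of "D ** A" D] by (simp add: sign_matrix_square(2)[OF assms])

lemma cut_time_C1:
  assumes a: "0 < a" "a < 1" and geo: "arclength_geodesic a R p" and p: "p 0 \<in> C1 a"
  shows "cut_time a R \<le> ereal (2 * elliptic_K ((modulus a (p 0))\<^sup>2) / a + pi)"
proof -
  define k where "k = modulus a (p 0)"
  have k: "0 < k" "k < 1" using modulus_C1(1)[OF a(1) p] by (simp_all add: k_def)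
  obtain x where x: "p 0 $ 2 = - k * sin x" "p 0 $ 3 = a * k * cos x" "\<bar>p 0 $ 1\<bar> = delta k x" "p 0 $ 1 \<noteq> 0"
    by (rule covector_C1[OF a p, folded k_def])
  have R: "R t \<in> SO3" if "0 \<le> t" for t using geo that by (simp add: arclength_geodesic_def)
  have "\<exists>L. 0 < L \<and> L \<le> 2 * elliptic_K (k\<^sup>2) / a \<and> trace (transpose (R 0) ** R L) = - 1 \<and> 0 < p 0 $ 1 * p L $ 1"
  proof (cases "0 < p 0 $ 1")
    case True
    then have "p 0 = vector [delta k x, - k * sin x, a * k * cos x]"
      using x by (simp add: vec_eq_iff forall_3)
    from oscillating_chord[OF a k geo this] show ?thesis by blast
  next
    case False
    define D where "D = diag3 (-1) (-1) 1"
    have D: "sign_matrix D" by (simp add: D_def sign_matrix_def)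
    have "reflect_covector D (p 0) = vector [delta k (- x), - k * sin (- x), a * k * cos (- x)]"
      using x False by (simp add: vec_eq_iff forall_3 D_def diag3_def delta_def)
    from oscillating_chord[OF a k geodesic_reflect[OF D geo] this]
    obtain L where L: "0 < L" "L \<le> 2 * elliptic_K (k\<^sup>2) / a"
      "trace (transpose (D ** R 0 ** D) ** (D ** R L ** D)) = - 1"
      "0 < reflect_covector D (p 0) $ 1 * reflect_covector D (p L) $ 1" by blast
    have "transpose (D ** R 0 ** D) ** (D ** R L ** D) = D ** (transpose (R 0) ** R L) ** D"
      by (simp add: matrix_transpose_mul sign_matrix_transpose[OF D] sign_matrix_square(2)[OF D]
          flip: matrix_mul_assoc)
    then have "trace (transpose (R 0) ** R L) = - 1" using L(3) by (simp add: trace_conjugate[OF D])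
    moreover have "0 < p 0 $ 1 * p L $ 1" using L(4) by (simp add: D_def diag3_def)
    ultimately show ?thesis using L by blast
  qed
  then obtain L where L: "0 < L" "L \<le> 2 * elliptic_K (k\<^sup>2) / a" "trace (transpose (R 0) ** R L) = - 1"
    "0 < p 0 $ 1 * p L $ 1" by blast
  define D where "D = diag3 1 1 1"
  have D: "sign_matrix D" "D = mat 1" by (simp_all add: D_def sign_matrix_def) (simp add: diag3_def mat3_simps)
  have "transpose (transpose (R 0) ** R L) = transpose (R 0) ** R L"
    by (rule symmetric_if_half_turn[OF _ L(3)]) (use L(1) in \<open>simp add: SO3_mult SO3_transpose R\<close>)
  then have ch: "D ** (transpose (R L) ** R 0) ** D = transpose (R 0) ** R L"
    by (simp add: D(2) matrix_transpose_mul)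
  have ne: "(- (D$2$2 * p 0 $ 1), - (D$1$1 * p 0 $ 2)) \<noteq> (p L $ 1, p L $ 2)"
  proof
    assume "(- (D$2$2 * p 0 $ 1), - (D$1$1 * p 0 $ 2)) = (p L $ 1, p L $ 2)"
    then have "p L $ 1 = - p 0 $ 1" by (simp add: D(2) mat_def)
    then show False using L(4) zero_le_square[of "p 0 $ 1"] by simp
  qed
  have "cut_time a R \<le> ereal L"
    by (rule cut_time_le) (rule not_minimizing_past_mirrored_chord[OF a geo order.refl L(1) _ D(1) ch ne])
  also have "\<dots> \<le> ereal (2 * elliptic_K (k\<^sup>2) / a + pi)" using L(2) pi_ge_zero by (simp only: ereal_less_eq(3))
  finally show ?thesis by (simp add: k_def)
qed

lemma cut_time_C2:
  assumes a: "0 < a" "a < 1" and geo: "arclength_geodesic a R p" and p: "p 0 \<in> C2 a"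
  shows "cut_time a R \<le> ereal (2 * modulus a (p 0) * elliptic_K ((modulus a (p 0))\<^sup>2) / a + pi)"
proof -
  define k where "k = modulus a (p 0)"
  have k: "0 < k" "k < 1" using modulus_C2(1)[OF a(1) p] by (simp_all add: k_def)
  obtain x where x: "p 0 $ 1 = cos x" "p 0 $ 2 = - sin x" "\<bar>p 0 $ 3\<bar> = a / k * delta k x" "p 0 $ 3 \<noteq> 0"
    by (rule covector_C2[OF a p, folded k_def])
  have R: "R t \<in> SO3" if "0 \<le> t" for t using geo that by (simp add: arclength_geodesic_def)
  define D where "D = diag3 1 (-1) (-1)"
  have D: "sign_matrix D" by (simp add: D_def sign_matrix_def)
  have "\<exists>L. 0 < L \<and> L \<le> 2 * k * elliptic_K (k\<^sup>2) / a + pi \<and> (\<forall>e>0. \<exists>s. 0 \<le> s \<and> s < e \<and>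
      trace (D ** (transpose (R s) ** R (s + L))) = - 1 \<and>
      \<not> (p (s + L) $ 1 = p s $ 1 \<and> p (s + L) $ 2 = - p s $ 2))"
  proof (cases "0 < p 0 $ 3")
    case True
    then have "p 0 = vector [cos x, - sin x, a / k * delta k x]"
      using x by (simp add: vec_eq_iff forall_3)
    from rotating_chord[OF a k geo this] show ?thesis by (simp only: D_def)
  next
    case False
    have "reflect_covector D (p 0) = vector [cos (pi - x), - sin (pi - x), a / k * delta k (pi - x)]"
      using x False by (simp add: vec_eq_iff forall_3 D_def diag3_def delta_def)
    from rotating_chord[OF a k geodesic_reflect[OF D geo] this]
    have reflected: "\<exists>L. 0 < L \<and> L \<le> 2 * k * elliptic_K (k\<^sup>2) / a + pi \<and> (\<forall>e>0. \<exists>s. 0 \<le> s \<and> s < e \<and>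
      trace (D ** (transpose (D ** R s ** D) ** (D ** R (s + L) ** D))) = - 1 \<and>
      \<not> (reflect_covector D (p (s + L)) $ 1 = reflect_covector D (p s) $ 1 \<and>
         reflect_covector D (p (s + L)) $ 2 = - reflect_covector D (p s) $ 2))"
      by (simp only: D_def)
    have c: "D ** (transpose (D ** R s ** D) ** (D ** R t ** D)) = D ** (D ** (transpose (R s) ** R t)) ** D" for s t
      by (simp add: matrix_transpose_mul sign_matrix_transpose[OF D] sign_matrix_square(2)[OF D]
          flip: matrix_mul_assoc)
    have D12: "D $ 1 $ 1 = 1" "D $ 2 $ 2 = - 1" by (simp_all add: D_def diag3_def)
    show ?thesis
      using reflected unfolding c trace_conjugate[OF D] reflect_covector_nth D12 by simp
  qed
  then obtain L where L: "0 < L" "L \<le> 2 * k * elliptic_K (k\<^sup>2) / a + pi" and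
    ex: "\<forall>e>0. \<exists>s. 0 \<le> s \<and> s < e \<and>
      trace (D ** (transpose (R s) ** R (s + L))) = - 1 \<and>
      \<not> (p (s + L) $ 1 = p s $ 1 \<and> p (s + L) $ 2 = - p s $ 2)" by (elim exE conjE)
  have "cut_time a R \<le> ereal L"
  proof (rule cut_time_le)
    fix t assume t: "L < t"
    obtain s where s: "0 \<le> s" "s < t - L" and tr: "trace (D ** (transpose (R s) ** R (s + L))) = - 1"
      and ne: "\<not> (p (s + L) $ 1 = p s $ 1 \<and> p (s + L) $ 2 = - p s $ 2)"
      using ex[rule_format, of "t - L"] t by auto
    have S: "D ** (transpose (R s) ** R (s + L)) \<in> SO3"
      using s L(1) by (simp add: SO3_mult SO3_transpose R sign_matrix_SO3[OF D])
    have "transpose (R (s + L)) ** R s ** D = D ** (transpose (R s) ** R (s + L))"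
      using symmetric_if_half_turn[OF S tr] by (simp add: matrix_transpose_mul sign_matrix_transpose[OF D])
    then have ch: "D ** (transpose (R (s + L)) ** R s) ** D = transpose (R s) ** R (s + L)"
      by (metis matrix_mul_assoc sign_matrix_square(2)[OF D])
    show "\<not> length_minimizing a t R"
      by (rule not_minimizing_past_mirrored_chord[OF a geo s(1) _ _ D ch])
        (use L(1) s ne in \<open>auto simp: D_def diag3_def\<close>)
  qed
  also have "\<dots> \<le> ereal (2 * k * elliptic_K (k\<^sup>2) / a + pi)" using L(2) by simp
  finally show ?thesis by (simp add: k_def)
qed

lemma cut_time_C4:
  assumes a: "0 < a" "a < 1" and geo: "arclength_geodesic a R p" and p: "p 0 \<in> C4 a"
  shows "cut_time a R \<le> ereal pi"
proof -
  have cyl: "p 0 \<in> cylinder" and E: "energy a (p 0) = - a\<^sup>2" using p by (simp_all add: C4_def)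
  note ps = psi_cylinder[OF cyl]
  have "2 * (p 0 $ 3)\<^sup>2 + 2 * (a * p 0 $ 2)\<^sup>2 = 0"
    using E unfolding energy_def cos_double_sin ps(2) by (simp add: power_mult_distrib algebra_simps)
  then have z: "p 0 $ 3 = 0" "p 0 $ 2 = 0"
    using a(1) by (auto simp: add_nonneg_eq_0_iff)
  have const: "p t = p 0" if "0 \<le> t" for t
  proof (rule covector_flow_unique[where a = a and p = p and q = "\<lambda>_. p 0"])
    show "covector_flow a p" using geo by (simp add: covector_flow_def arclength_geodesic_def)
    show "covector_flow a (\<lambda>_. p 0)" using cyl z by (simp add: covector_flow_def cylinder_def)
  qed (use a that in simp_all)
  have R: "(R has_vector_derivative R t ** ctrl a (p t $ 1) (p t $ 2)) (at t within {0..})" if "0 \<le> t" for t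
    using geo that by (simp add: arclength_geodesic_def ctrl_def)
  have "((\<lambda>t. R t $ 2 $ 2) has_real_derivative 0) (at t within {0..})" if "0 \<le> t" for t
    using entry_derivative[OF R[OF that], of 2 2] const[OF that] z
    by (simp add: ctrl_entries matrix_matrix_mult_def sum_3)
  then have "R t $ 2 $ 2 = R 0 $ 2 $ 2" if "0 \<le> t" for t
    using that by (intro has_derivative_zero_unique[of "{0..}"])
      (auto simp: has_field_derivative_def lambda_zero)
  moreover have "R 0 $ 2 $ 2 = 1" using geo by (simp add: arclength_geodesic_def mat_def)
  ultimately show ?thesis by (intro cut_time_le_diameter[OF a geo]) auto
qed

theorem corollary13:
  fixes a :: real and R :: "real \<Rightarrow> real^3^3" and p :: "real \<Rightarrow> real^3"
  assumes "0 < a" and "a < 1"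
    and "arclength_geodesic a R p"
  shows "(p 0 \<in> C1 a \<longrightarrow>
            cut_time a R \<le> ereal (2 * elliptic_K ((modulus a (p 0))\<^sup>2) / a + pi)) \<and>
         (p 0 \<in> C2 a \<longrightarrow>
            cut_time a R \<le> ereal (2 * modulus a (p 0) * elliptic_K ((modulus a (p 0))\<^sup>2) / a + pi)) \<and>
         (p 0 \<in> C3 a \<longrightarrow> cut_time a R \<le> ereal (pi / sqrt (1 - a\<^sup>2) + pi)) \<and>
         (p 0 \<in> C4 a \<longrightarrow> cut_time a R \<le> ereal (2 * pi)) \<and>
         (p 0 \<in> C5 a \<longrightarrow> cut_time a R \<le> ereal (pi / sqrt (1 - a\<^sup>2) + pi))"
proof -
  note a = assms(1,2) and geo = assms(3)
  have "cut_time a R \<le> ereal (pi / sqrt (1 - a\<^sup>2) + pi)"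
  proof (rule cut_time_le_diameter[OF a geo])
    fix t :: real assume "0 \<le> t"
    then have "R t \<in> SO3" using geo by (simp add: arclength_geodesic_def)
    from SO3_entry_le[OF this, of 2 2] have "arccos (R t $ 2 $ 2) \<le> pi"
      by (intro arccos_ubound) auto
    then have "arccos (R t $ 2 $ 2) / sqrt (1 - a\<^sup>2) \<le> pi / sqrt (1 - a\<^sup>2)"
      using contraction_factor(1)[OF a] by (intro divide_right_mono) auto
    then show "pi + arccos (R t $ 2 $ 2) / sqrt (1 - a\<^sup>2) \<le> pi / sqrt (1 - a\<^sup>2) + pi" by simp
  next
    show "0 \<le> pi / sqrt (1 - a\<^sup>2) + pi"
      using contraction_factor(1)[OF a] by (intro add_nonneg_nonneg divide_nonneg_pos) auto
  qed
  moreover have "cut_time a R \<le> ereal (2 * pi)" if "p 0 \<in> C4 a"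
    by (rule order.trans[OF cut_time_C4[OF a geo that]]) simp
  ultimately show ?thesis using cut_time_C1[OF a geo] cut_time_C2[OF a geo] by blast
qed

end
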